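(* Let $\mathcal G:\mathscr P_2(\mathbb R^d)\to\mathbb R$ be locally Lipschitz around $\mu$, and let $\hat{\mathcal G}:L^2_{\mathbb P}\to\mathbb R$ be its lift. Let $X\in L^2_{\mathbb P}$ be such that $X_\#\mathbb P=\mu$. Then $$\forall\beta\in L^2_\mu,\qquad D\hat{\mathcal G}(X)(\beta\circ X)=D\mathcal G(\mu)(\beta).$$ Moreover, $\partial_C\mathcal G(\mu)=\operatorname{Bar}_X[\partial_C\hat{\mathcal G}(X)]$.
   Context: $\mathscr P_2(\mathbb R^d)$ is the space of Borel probability measures on $\mathbb R^d$ with finite second moment, with the 2-Wasserstein distance. $L^2_\mu$ is the space of $\mu$-square-integrable maps $\mathbb R^d\to\mathbb R^d$ with inner product $\langle\cdot,\cdot\rangle_\mu$. $(\Omega,\mathbb P)$ is a fixed complete non-atomic probability space with $\Omega$ a Polish metric space, and $L^2_{\mathbb P}$ is the Hilbert space of square-integrable random variables $\Omega\to\mathbb R^d$. The lift of $\mathcal G$ is $\hat{\mathcal G}(X):=\mathcal G(X_\#\mathbb P)$. On $\mathscr P_2(\mathbb R^d)$: let $C_1(\mathbb R^d;\mathbb R^d)$ be the set of continuous maps $w$ with $\sup_x|w(x)|/(1+|x|)<\infty$. For $\mathcal G$ locally Lipschitz around $\mu$ and $w\in C_1(\mathbb R^d;\mathbb R^d)$, $D\mathcal G(\mu)(w):=\limsup_{\nu\to\mu,\ t\searrow0}\frac{\mathcal G((\mathrm{id}+tw)_\#\nu)-\mathcal G(\nu)}{t}$; this map admits a unique continuous (Lipschitz)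 extension to $L^2_\mu$, still denoted $D\mathcal G(\mu)$. The Clarke subdifferential is $\partial_C\mathcal G(\mu):=\{\Xi\in L^2_\mu:\ \langle\Xi,w\rangle_\mu\le D\mathcal G(\mu)(w)\ \ \forall w\in C_1(\mathbb R^d;\mathbb R^d)\}$. On $L^2_{\mathbb P}$ (classical Clarke objects): for $V\in L^2_{\mathbb P}$, $D\hat{\mathcal G}(X)(V):=\limsup_{t\searrow0,\ Y\to X}\frac{\hat{\mathcal G}(Y+tV)-\hat{\mathcal G}(Y)}{t}$ and $\partial_C\hat{\mathcal G}(X):=\{Z\in L^2_{\mathbb P}:\langle Z,V\rangle_{\mathbb P}\le D\hat{\mathcal G}(X)(V)\ \forall V\in L^2_{\mathbb P}\}$. $\operatorname{Bar}_X:L^2_{\mathbb P}\to L^2_{X_\#\mathbb P}$ is the barycentric projection: $\operatorname{Bar}_X[Z](x)=\int v\,d\xi_x(v)$ where $(X,Z)_\#\mathbb P(dx,dv)=(X_\#\mathbb P)(dx)\,\xi_x(dv)$; equivalently $\operatorname{Bar}_X[Z]\circ X=\mathbb E[Z\mid X]$. *)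

theory Defs
  imports "HOL-Probability.Probability"
begin

text \<open>
  Elements of \<open>L\<^sup>2\<close> are represented by measurable functions. The subsets of \<open>L\<^sup>2\<close> defined
  below (subdifferentials and \<open>Bar\<close>) are closed under a.e. equality, so an equation between two is an
  equation between the corresponding sets of equivalence classes.
\<close>

definition L2 :: "'a measure \<Rightarrow> ('a \<Rightarrow> real ^ 'n) set" where
  "L2 M = {f \<in> borel_measurable M. integrable M (\<lambda>x. (norm (f x))\<^sup>2)}"

definition L2_inner :: "'a measure \<Rightarrow> ('a \<Rightarrow> real ^ 'n) \<Rightarrow> ('a \<Rightarrow> real ^ 'n) \<Rightarrow> real" where
  "L2_inner M f g = (\<integral>x. f x \<bullet> g x \<partial>M)"

definition L2_dist :: "'a measure \<Rightarrow> ('a \<Rightarrow> real ^ 'n) \<Rightarrow> ('a \<Rightarrow> real ^ 'n) \<Rightarrow> real" where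
  "L2_dist M f g = sqrt (\<integral>x. (norm (f x - g x))\<^sup>2 \<partial>M)"

definition L2_nhds :: "'a measure \<Rightarrow> ('a \<Rightarrow> real ^ 'n) \<Rightarrow> ('a \<Rightarrow> real ^ 'n) filter" where
  "L2_nhds M f = (INF e\<in>{0<..}. principal {g \<in> L2 M. L2_dist M g f < e})"

definition P2 :: "(real ^ 'n) measure set" where
  "P2 = {\<mu>. sets \<mu> = sets borel \<and> prob_space \<mu> \<and> integrable \<mu> (\<lambda>x. (norm x)\<^sup>2)}"

definition couplings ::
  "(real ^ 'n) measure \<Rightarrow> (real ^ 'n) measure \<Rightarrow> ((real ^ 'n) \<times> (real ^ 'n)) measure set" where
  "couplings \<mu> \<nu> =
    {\<gamma>. sets \<gamma> = sets (borel \<Otimes>\<^sub>M borel) \<and> distr \<gamma> borel fst = \<mu> \<and> distr \<gamma> borel snd = \<nu>}"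

definition W2 :: "(real ^ 'n) measure \<Rightarrow> (real ^ 'n) measure \<Rightarrow> real" where
  "W2 \<mu> \<nu> = sqrt (INF \<gamma>\<in>couplings \<mu> \<nu>. \<integral>z. (dist (fst z) (snd z))\<^sup>2 \<partial>\<gamma>)"

definition P2_nhds :: "(real ^ 'n) measure \<Rightarrow> (real ^ 'n) measure filter" where
  "P2_nhds \<mu> = (INF e\<in>{0<..}. principal {\<nu> \<in> P2. W2 \<nu> \<mu> < e})"

definition locally_Lipschitz_around :: "((real ^ 'n) measure \<Rightarrow> real) \<Rightarrow> (real ^ 'n) measure \<Rightarrow> bool"
  where
  "locally_Lipschitz_around G \<mu> \<longleftrightarrow>
    (\<exists>r>0. \<exists>L. \<forall>\<nu>\<in>P2. \<forall>\<nu>'\<in>P2. W2 \<nu> \<mu> < r \<longrightarrow> W2 \<nu>' \<mu> < r \<longrightarrow> \<bar>G \<nu> - G \<nu>'\<bar> \<le> L * W2 \<nu> \<nu>')"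

definition C1_growth :: "(real ^ 'n \<Rightarrow> real ^ 'n) set" where
  "C1_growth = {w. continuous_on UNIV w \<and> bdd_above (range (\<lambda>x. norm (w x) / (1 + norm x)))}"

text \<open>
  The upper limits are taken in the extended reals; under the local Lipschitz assumption they are
  finite. As usual for Clarke derivatives, the base point itself is admitted in the limit.
\<close>

definition Clarke_deriv_C1 ::
  "((real ^ 'n) measure \<Rightarrow> real) \<Rightarrow> (real ^ 'n) measure \<Rightarrow> (real ^ 'n \<Rightarrow> real ^ 'n) \<Rightarrow> ereal" where
  "Clarke_deriv_C1 G \<mu> w =
    Limsup (P2_nhds \<mu> \<times>\<^sub>F at_right 0)
      (\<lambda>(\<nu>, t). ereal ((G (distr \<nu> borel (\<lambda>x. x + t *\<^sub>R w x)) - G \<nu>) / t))"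

text \<open>
  The unique continuous extension of \<^term>\<open>Clarke_deriv_C1 G \<mu>\<close> to \<^term>\<open>L2 \<mu>\<close>; the value \<open>0\<close>
  outside \<^term>\<open>L2 \<mu>\<close> is only there to make the extension unique as a total function.
\<close>

definition Clarke_deriv ::
  "((real ^ 'n) measure \<Rightarrow> real) \<Rightarrow> (real ^ 'n) measure \<Rightarrow> (real ^ 'n \<Rightarrow> real ^ 'n) \<Rightarrow> ereal" where
  "Clarke_deriv G \<mu> =
    (THE E. (\<forall>w\<in>C1_growth. E w = Clarke_deriv_C1 G \<mu> w) \<and>
            (\<forall>\<beta>\<in>L2 \<mu>. (E \<longlongrightarrow> E \<beta>) (L2_nhds \<mu> \<beta>)) \<and>
            (\<forall>\<beta>. \<beta> \<notin> L2 \<mu> \<longrightarrow> E \<beta> = 0))"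

definition Clarke_subdiff ::
  "((real ^ 'n) measure \<Rightarrow> real) \<Rightarrow> (real ^ 'n) measure \<Rightarrow> (real ^ 'n \<Rightarrow> real ^ 'n) set" where
  "Clarke_subdiff G \<mu> =
    {\<Xi> \<in> L2 \<mu>. \<forall>w\<in>C1_growth. ereal (L2_inner \<mu> \<Xi> w) \<le> Clarke_deriv_C1 G \<mu> w}"

definition L2_Clarke_deriv ::
  "'w measure \<Rightarrow> (('w \<Rightarrow> real ^ 'n) \<Rightarrow> real) \<Rightarrow> ('w \<Rightarrow> real ^ 'n) \<Rightarrow> ('w \<Rightarrow> real ^ 'n) \<Rightarrow> ereal" where
  "L2_Clarke_deriv M F X V =
    Limsup (at_right 0 \<times>\<^sub>F L2_nhds M X)
      (\<lambda>(t, Y). ereal ((F (\<lambda>\<omega>. Y \<omega> + t *\<^sub>R V \<omega>) - F Y) / t))"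

definition L2_Clarke_subdiff ::
  "'w measure \<Rightarrow> (('w \<Rightarrow> real ^ 'n) \<Rightarrow> real) \<Rightarrow> ('w \<Rightarrow> real ^ 'n) \<Rightarrow> ('w \<Rightarrow> real ^ 'n) set" where
  "L2_Clarke_subdiff M F X =
    {Z \<in> L2 M. \<forall>V\<in>L2 M. ereal (L2_inner M Z V) \<le> L2_Clarke_deriv M F X V}"

definition lift :: "'w measure \<Rightarrow> ((real ^ 'n) measure \<Rightarrow> real) \<Rightarrow> ('w \<Rightarrow> real ^ 'n) \<Rightarrow> real" where
  "lift M G X = G (distr M borel X)"

definition non_atomic :: "'w measure \<Rightarrow> bool" where
  "non_atomic M \<longleftrightarrow>
    (\<forall>A\<in>sets M. 0 < emeasure M A \<longrightarrow>
      (\<exists>B\<in>sets M. B \<subseteq> A \<and> 0 < emeasure M B \<and> emeasure M B < emeasure M A))"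

text \<open>
  \<open>Bar M X Z\<close> is the almost-everywhere class of the barycentric projection \<open>b\<close> of \<open>Z\<close>, given by
  \<open>b \<circ> X = E[Z | X]\<close>. The library's conditional expectation is real-valued, hence it is applied to
  each coordinate; the conditioning sigma-algebra is the one generated by \<open>X\<close>. The lemma
  \<open>Bar_iff_disintegration\<close> below identifies it with the barycenters of the
  disintegration of the law of \<open>(X, Z)\<close>.
\<close>

definition Bar :: "'w measure \<Rightarrow> ('w \<Rightarrow> real ^ 'n) \<Rightarrow> ('w \<Rightarrow> real ^ 'n) \<Rightarrow> (real ^ 'n \<Rightarrow> real ^ 'n) set"
  where
  "Bar M X Z =
    {b \<in> L2 (distr M borel X).
      \<forall>i. AE \<omega> in M.
        b (X \<omega>) $ i = real_cond_exp M (vimage_algebra (space M) X borel) (\<lambda>\<omega>. Z \<omega> $ i) \<omega>}"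

definition disintegration ::
  "'w measure \<Rightarrow> ('w \<Rightarrow> real ^ 'n) \<Rightarrow> ('w \<Rightarrow> real ^ 'n) \<Rightarrow> (real ^ 'n \<Rightarrow> (real ^ 'n) measure) \<Rightarrow> bool" where
  "disintegration M X Z \<xi> \<longleftrightarrow>
    \<xi> \<in> borel \<rightarrow>\<^sub>M prob_algebra borel \<and>
    distr M (borel \<Otimes>\<^sub>M borel) (\<lambda>\<omega>. (X \<omega>, Z \<omega>)) =
      distr M borel X \<bind> (\<lambda>x. distr (\<xi> x) (borel \<Otimes>\<^sub>M borel) (\<lambda>v. (x, v)))"

lemma nn_integral_disintegration:
  fixes X Z :: "'w \<Rightarrow> real ^ 'n"
  assumes M: "prob_space M" and X [measurable]: "X \<in> borel_measurable M"
    and Z [measurable]: "Z \<in> borel_measurable M"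
    and dis: "disintegration M X Z \<xi>"
    and h [measurable]: "h \<in> borel_measurable (borel \<Otimes>\<^sub>M borel)"
  shows "(\<integral>\<^sup>+\<omega>. h (X \<omega>, Z \<omega>) \<partial>M) = (\<integral>\<^sup>+x. (\<integral>\<^sup>+v. h (x, v) \<partial>\<xi> x) \<partial>distr M borel X)"
proof -
  have \<xi>: "\<xi> \<in> borel \<rightarrow>\<^sub>M prob_algebra borel" using dis by (simp add: disintegration_def)
  have \<xi>s [measurable]: "\<xi> \<in> borel \<rightarrow>\<^sub>M subprob_algebra borel"
    using \<xi> by (rule measurable_prob_algebraD)
  have sets_\<xi> [measurable_cong]: "sets (\<xi> x) = sets borel" for x
    using subprob_measurableD(2)[OF \<xi>s] by simp
  have K: "(\<lambda>x. distr (\<xi> x) (borel \<Otimes>\<^sub>M borel) (\<lambda>v. (x, v)))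
      \<in> distr M borel X \<rightarrow>\<^sub>M subprob_algebra (borel \<Otimes>\<^sub>M borel)"
    by (rule measurable_distr2[where M = borel]) (auto intro: measurable_compose[OF _ \<xi>s])
  have "(\<integral>\<^sup>+\<omega>. h (X \<omega>, Z \<omega>) \<partial>M) =
      (\<integral>\<^sup>+z. h z \<partial>distr M (borel \<Otimes>\<^sub>M borel) (\<lambda>\<omega>. (X \<omega>, Z \<omega>)))"
    by (subst nn_integral_distr) auto
  also have "\<dots> = (\<integral>\<^sup>+z. h z \<partial>(distr M borel X \<bind>
      (\<lambda>x. distr (\<xi> x) (borel \<Otimes>\<^sub>M borel) (\<lambda>v. (x, v)))))"
    using dis by (simp add: disintegration_def)
  also have "\<dots> = (\<integral>\<^sup>+x. (\<integral>\<^sup>+z. h z \<partial>distr (\<xi> x) (borel \<Otimes>\<^sub>M borel) (\<lambda>v. (x, v))) \<partial>distr M borel X)"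
    by (rule nn_integral_bind[OF h K])
  also have "\<dots> = (\<integral>\<^sup>+x. (\<integral>\<^sup>+v. h (x, v) \<partial>\<xi> x) \<partial>distr M borel X)"
    by (intro nn_integral_cong nn_integral_distr) auto
  finally show ?thesis .
qed

lemma integral_disintegration:
  fixes X Z :: "'w \<Rightarrow> real ^ 'n" and h :: "(real ^ 'n) \<times> (real ^ 'n) \<Rightarrow> real"
  assumes M: "prob_space M" and X [measurable]: "X \<in> borel_measurable M"
    and Z [measurable]: "Z \<in> borel_measurable M"
    and dis: "disintegration M X Z \<xi>"
    and h [measurable]: "h \<in> borel_measurable (borel \<Otimes>\<^sub>M borel)"
    and int: "integrable M (\<lambda>\<omega>. h (X \<omega>, Z \<omega>))"
  shows "AE x in distr M borel X. integrable (\<xi> x) (\<lambda>v. h (x, v))"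
    and "integrable (distr M borel X) (\<lambda>x. \<integral>v. h (x, v) \<partial>\<xi> x)"
    and "(\<integral>\<omega>. h (X \<omega>, Z \<omega>) \<partial>M) = (\<integral>x. (\<integral>v. h (x, v) \<partial>\<xi> x) \<partial>distr M borel X)"
proof -
  have \<xi>s [measurable]: "\<xi> \<in> borel \<rightarrow>\<^sub>M subprob_algebra borel"
    using dis by (auto simp: disintegration_def intro: measurable_prob_algebraD)
  have sets_\<xi> [measurable_cong]: "sets (\<xi> x) = sets borel" for x
    using subprob_measurableD(2)[OF \<xi>s] by simp
  let ?\<mu> = "distr M borel X"
  define P where "P x = (\<integral>\<^sup>+v. ennreal (h (x, v)) \<partial>\<xi> x)" for x
  define N where "N x = (\<integral>\<^sup>+v. ennreal (- h (x, v)) \<partial>\<xi> x)" for x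
  have P [measurable]: "P \<in> borel_measurable borel"
    unfolding P_def by (rule nn_integral_measurable_subprob_algebra2[where N = borel]) auto
  have N [measurable]: "N \<in> borel_measurable borel"
    unfolding N_def by (rule nn_integral_measurable_subprob_algebra2[where N = borel]) auto
  have eP: "(\<integral>\<^sup>+\<omega>. ennreal (h (X \<omega>, Z \<omega>)) \<partial>M) = (\<integral>\<^sup>+x. P x \<partial>?\<mu>)"
    unfolding P_def by (rule nn_integral_disintegration[OF M X Z dis]) auto
  have eN: "(\<integral>\<^sup>+\<omega>. ennreal (- h (X \<omega>, Z \<omega>)) \<partial>M) = (\<integral>\<^sup>+x. N x \<partial>?\<mu>)"
    unfolding N_def by (rule nn_integral_disintegration[OF M X Z dis, of "\<lambda>z. ennreal (- h z)"]) auto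
  have fP: "(\<integral>\<^sup>+x. P x \<partial>?\<mu>) \<noteq> \<infinity>" and fN: "(\<integral>\<^sup>+x. N x \<partial>?\<mu>) \<noteq> \<infinity>"
    using int unfolding real_integrable_def eP eN by auto
  have aP: "AE x in ?\<mu>. P x \<noteq> \<infinity>" using fP by (intro nn_integral_PInf_AE) auto
  have aN: "AE x in ?\<mu>. N x \<noteq> \<infinity>" using fN by (intro nn_integral_PInf_AE) auto
  show ai: "AE x in ?\<mu>. integrable (\<xi> x) (\<lambda>v. h (x, v))"
    using aP aN by eventually_elim (auto simp: real_integrable_def P_def N_def)
  have ev: "AE x in ?\<mu>. (\<integral>v. h (x, v) \<partial>\<xi> x) = enn2real (P x) - enn2real (N x)"
    using ai by eventually_elim (simp add: real_lebesgue_integral_def P_def N_def)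
  have intP: "integrable ?\<mu> (\<lambda>x. enn2real (P x))" and valP: "(\<integral>x. enn2real (P x) \<partial>?\<mu>) = enn2real (\<integral>\<^sup>+x. P x \<partial>?\<mu>)"
  proof -
    have *: "(\<integral>\<^sup>+x. ennreal (enn2real (P x)) \<partial>?\<mu>) = (\<integral>\<^sup>+x. P x \<partial>?\<mu>)"
      using aP by (intro nn_integral_cong_AE) (auto simp: less_top)
    show "integrable ?\<mu> (\<lambda>x. enn2real (P x))"
      using fP by (intro integrableI_nonneg) (auto simp: * less_top)
    show "(\<integral>x. enn2real (P x) \<partial>?\<mu>) = enn2real (\<integral>\<^sup>+x. P x \<partial>?\<mu>)"
      by (subst integral_eq_nn_integral) (auto simp: *)
  qed
  have intN: "integrable ?\<mu> (\<lambda>x. enn2real (N x))" and valN: "(\<integral>x. enn2real (N x) \<partial>?\<mu>) = enn2real (\<integral>\<^sup>+x. N x \<partial>?\<mu>)"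
  proof -
    have *: "(\<integral>\<^sup>+x. ennreal (enn2real (N x)) \<partial>?\<mu>) = (\<integral>\<^sup>+x. N x \<partial>?\<mu>)"
      using aN by (intro nn_integral_cong_AE) (auto simp: less_top)
    show "integrable ?\<mu> (\<lambda>x. enn2real (N x))"
      using fN by (intro integrableI_nonneg) (auto simp: * less_top)
    show "(\<integral>x. enn2real (N x) \<partial>?\<mu>) = enn2real (\<integral>\<^sup>+x. N x \<partial>?\<mu>)"
      by (subst integral_eq_nn_integral) (auto simp: *)
  qed
  have K: "(\<lambda>x. distr (\<xi> x) (borel \<Otimes>\<^sub>M borel) (\<lambda>v. (x, v)))
      \<in> borel \<rightarrow>\<^sub>M subprob_algebra (borel \<Otimes>\<^sub>M borel)"
    by (rule measurable_distr2[where M = borel]) auto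
  have "(\<integral>z. h z \<partial>distr (\<xi> x) (borel \<Otimes>\<^sub>M borel) (\<lambda>v. (x, v))) = (\<integral>v. h (x, v) \<partial>\<xi> x)" for x
    by (intro integral_distr) auto
  then have m: "(\<lambda>x. \<integral>v. h (x, v) \<partial>\<xi> x) \<in> borel_measurable ?\<mu>"
    using measurable_compose[OF K integral_measurable_subprob_algebra[OF h]] by simp
  show "integrable ?\<mu> (\<lambda>x. \<integral>v. h (x, v) \<partial>\<xi> x)"
    using Bochner_Integration.integrable_diff[OF intP intN] ev m
    by (subst integrable_cong_AE) auto
  have "(\<integral>x. (\<integral>v. h (x, v) \<partial>\<xi> x) \<partial>?\<mu>) = (\<integral>x. enn2real (P x) - enn2real (N x) \<partial>?\<mu>)"
    using ev m by (intro integral_cong_AE) auto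
  also have "\<dots> = enn2real (\<integral>\<^sup>+x. P x \<partial>?\<mu>) - enn2real (\<integral>\<^sup>+x. N x \<partial>?\<mu>)"
    using intP intN by (simp add: valP valN)
  also have "\<dots> = (\<integral>\<omega>. h (X \<omega>, Z \<omega>) \<partial>M)"
    using int by (simp add: real_lebesgue_integral_def eP eN)
  finally show "(\<integral>\<omega>. h (X \<omega>, Z \<omega>) \<partial>M) = (\<integral>x. (\<integral>v. h (x, v) \<partial>\<xi> x) \<partial>?\<mu>)" by simp
qed

lemma Bar_iff_disintegration:
  fixes X Z :: "'w \<Rightarrow> real ^ 'n"
  assumes M: "prob_space M" and X [measurable]: "X \<in> borel_measurable M" and Z: "Z \<in> L2 M"
    and dis: "disintegration M X Z \<xi>" and b: "b \<in> L2 (distr M borel X)"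
  shows "b \<in> Bar M X Z \<longleftrightarrow> (AE x in distr M borel X. b x = (\<integral>v. v \<partial>\<xi> x))"
proof -
  interpret prob_space M by (rule M)
  let ?\<mu> = "distr M borel X" and ?F = "vimage_algebra (space M) X borel"
  have Zm [measurable]: "Z \<in> borel_measurable M" and Z2: "integrable M (\<lambda>x. (norm (Z x))\<^sup>2)"
    using Z by (auto simp: L2_def)
  have bm [measurable]: "b \<in> borel_measurable borel" using b by (simp add: L2_def)
  have \<xi>s [measurable]: "\<xi> \<in> borel \<rightarrow>\<^sub>M subprob_algebra borel"
    using dis by (auto simp: disintegration_def intro: measurable_prob_algebraD)
  have sets_\<xi> [measurable_cong]: "sets (\<xi> x) = sets borel" for x
    using subprob_measurableD(2)[OF \<xi>s] by simp
  define g where "g x = (\<integral>v. v \<partial>\<xi> x)" for x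
  have gm [measurable]: "g \<in> borel_measurable borel"
    unfolding g_def
    using measurable_compose[OF \<xi>s integral_measurable_subprob_algebra[where f = "\<lambda>v. v" and N = borel]] by simp
  have XF: "X \<in> ?F \<rightarrow>\<^sub>M borel" by (rule measurable_vimage_algebra1) auto
  have sub: "subalgebra M ?F"
    unfolding subalgebra_def by (auto simp: sets_vimage_algebra2 intro: measurable_sets[OF X])
  interpret F: finite_measure_subalgebra M ?F
    by (intro finite_measure_subalgebra.intro finite_measure_subalgebra_axioms.intro sub finite_measure_axioms)
  have intn: "integrable M (\<lambda>\<omega>. norm (Z \<omega>))"
    by (rule square_integrable_imp_integrable[OF _ Z2]) measurable
  have intZ: "integrable M Z"
    using intn by (simp add: integrable_norm_iff)
  have "AE x in ?\<mu>. integrable (\<xi> x) (\<lambda>v. norm v)"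
    using integral_disintegration(1)[OF M X Zm dis, where h = "\<lambda>z. norm (snd z)"] intn
    unfolding snd_conv by measurable
  then have iv: "AE x in ?\<mu>. integrable (\<xi> x) (\<lambda>v. v)"
    by eventually_elim (subst (asm) integrable_norm_iff, auto)
  have gi: "AE x in ?\<mu>. \<forall>i. g x $ i = (\<integral>v. v $ i \<partial>\<xi> x)"
    using iv
  proof eventually_elim
    case (elim x)
    show ?case
      unfolding g_def using integral_bounded_linear[OF bounded_linear_vec_nth elim] by simp
  qed
  have nth: "(\<lambda>v::real ^ 'n. v $ i) \<in> borel_measurable borel" for i
    by (intro borel_measurable_continuous_onI continuous_intros)
  have snd_nth [measurable]:
    "(\<lambda>z::(real ^ 'n) \<times> (real ^ 'n). snd z $ i) \<in> borel_measurable (borel \<Otimes>\<^sub>M borel)" for i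
    by (rule measurable_compose[OF measurable_snd nth])
  have g_nth [measurable]: "(\<lambda>x. g x $ i) \<in> borel_measurable borel" for i
    by (rule measurable_compose[OF gm nth])
  have ce: "AE \<omega> in M. real_cond_exp M ?F (\<lambda>\<omega>. Z \<omega> $ i) \<omega> = g (X \<omega>) $ i" for i
  proof (rule F.real_cond_exp_charact)
    show iZ: "integrable M (\<lambda>\<omega>. Z \<omega> $ i)"
      by (rule integrable_bounded_linear[OF bounded_linear_vec_nth intZ])
    have "integrable ?\<mu> (\<lambda>x. \<integral>v. v $ i \<partial>\<xi> x)"
      using integral_disintegration(2)[OF M X Zm dis snd_nth, of i] iZ unfolding snd_conv by blast
    moreover have m1: "(\<lambda>x. \<integral>v. v $ i \<partial>\<xi> x) \<in> borel_measurable borel"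
      using measurable_compose[OF \<xi>s integral_measurable_subprob_algebra[OF nth]] by simp
    ultimately have "integrable ?\<mu> (\<lambda>x. g x $ i)"
      using gi by (subst integrable_cong_AE) auto
    then show "integrable M (\<lambda>\<omega>. g (X \<omega>) $ i)"
      by (subst (asm) integrable_distr_eq) auto
    show "(\<lambda>\<omega>. g (X \<omega>) $ i) \<in> borel_measurable ?F"
      by (rule measurable_compose[OF XF g_nth])
    fix A assume "A \<in> sets ?F"
    then obtain B where [measurable]: "B \<in> sets borel" and A: "A = X -` B \<inter> space M"
      by (auto simp: sets_vimage_algebra2)
    have "(\<integral>\<omega>\<in>A. Z \<omega> $ i \<partial>M) = (\<integral>\<omega>. indicator B (X \<omega>) * Z \<omega> $ i \<partial>M)"
      unfolding set_lebesgue_integral_def A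
      by (intro Bochner_Integration.integral_cong) (auto simp: indicator_def)
    also have "\<dots> = (\<integral>x. (\<integral>v. indicator B x * v $ i \<partial>\<xi> x) \<partial>?\<mu>)"
    proof -
      have "(\<lambda>z::(real^'n) \<times> (real^'n). indicator B (fst z) * snd z $ i) \<in> borel_measurable (borel \<Otimes>\<^sub>M borel)"
        by measurable
      moreover have "integrable M (\<lambda>\<omega>. indicator B (X \<omega>) * Z \<omega> $ i)"
        using integrable_mult_indicator[OF measurable_sets[OF X \<open>B \<in> sets borel\<close>] iZ]
        by (subst Bochner_Integration.integrable_cong[OF refl]) (auto simp: indicator_def)
      ultimately show ?thesis
        using integral_disintegration(3)[OF M X Zm dis, where h = "\<lambda>z. indicator B (fst z) * snd z $ i"]
        unfolding fst_conv snd_conv by blast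
    qed
    also have "\<dots> = (\<integral>x. indicator B x * g x $ i \<partial>?\<mu>)"
      using gi m1 by (intro integral_cong_AE) (auto elim!: eventually_mono)
    also have "\<dots> = (\<integral>\<omega>. indicator B (X \<omega>) * g (X \<omega>) $ i \<partial>M)"
      by (subst integral_distr) auto
    also have "\<dots> = (\<integral>\<omega>\<in>A. g (X \<omega>) $ i \<partial>M)"
      unfolding set_lebesgue_integral_def A
      by (intro Bochner_Integration.integral_cong) (auto simp: indicator_def)
    finally show "(\<integral>\<omega>\<in>A. Z \<omega> $ i \<partial>M) = (\<integral>\<omega>\<in>A. g (X \<omega>) $ i \<partial>M)" .
  qed
  have "b \<in> Bar M X Z \<longleftrightarrow> (\<forall>i. AE \<omega> in M. b (X \<omega>) $ i = g (X \<omega>) $ i)"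
  proof -
    have "(AE \<omega> in M. b (X \<omega>) $ i = real_cond_exp M ?F (\<lambda>\<omega>. Z \<omega> $ i) \<omega>) \<longleftrightarrow>
        (AE \<omega> in M. b (X \<omega>) $ i = g (X \<omega>) $ i)" for i
      by (rule eventually_subst) (use ce[of i] in \<open>eventually_elim, simp\<close>)
    then show ?thesis using b by (simp add: Bar_def)
  qed
  also have "\<dots> \<longleftrightarrow> (AE \<omega> in M. b (X \<omega>) = g (X \<omega>))"
    by (simp add: AE_all_countable[symmetric] vec_eq_iff)
  also have "\<dots> \<longleftrightarrow> (AE x in ?\<mu>. b x = g x)"
    by (subst AE_distr_iff) auto
  finally show ?thesis by (simp add: g_def)
qed

end

theory Submission
  imports Defs
begin

text \<open>
  For continuous \<open>w\<close> of linear growth the two difference quotients can be compared because every law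
  \<open>\<nu>\<close> close to \<open>\<mu>\<close> is the law of some \<open>Y\<close> close to \<open>X\<close>, and because moving \<open>Y\<close> along \<open>w \<circ> Y\<close> or
  along \<open>w \<circ> X\<close> makes a difference of order \<open>o(t)\<close>. The Clarke derivative of the lift is Lipschitz in
  the direction, so, \<open>F\<close> being the lift, \<open>\<beta> \<mapsto> DF(X)(\<beta> \<circ> X)\<close> is the continuous extension to
  \<open>L\<^sup>2\<close>. For the subdifferentials, \<open>b\<close> is the barycentric projection of \<open>Z\<close> exactly when \<open>Z\<close> and \<open>b \<circ> X\<close> have the
  same inner product with all \<open>\<beta> \<circ> X\<close>; hence one inclusion is immediate, and the other one extends
  the functional \<open>\<beta> \<circ> X \<mapsto> \<langle>\<Xi>, \<beta>\<rangle>\<close> to \<open>L\<^sup>2\<close> below the sublinear Clarke derivative.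
\<close>

section \<open>The space of square-integrable maps\<close>

text \<open>Two obstacles shape the proof. First, X may generate all the randomness of the
  underlying space (it can be injective), so nothing independent of X is left from which to draw Y
  by the conditional laws of a coupling of \<nu> and \<mu>. A rounding of X to countably many values
  removes this: on each of its level sets the restricted measure still has no atoms and can be
  mapped onto any law of the same mass. Second, on laws the direction w travels with \<nu>, whereas
  on \<open>L2 M\<close> the direction \<open>w \<circ> X\<close> is frozen while the base point Y
  varies. Exchanging the two costs at most L t times the distance of \<open>w \<circ> Y\<close> and
  \<open>w \<circ> X\<close>, which is o(t) because composition with w is continuous in the mean
  square. That holds for continuous w of linear growth; for a general element of
  \<open>L2 \<mu>\<close> the map \<open>\<beta> \<circ> Y\<close> need not even be square
  integrable. So the two derivatives are compared on \<open>C1_growth\<close> only, and density does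
  the rest. Since elements of \<open>L2 M\<close> are functions and \<open>L2_norm\<close> is a
  seminorm, the functional analysis is done by hand with minimising and fast Cauchy
  sequences.\<close>

definition L2_norm :: "'a measure \<Rightarrow> ('a \<Rightarrow> real ^ 'n) \<Rightarrow> real" where
  "L2_norm M f = sqrt (\<integral>x. (norm (f x))\<^sup>2 \<partial>M)"

lemma L2_dist_eq_norm: "L2_dist M f g = L2_norm M (\<lambda>x. f x - g x)"
  by (simp add: L2_dist_def L2_norm_def)

lemma L2_measurable: "f \<in> L2 M \<Longrightarrow> f \<in> borel_measurable M"
  by (simp add: L2_def)

lemma L2_integrable: "f \<in> L2 M \<Longrightarrow> integrable M (\<lambda>x. (norm (f x))\<^sup>2)"
  by (simp add: L2_def)

lemma norm_add_square_le:
  fixes a b :: "'a :: real_normed_vector"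
  shows "(norm (a + b))\<^sup>2 \<le> 2 * (norm a)\<^sup>2 + 2 * (norm b)\<^sup>2"
proof -
  have "(norm (a + b))\<^sup>2 \<le> (norm a + norm b)\<^sup>2"
    by (intro power_mono norm_triangle_ineq norm_ge_zero)
  also have "\<dots> \<le> 2 * (norm a)\<^sup>2 + 2 * (norm b)\<^sup>2"
    using sum_squares_bound[of "norm a" "norm b"] by (simp add: power2_sum)
  finally show ?thesis .
qed

lemma L2_add: "f \<in> L2 M \<Longrightarrow> g \<in> L2 M \<Longrightarrow> (\<lambda>x. f x + g x) \<in> L2 M"
proof -
  assume f: "f \<in> L2 M" and g: "g \<in> L2 M"
  note [measurable] = L2_measurable[OF f] L2_measurable[OF g]
  have "integrable M (\<lambda>x. (norm (f x + g x))\<^sup>2)"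
    by (rule Bochner_Integration.integrable_bound
        [of _ "\<lambda>x. 2 * (norm (f x))\<^sup>2 + 2 * (norm (g x))\<^sup>2"])
      (use L2_integrable[OF f] L2_integrable[OF g] norm_add_square_le in auto)
  then show ?thesis by (simp add: L2_def)
qed

lemma L2_scaleR: "f \<in> L2 M \<Longrightarrow> (\<lambda>x. c *\<^sub>R f x) \<in> L2 M"
  by (auto simp: L2_def power_mult_distrib)

lemma L2_uminus: "f \<in> L2 M \<Longrightarrow> (\<lambda>x. - f x) \<in> L2 M"
  by (auto simp: L2_def)

lemma L2_diff: "f \<in> L2 M \<Longrightarrow> g \<in> L2 M \<Longrightarrow> (\<lambda>x. f x - g x) \<in> L2 M"
  using L2_add[OF _ L2_uminus, of f M g] by simp

lemma L2_zero: "(\<lambda>x. 0) \<in> L2 M"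
  by (simp add: L2_def)

lemmas L2_intros = L2_add L2_scaleR L2_uminus L2_diff L2_zero

lemma (in finite_measure) L2_const: "(\<lambda>x. c) \<in> L2 M"
  by (simp add: L2_def)

lemma (in finite_measure) L2_bounded:
  fixes f :: "'a \<Rightarrow> real ^ 'n"
  assumes f: "f \<in> borel_measurable M" and le: "\<And>x. x \<in> space M \<Longrightarrow> norm (f x) \<le> B"
  shows "f \<in> L2 M"
proof -
  note [measurable] = f
  have "integrable M (\<lambda>x. (norm (f x))\<^sup>2)"
    by (rule integrable_const_bound[of _ "B\<^sup>2"]) (use le in \<open>auto intro!: power_mono AE_I2\<close>)
  then show ?thesis using f by (simp add: L2_def)
qed

lemma L2_norm_nonneg: "0 \<le> L2_norm M f"
  by (simp add: L2_norm_def)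

lemma L2_norm_square: "(L2_norm M f)\<^sup>2 = (\<integral>x. (norm (f x))\<^sup>2 \<partial>M)"
  by (simp add: L2_norm_def)

lemma L2_norm_zero [simp]: "L2_norm M (\<lambda>x. 0) = 0"
  by (simp add: L2_norm_def)

lemma L2_norm_scaleR: "L2_norm M (\<lambda>x. c *\<^sub>R f x) = \<bar>c\<bar> * L2_norm M f"
  by (simp add: L2_norm_def power_mult_distrib real_sqrt_mult)

lemma L2_norm_uminus: "L2_norm M (\<lambda>x. - f x) = L2_norm M f"
  by (simp add: L2_norm_def)

lemma L2_norm_diff_commute: "L2_norm M (\<lambda>x. f x - g x) = L2_norm M (\<lambda>x. g x - f x)"
  by (simp add: L2_norm_def norm_minus_commute)

lemma L2_inner_integrable:
  assumes f: "f \<in> L2 M" and g: "g \<in> L2 M"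
  shows "integrable M (\<lambda>x. f x \<bullet> g x)"
proof -
  note [measurable] = L2_measurable[OF f] L2_measurable[OF g]
  have le: "norm (f x \<bullet> g x) \<le> norm ((norm (f x))\<^sup>2 + (norm (g x))\<^sup>2)" for x
  proof -
    have "\<bar>f x \<bullet> g x\<bar> \<le> norm (f x) * norm (g x)" by (rule Cauchy_Schwarz_ineq2)
    moreover have "2 * (norm (f x) * norm (g x)) \<le> (norm (f x))\<^sup>2 + (norm (g x))\<^sup>2"
      using sum_squares_bound[of "norm (f x)" "norm (g x)"] by simp
    moreover have "0 \<le> norm (f x) * norm (g x)" by simp
    ultimately show ?thesis unfolding real_norm_def by linarith
  qed
  show ?thesis
  proof (rule Bochner_Integration.integrable_bound)
    show "integrable M (\<lambda>x. (norm (f x))\<^sup>2 + (norm (g x))\<^sup>2)"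
      by (intro Bochner_Integration.integrable_add L2_integrable f g)
    show "AE x in M. norm (f x \<bullet> g x) \<le> norm ((norm (f x))\<^sup>2 + (norm (g x))\<^sup>2)"
      by (rule AE_I2) (rule le)
  qed measurable
qed

lemma L2_inner_add_right:
  "f \<in> L2 M \<Longrightarrow> g \<in> L2 M \<Longrightarrow> h \<in> L2 M \<Longrightarrow>
    L2_inner M f (\<lambda>x. g x + h x) = L2_inner M f g + L2_inner M f h"
  by (simp add: L2_inner_def inner_add_right L2_inner_integrable)

lemma L2_inner_diff_right:
  "f \<in> L2 M \<Longrightarrow> g \<in> L2 M \<Longrightarrow> h \<in> L2 M \<Longrightarrow>
    L2_inner M f (\<lambda>x. g x - h x) = L2_inner M f g - L2_inner M f h"
  by (simp add: L2_inner_def inner_diff_right L2_inner_integrable)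

lemma L2_inner_diff_left:
  "f \<in> L2 M \<Longrightarrow> g \<in> L2 M \<Longrightarrow> h \<in> L2 M \<Longrightarrow>
    L2_inner M (\<lambda>x. g x - h x) f = L2_inner M g f - L2_inner M h f"
  by (simp add: L2_inner_def inner_diff_left L2_inner_integrable)

lemma L2_inner_scaleR_right: "L2_inner M f (\<lambda>x. c *\<^sub>R g x) = c * L2_inner M f g"
  by (simp add: L2_inner_def)

lemma L2_inner_uminus_right: "L2_inner M f (\<lambda>x. - g x) = - L2_inner M f g"
  by (simp add: L2_inner_def)

lemma L2_inner_uminus_left: "L2_inner M (\<lambda>x. - f x) g = - L2_inner M f g"
  by (simp add: L2_inner_def)

lemma L2_norm_add_square:
  assumes "f \<in> L2 M" "g \<in> L2 M"
  shows "(L2_norm M (\<lambda>x. f x + g x))\<^sup>2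
    = (L2_norm M f)\<^sup>2 + 2 * L2_inner M f g + (L2_norm M g)\<^sup>2"
proof -
  have "(norm (f x + g x))\<^sup>2 = (norm (f x))\<^sup>2 + 2 * (f x \<bullet> g x) + (norm (g x))\<^sup>2" for x
    by (simp add: power2_norm_eq_inner inner_add inner_commute)
  then show ?thesis
    using assms by (simp add: L2_norm_square L2_inner_def L2_inner_integrable L2_integrable)
qed

lemma L2_norm_add_scaleR_square:
  assumes "f \<in> L2 M" "g \<in> L2 M"
  shows "(L2_norm M (\<lambda>x. f x + c *\<^sub>R g x))\<^sup>2
    = (L2_norm M f)\<^sup>2 + 2 * c * L2_inner M f g + c\<^sup>2 * (L2_norm M g)\<^sup>2"
  using L2_norm_add_square[OF assms(1) L2_scaleR[OF assms(2)], of c]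
  by (simp add: L2_inner_scaleR_right L2_norm_scaleR power_mult_distrib)

lemma L2_parallelogram:
  assumes f: "f \<in> L2 M" and g: "g \<in> L2 M"
  shows "(L2_norm M (\<lambda>x. f x + g x))\<^sup>2 + (L2_norm M (\<lambda>x. f x - g x))\<^sup>2
    = 2 * (L2_norm M f)\<^sup>2 + 2 * (L2_norm M g)\<^sup>2"
  using L2_norm_add_scaleR_square[OF f g, of 1] L2_norm_add_scaleR_square[OF f g, of "-1"] by simp

text \<open>The quadratic polynomial t |-> ||f + t g||^2 is non-negative. For a seminorm its leading
  coefficient may vanish without g being zero, so the degenerate case is treated separately.\<close>

lemma L2_Cauchy_Schwarz:
  assumes f: "f \<in> L2 M" and g: "g \<in> L2 M"
  shows "\<bar>L2_inner M f g\<bar> \<le> L2_norm M f * L2_norm M g"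
proof -
  define a b c where "a = (L2_norm M f)\<^sup>2" and "b = L2_inner M f g" and "c = (L2_norm M g)\<^sup>2"
  have *: "0 \<le> a + 2 * t * b + t\<^sup>2 * c" for t
    using L2_norm_add_scaleR_square[OF f g, of t] zero_le_power2[of "L2_norm M (\<lambda>x. f x + t *\<^sub>R g x)"]
    by (simp add: a_def b_def c_def)
  have "b\<^sup>2 \<le> a * c"
  proof (cases "c = 0")
    case True
    have "b = 0"
    proof (rule ccontr)
      assume "b \<noteq> 0"
      \<comment> \<open>At this t the polynomial, now affine, takes the value -1.\<close>
      then show False using *[of "- (a + 1) / (2 * b)"] True by (simp add: field_simps)
    qed
    then show ?thesis using True by simp
  next
    case False
    then have c: "c > 0" by (simp add: c_def)
    \<comment> \<open>The minimiser of the polynomial.\<close>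
    have "0 \<le> a + 2 * (- b / c) * b + (- b / c)\<^sup>2 * c" by (rule *)
    also have "\<dots> = (a * c - b\<^sup>2) / c"
      using c by (simp add: field_simps power2_eq_square)
    finally show ?thesis using c by (simp add: zero_le_divide_iff)
  qed
  then have "\<bar>b\<bar>\<^sup>2 \<le> (L2_norm M f * L2_norm M g)\<^sup>2"
    by (simp add: a_def c_def power_mult_distrib)
  then show ?thesis unfolding b_def
    by (rule power2_le_imp_le) (simp add: L2_norm_nonneg)
qed

lemma L2_norm_triangle:
  assumes f: "f \<in> L2 M" and g: "g \<in> L2 M"
  shows "L2_norm M (\<lambda>x. f x + g x) \<le> L2_norm M f + L2_norm M g"
proof (rule power2_le_imp_le)
  show "(L2_norm M (\<lambda>x. f x + g x))\<^sup>2 \<le> (L2_norm M f + L2_norm M g)\<^sup>2"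
    using L2_Cauchy_Schwarz[OF f g] by (simp add: L2_norm_add_square[OF f g] power2_sum)
qed (intro add_nonneg_nonneg L2_norm_nonneg)

lemma L2_norm_triangle_diff:
  assumes "f \<in> L2 M" "g \<in> L2 M" "h \<in> L2 M"
  shows "L2_norm M (\<lambda>x. f x - h x) \<le> L2_norm M (\<lambda>x. f x - g x) + L2_norm M (\<lambda>x. g x - h x)"
  using L2_norm_triangle[of "\<lambda>x. f x - g x" M "\<lambda>x. g x - h x"] assms by (simp add: L2_diff)

lemma L2_distr:
  assumes X [measurable]: "X \<in> measurable M N" and \<beta>: "\<beta> \<in> L2 (distr M N X)"
  shows "\<beta> \<circ> X \<in> L2 M"
proof -
  have [measurable]: "\<beta> \<in> borel_measurable N" using \<beta> by (simp add: L2_def)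
  have "integrable M (\<lambda>\<omega>. (norm (\<beta> (X \<omega>)))\<^sup>2)"
    using L2_integrable[OF \<beta>] by (subst (asm) integrable_distr_eq) auto
  then show ?thesis by (simp add: L2_def comp_def)
qed

lemma L2_norm_distr:
  assumes [measurable]: "X \<in> measurable M N" "\<beta> \<in> borel_measurable N"
  shows "L2_norm (distr M N X) \<beta> = L2_norm M (\<beta> \<circ> X)"
  by (simp add: L2_norm_def comp_def integral_distr)

lemma L2_inner_distr:
  assumes [measurable]: "X \<in> measurable M N" "\<beta> \<in> borel_measurable N" "\<eta> \<in> borel_measurable N"
  shows "L2_inner (distr M N X) \<beta> \<eta> = L2_inner M (\<beta> \<circ> X) (\<eta> \<circ> X)"
  by (simp add: L2_inner_def comp_def integral_distr)

section \<open>Neighbourhood filters and upper limits as epsilon-delta statements\<close>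

lemma eventually_L2_nhds:
  "eventually P (L2_nhds M f) \<longleftrightarrow> (\<exists>e>0. \<forall>g\<in>L2 M. L2_norm M (\<lambda>x. g x - f x) < e \<longrightarrow> P g)"
  unfolding L2_nhds_def L2_dist_eq_norm
proof (subst eventually_INF_base, goal_cases)
  case (2 a b)
  then show ?case by (intro bexI[of _ "min a b"]) auto
qed (auto simp: eventually_principal)

lemma eventually_P2_nhds:
  "eventually P (P2_nhds \<mu>) \<longleftrightarrow> (\<exists>e>0. \<forall>\<nu>\<in>P2. W2 \<nu> \<mu> < e \<longrightarrow> P \<nu>)"
  unfolding P2_nhds_def
proof (subst eventually_INF_base, goal_cases)
  case (2 a b)
  then show ?case by (intro bexI[of _ "min a b"]) auto
qed (auto simp: eventually_principal)

lemma eventually_at_right_0: "eventually P (at_right 0) \<longleftrightarrow> (\<exists>e>0. \<forall>t::real. 0 < t \<longrightarrow> t < e \<longrightarrow> P t)"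
  by (subst eventually_at_right[of 0 1]) auto

lemma eventually_at_right_L2_nhds:
  "eventually P (at_right 0 \<times>\<^sub>F L2_nhds M f) \<longleftrightarrow>
    (\<exists>d>0. \<forall>t g. 0 < t \<longrightarrow> t < d \<longrightarrow> g \<in> L2 M \<longrightarrow> L2_norm M (\<lambda>x. g x - f x) < d \<longrightarrow> P (t, g))"
  (is "_ \<longleftrightarrow> ?R")
proof
  assume "eventually P (at_right 0 \<times>\<^sub>F L2_nhds M f)"
  then obtain Q S where Q: "eventually Q (at_right 0)" and S: "eventually S (L2_nhds M f)"
    and P: "\<And>t g. Q t \<Longrightarrow> S g \<Longrightarrow> P (t, g)"
    by (auto simp: eventually_prod_filter)
  from Q obtain d1 where "d1 > 0" "\<And>t. 0 < t \<Longrightarrow> t < d1 \<Longrightarrow> Q t"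
    by (auto simp: eventually_at_right_0)
  moreover from S obtain d2 where "d2 > 0"
    "\<And>g. g \<in> L2 M \<Longrightarrow> L2_norm M (\<lambda>x. g x - f x) < d2 \<Longrightarrow> S g"
    by (auto simp: eventually_L2_nhds)
  ultimately show ?R by (intro exI[of _ "min d1 d2"]) (auto intro!: P)
next
  assume ?R
  then obtain d where d: "d > 0"
    "\<And>t g. 0 < t \<Longrightarrow> t < d \<Longrightarrow> g \<in> L2 M \<Longrightarrow> L2_norm M (\<lambda>x. g x - f x) < d \<Longrightarrow> P (t, g)"
    by blast
  show "eventually P (at_right 0 \<times>\<^sub>F L2_nhds M f)"
    unfolding eventually_prod_filter
    by (rule exI[of _ "\<lambda>t. 0 < t \<and> t < d"],
        rule exI[of _ "\<lambda>g. g \<in> L2 M \<and> L2_norm M (\<lambda>x. g x - f x) < d"])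
      (use d in \<open>auto simp: eventually_at_right_0 eventually_L2_nhds\<close>)
qed

lemma eventually_P2_nhds_at_right:
  "eventually P (P2_nhds \<mu> \<times>\<^sub>F at_right 0) \<longleftrightarrow>
    (\<exists>d>0. \<forall>\<nu> t. 0 < t \<longrightarrow> t < d \<longrightarrow> \<nu> \<in> P2 \<longrightarrow> W2 \<nu> \<mu> < d \<longrightarrow> P (\<nu>, t))"
  (is "_ \<longleftrightarrow> ?R")
proof
  assume "eventually P (P2_nhds \<mu> \<times>\<^sub>F at_right 0)"
  then obtain Q S where Q: "eventually Q (at_right 0)" and S: "eventually S (P2_nhds \<mu>)"
    and P: "\<And>t g. Q t \<Longrightarrow> S g \<Longrightarrow> P (g, t)"
    by (auto simp: eventually_prod_filter)
  from Q obtain d1 where "d1 > 0" "\<And>t. 0 < t \<Longrightarrow> t < d1 \<Longrightarrow> Q t"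
    by (auto simp: eventually_at_right_0)
  moreover from S obtain d2 where "d2 > 0" "\<And>g. g \<in> P2 \<Longrightarrow> W2 g \<mu> < d2 \<Longrightarrow> S g"
    by (auto simp: eventually_P2_nhds)
  ultimately show ?R by (intro exI[of _ "min d1 d2"]) (auto intro!: P)
next
  assume ?R
  then obtain d where d: "d > 0"
    "\<And>t g. 0 < t \<Longrightarrow> t < d \<Longrightarrow> g \<in> P2 \<Longrightarrow> W2 g \<mu> < d \<Longrightarrow> P (g, t)"
    by blast
  show "eventually P (P2_nhds \<mu> \<times>\<^sub>F at_right 0)"
    unfolding eventually_prod_filter
    by (rule exI[of _ "\<lambda>g. g \<in> P2 \<and> W2 g \<mu> < d"], rule exI[of _ "\<lambda>t. 0 < t \<and> t < d"])
      (use d in \<open>auto simp: eventually_at_right_0 eventually_P2_nhds\<close>)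
qed

text \<open>An upper limit at most c only controls values strictly above c, hence the slack e. In
  this form all later bounds on Clarke derivatives are proved and used.\<close>

lemma Limsup_le_ereal_iff:
  "Limsup F (\<lambda>x. ereal (h x)) \<le> ereal c \<longleftrightarrow> (\<forall>e>0. eventually (\<lambda>x. h x \<le> c + e) F)"
proof
  assume le: "Limsup F (\<lambda>x. ereal (h x)) \<le> ereal c"
  show "\<forall>e>0. eventually (\<lambda>x. h x \<le> c + e) F"
  proof (intro allI impI)
    fix e :: real assume "e > 0"
    then have "ereal c < ereal (c + e)" by simp
    with le have "eventually (\<lambda>x. ereal (h x) < ereal (c + e)) F"
      unfolding Limsup_le_iff by blast
    then show "eventually (\<lambda>x. h x \<le> c + e) F" by eventually_elim simp
  qed
next
  assume ev: "\<forall>e>0. eventually (\<lambda>x. h x \<le> c + e) F"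
  show "Limsup F (\<lambda>x. ereal (h x)) \<le> ereal c"
  proof (rule ereal_le_epsilon2)
    fix e :: real assume "e > 0"
    with ev have "eventually (\<lambda>x. ereal (h x) \<le> ereal (c + e)) F" by simp
    then have "Limsup F (\<lambda>x. ereal (h x)) \<le> ereal (c + e)" by (rule Limsup_bounded)
    then show "Limsup F (\<lambda>x. ereal (h x)) \<le> ereal c + ereal e" by simp
  qed
qed

text \<open>Infinite values are included: every real bounds -\<infinity> from above and none bounds
  \<infinity>. Two upper limits can thus be identified by matching their epsilon-delta conditions,
  without first showing that they are finite.\<close>

lemma ereal_eq_if_same_upper_bounds:
  fixes a b :: ereal
  assumes "\<And>c::real. a \<le> ereal c \<longleftrightarrow> b \<le> ereal c"
  shows "a = b"
proof (rule antisym)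
  show "a \<le> b" by (rule ereal_le_real) (simp add: assms)
  show "b \<le> a" by (rule ereal_le_real) (simp add: assms[symmetric])
qed

section \<open>Completeness and the domination of linear functionals\<close>

lemma AE_summable_if_summable_integrals:
  fixes h :: "nat \<Rightarrow> 'a \<Rightarrow> real"
  assumes int: "\<And>k. integrable M (h k)" and nonneg: "\<And>k x. 0 \<le> h k x"
    and le: "\<And>k. (\<integral>x. h k x \<partial>M) \<le> c k" and c: "summable c"
  shows "AE x in M. summable (\<lambda>k. h k x)" and "integrable M (\<lambda>x. \<Sum>k. h k x)"
proof -
  have [measurable]: "h k \<in> borel_measurable M" for k using int[of k] by simp
  have c0: "0 \<le> c k" for k
    using le[of k] nonneg by (meson Bochner_Integration.integral_nonneg order_trans)
  have s: "summable (\<lambda>k. \<integral>x. h k x \<partial>M)"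
    by (rule summable_comparison_test[OF _ c])
      (use le nonneg in \<open>auto intro!: exI[of _ 0] simp: Bochner_Integration.integral_nonneg\<close>)
  have "(\<integral>\<^sup>+x. (\<Sum>k. ennreal (h k x)) \<partial>M) = (\<Sum>k. \<integral>\<^sup>+x. ennreal (h k x) \<partial>M)"
    by (rule nn_integral_suminf) measurable
  also have "\<dots> = (\<Sum>k. ennreal (\<integral>x. h k x \<partial>M))"
    by (simp add: nn_integral_eq_integral int nonneg)
  also have "\<dots> \<noteq> \<infinity>"
    using s nonneg by (subst suminf_ennreal2) (auto simp: Bochner_Integration.integral_nonneg)
  finally have "AE x in M. (\<Sum>k. ennreal (h k x)) \<noteq> \<infinity>"
    by (intro nn_integral_PInf_AE) auto
  then show *: "AE x in M. summable (\<lambda>k. h k x)"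
    by eventually_elim (auto intro!: summable_suminf_not_top nonneg)
  show "integrable M (\<lambda>x. \<Sum>k. h k x)"
    by (rule integrable_suminf[OF int]) (use * s nonneg in auto)
qed

text \<open>At this rate the integrals of 2^k |f (k+1) - f k|^2 are at most (1/2)^k. So these
  weighted squares are summable almost everywhere, and the inequality between arithmetic and
  geometric mean turns this into absolute summability of the increments. Fatou's lemma then bounds
  the distance to the pointwise limit.\<close>

lemma L2_complete_fast:
  fixes f :: "nat \<Rightarrow> 'a \<Rightarrow> real ^ 'n"
  assumes f: "\<And>k. f k \<in> L2 M"
    and cauchy: "\<And>k. L2_norm M (\<lambda>x. f (Suc k) x - f k x) \<le> (1/2) ^ k"
  obtains g where "g \<in> L2 M" and "(\<lambda>k. L2_norm M (\<lambda>x. f k x - g x)) \<longlonglongrightarrow> 0"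
proof -
  note [measurable] = L2_measurable[OF f]
  define g where "g x = lim (\<lambda>k. f k x)" for x
  have gm [measurable]: "g \<in> borel_measurable M"
    unfolding g_def by measurable
  define a where "a k x = norm (f (Suc k) x - f k x)" for k x
  have "AE x in M. summable (\<lambda>k. 2 ^ k * (a k x)\<^sup>2)"
  proof (rule AE_summable_if_summable_integrals)
    show "integrable M (\<lambda>x. 2 ^ k * (a k x)\<^sup>2)" for k
      unfolding a_def by (intro integrable_mult_right L2_integrable L2_diff f)
    show "(\<integral>x. 2 ^ k * (a k x)\<^sup>2 \<partial>M) \<le> (1/2) ^ k" for k
    proof -
      have "(\<integral>x. (a k x)\<^sup>2 \<partial>M) \<le> ((1/2) ^ k)\<^sup>2"
        using power_mono[OF cauchy L2_norm_nonneg, of k 2] by (simp add: L2_norm_square a_def)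
      then have "2 ^ k * (\<integral>x. (a k x)\<^sup>2 \<partial>M) \<le> 2 ^ k * ((1/2) ^ k)\<^sup>2"
        by (intro mult_left_mono) auto
      also have "\<dots> = (1/2) ^ k"
        by (simp add: power2_eq_square power_divide)
      finally show ?thesis by simp
    qed
  qed (auto intro!: summable_geometric)
  then have lim: "AE x in M. (\<lambda>k. f k x) \<longlonglongrightarrow> g x"
  proof eventually_elim
    case (elim x)
    have le: "norm (f (Suc k) x - f k x) \<le> (1/2) ^ k + 2 ^ k * (a k x)\<^sup>2" for k
    proof -
      have "2 * (1 * (2 ^ k * a k x)) \<le> 1 + (2 ^ k * a k x)\<^sup>2"
        using sum_squares_bound[of 1 "2 ^ k * a k x"] by simp
      then have "2 ^ k * (2 * a k x) \<le> 2 ^ k * ((1/2) ^ k + 2 ^ k * (a k x)\<^sup>2)"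
        by (simp add: power_mult_distrib power2_eq_square algebra_simps power_divide)
      then have "2 * a k x \<le> (1/2) ^ k + 2 ^ k * (a k x)\<^sup>2" by simp
      moreover have "0 \<le> a k x" by (simp add: a_def)
      ultimately have "a k x \<le> (1/2) ^ k + 2 ^ k * (a k x)\<^sup>2" by linarith
      then show ?thesis by (simp add: a_def)
    qed
    have "summable (\<lambda>k. (1/2) ^ k + 2 ^ k * (a k x)\<^sup>2)"
      by (intro summable_add elim summable_geometric) simp
    then have "summable (\<lambda>k. norm (f (Suc k) x - f k x))"
      by (rule summable_comparison_test') (simp add: le)
    then have "summable (\<lambda>k. f (Suc k) x - f k x)"
      by (rule summable_norm_cancel)
    then have "convergent (\<lambda>k. f k x - f 0 x)"
      by (simp add: summable_iff_convergent sum_lessThan_telescope[of "\<lambda>k. f k x"])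
    then have "convergent (\<lambda>k. (f k x - f 0 x) + f 0 x)"
      by (intro convergent_add convergent_const)
    then show ?case
      by (simp add: g_def convergent_LIMSEQ_iff)
  qed
  \<comment> \<open>The right-hand side is the geometric sum of (1/2)^i over k \<le> i < k + j;
    keeping the subtracted term makes the induction close.\<close>
  have dist: "L2_norm M (\<lambda>x. f (k + j) x - f k x) \<le> 2 * (1/2) ^ k - 2 * (1/2) ^ (k + j)" for k j
  proof (induction j)
    case (Suc j)
    have "L2_norm M (\<lambda>x. f (k + Suc j) x - f k x) \<le>
        L2_norm M (\<lambda>x. f (Suc (k + j)) x - f (k + j) x) + L2_norm M (\<lambda>x. f (k + j) x - f k x)"
      using L2_norm_triangle_diff[OF f[of "Suc (k + j)"] f[of "k + j"] f[of k]] by simp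
    then show ?case using Suc cauchy[of "k + j"] by simp
  qed simp
  have bound: "(\<integral>\<^sup>+x. ennreal ((norm (f k x - g x))\<^sup>2) \<partial>M) \<le> ennreal ((2 * (1/2) ^ k)\<^sup>2)" for k
  proof -
    have "(\<integral>\<^sup>+x. ennreal ((norm (f k x - g x))\<^sup>2) \<partial>M)
        = (\<integral>\<^sup>+x. liminf (\<lambda>j. ennreal ((norm (f (k + j) x - f k x))\<^sup>2)) \<partial>M)"
    proof (rule nn_integral_cong_AE)
      show "AE x in M. ennreal ((norm (f k x - g x))\<^sup>2)
          = liminf (\<lambda>j. ennreal ((norm (f (k + j) x - f k x))\<^sup>2))"
        using lim
      proof eventually_elim
        case (elim x)
        then have "(\<lambda>j. f (k + j) x) \<longlonglongrightarrow> g x"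
          using LIMSEQ_ignore_initial_segment[of "\<lambda>j. f j x" "g x" k] by (simp add: add.commute)
        then have "(\<lambda>j. ennreal ((norm (f (k + j) x - f k x))\<^sup>2))
            \<longlonglongrightarrow> ennreal ((norm (g x - f k x))\<^sup>2)"
          by (intro tendsto_ennrealI tendsto_power tendsto_norm tendsto_diff tendsto_const)
        from lim_imp_Liminf[OF _ this] show ?case by (simp add: norm_minus_commute)
      qed
    qed
    also have "\<dots> \<le> liminf (\<lambda>j. \<integral>\<^sup>+x. ennreal ((norm (f (k + j) x - f k x))\<^sup>2) \<partial>M)"
      by (rule nn_integral_liminf) measurable
    also have "\<dots> \<le> ennreal ((2 * (1/2) ^ k)\<^sup>2)"
    proof -
      have "(\<integral>\<^sup>+x. ennreal ((norm (f (k + j) x - f k x))\<^sup>2) \<partial>M) \<le> ennreal ((2 * (1/2) ^ k)\<^sup>2)" for j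
      proof -
        have "(\<integral>\<^sup>+x. ennreal ((norm (f (k + j) x - f k x))\<^sup>2) \<partial>M)
            = ennreal ((L2_norm M (\<lambda>x. f (k + j) x - f k x))\<^sup>2)"
          by (simp add: L2_norm_square nn_integral_eq_integral L2_integrable L2_diff f)
        also have "\<dots> \<le> ennreal ((2 * (1/2) ^ k)\<^sup>2)"
          by (rule ennreal_leI, rule power_mono[OF _ L2_norm_nonneg])
            (use dist[of k j] in \<open>auto intro: order_trans\<close>)
        finally show ?thesis .
      qed
      then show ?thesis
        by (intro order_trans[OF Liminf_mono Liminf_const[THEN eq_refl]]) auto
    qed
    finally show ?thesis .
  qed
  have fg: "(\<lambda>x. f k x - g x) \<in> L2 M" for k
    using bound[of k] unfolding L2_def
    by (auto intro!: integrableI_bounded intro: le_less_trans simp: ennreal_less_top)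
  have "g \<in> L2 M"
    using L2_diff[OF f[of 0] fg[of 0]] by simp
  moreover have "(\<lambda>k. L2_norm M (\<lambda>x. f k x - g x)) \<longlonglongrightarrow> 0"
  proof (rule tendsto_sandwich[of "\<lambda>k. 0" _ _ "\<lambda>k. 2 * (1/2) ^ k"])
    have "L2_norm M (\<lambda>x. f k x - g x) \<le> 2 * (1/2) ^ k" for k
    proof (rule power2_le_imp_le)
      have "ennreal ((L2_norm M (\<lambda>x. f k x - g x))\<^sup>2) \<le> ennreal ((2 * (1/2) ^ k)\<^sup>2)"
        using bound[of k] by (simp add: L2_norm_square nn_integral_eq_integral[symmetric] L2_integrable[OF fg])
      then show "(L2_norm M (\<lambda>x. f k x - g x))\<^sup>2 \<le> (2 * (1/2) ^ k)\<^sup>2"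
        by (subst (asm) ennreal_le_iff) auto
    qed simp
    then show "eventually (\<lambda>k. L2_norm M (\<lambda>x. f k x - g x) \<le> 2 * (1/2) ^ k) sequentially"
      by simp
    show "(\<lambda>k. 2 * (1/2::real) ^ k) \<longlonglongrightarrow> 0"
      by (intro tendsto_mult_right_zero LIMSEQ_power_zero) auto
  qed (auto simp: L2_norm_nonneg)
  ultimately show ?thesis by (rule that)
qed

text \<open>
  A substitute for the Hahn-Banach and Riesz theorems: if \<open>V\<^sub>0\<close> minimises \<open>q V + \<parallel>V\<parallel>\<^sup>2 / 2\<close>, then
  \<open>Z = - V\<^sub>0\<close> works. By the parallelogram identity a minimising sequence is Cauchy, and the first
  order condition passes to the limit without any continuity of \<open>q\<close>.
\<close>

lemma L2_sublinear_dominates_linear: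
  fixes q :: "('a \<Rightarrow> real ^ 'n) \<Rightarrow> real"
  assumes add: "\<And>V W. V \<in> L2 M \<Longrightarrow> W \<in> L2 M \<Longrightarrow> q (\<lambda>x. V x + W x) \<le> q V + q W"
    and scale: "\<And>V s. V \<in> L2 M \<Longrightarrow> 0 < s \<Longrightarrow> q (\<lambda>x. s *\<^sub>R V x) \<le> s * q V"
    and lower: "\<And>V. V \<in> L2 M \<Longrightarrow> - (L * L2_norm M V) \<le> q V"
  obtains Z where "Z \<in> L2 M" and "\<And>V. V \<in> L2 M \<Longrightarrow> L2_inner M Z V \<le> q V"
proof -
  define J where "J V = q V + (L2_norm M V)\<^sup>2 / 2" for V
  have "- (L\<^sup>2 / 2) \<le> J V" if "V \<in> L2 M" for V
    using lower[OF that] zero_le_power2[of "L2_norm M V - L"]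
    by (simp add: J_def power2_diff field_simps)
  then have bdd: "bdd_below (J ` L2 M)" by (intro bdd_belowI2) auto
  define m where "m = Inf (J ` L2 M)"
  have m: "m \<le> J V" if "V \<in> L2 M" for V
    unfolding m_def by (rule cInf_lower) (use that bdd in auto)
  \<comment> \<open>With c = (1/4)^k this accuracy makes the squared distance of
    \<open>U (Suc k)\<close> and \<open>U k\<close> at most 4 (c/32 + c/8) = 5c/8, which gives the
    rate (1/2)^k required by \<open>L2_complete_fast\<close>.\<close>
  have "\<exists>V\<in>L2 M. J V < m + (1/4) ^ k / 8" for k
  proof (rule ccontr)
    assume "\<not> ?thesis"
    then have "m + (1/4) ^ k / 8 \<le> m"
      unfolding m_def by (intro cInf_greatest) (use L2_zero in force)+
    then show False by (simp add: field_simps)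
  qed
  then obtain U where U: "\<And>k. U k \<in> L2 M" and JU: "\<And>k. J (U k) < m + (1/4) ^ k / 8"
    by metis
  have mid: "m \<le> (J V + J W) / 2 - (L2_norm M (\<lambda>x. V x - W x))\<^sup>2 / 8"
    if V: "V \<in> L2 M" and W: "W \<in> L2 M" for V W
  proof -
    have "m \<le> J (\<lambda>x. (1/2) *\<^sub>R (V x + W x))"
      by (intro m L2_intros V W)
    also have "\<dots> \<le> 1/2 * (q V + q W) + (L2_norm M (\<lambda>x. V x + W x))\<^sup>2 / 8"
      using scale[OF L2_add[OF V W], of "1/2"] add[OF V W]
      by (simp add: J_def L2_norm_scaleR power_mult_distrib power2_eq_square del: scaleR_add_right)
    also have "\<dots> = (J V + J W) / 2 - (L2_norm M (\<lambda>x. V x - W x))\<^sup>2 / 8"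
      using L2_parallelogram[OF V W] by (simp add: J_def field_simps)
    finally show ?thesis .
  qed
  have "L2_norm M (\<lambda>x. U (Suc k) x - U k x) \<le> (1/2) ^ k" for k
  proof (rule power2_le_imp_le)
    define c :: real where "c = (1/4) ^ k"
    have "0 \<le> c" and "J (U (Suc k)) < m + c / 32" and "J (U k) < m + c / 8"
      using JU[of "Suc k"] JU[of k] by (simp_all add: c_def)
    moreover have "8 * m + (L2_norm M (\<lambda>x. U (Suc k) x - U k x))\<^sup>2 \<le> 4 * J (U (Suc k)) + 4 * J (U k)"
      using mid[OF U U, of "Suc k" k] by (simp add: field_simps)
    ultimately have "(L2_norm M (\<lambda>x. U (Suc k) x - U k x))\<^sup>2 \<le> c"
      by linarith
    also have "c = (1/4) ^ k" by (rule c_def)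
    also have "\<dots> = ((1/2) ^ k)\<^sup>2"
      by (simp add: power2_eq_square flip: power_mult_distrib)
    finally show "(L2_norm M (\<lambda>x. U (Suc k) x - U k x))\<^sup>2 \<le> ((1/2) ^ k)\<^sup>2" .
  qed simp
  with U obtain V0 where V0: "V0 \<in> L2 M" and lim: "(\<lambda>k. L2_norm M (\<lambda>x. U k x - V0 x)) \<longlonglongrightarrow> 0"
    by (rule L2_complete_fast[of U M]) auto
  show ?thesis
  proof (rule that[OF L2_uminus[OF V0]])
    fix V :: "'a \<Rightarrow> real ^ 'n" assume V: "V \<in> L2 M"
    have inner: "(\<lambda>k. L2_inner M (U k) V) \<longlonglongrightarrow> L2_inner M V0 V"
    proof -
      have "(\<lambda>k. L2_norm M (\<lambda>x. U k x - V0 x) * L2_norm M V) \<longlonglongrightarrow> 0"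
        using lim by (rule tendsto_mult_left_zero)
      moreover have "eventually (\<lambda>k. norm (L2_inner M (U k) V - L2_inner M V0 V)
          \<le> L2_norm M (\<lambda>x. U k x - V0 x) * L2_norm M V) sequentially"
      proof (rule always_eventually, rule allI)
        fix k
        show "norm (L2_inner M (U k) V - L2_inner M V0 V)
            \<le> L2_norm M (\<lambda>x. U k x - V0 x) * L2_norm M V"
          using L2_Cauchy_Schwarz[OF L2_diff[OF U V0] V, of k] L2_inner_diff_left[OF V U V0, of k] by simp
      qed
      ultimately have "(\<lambda>k. L2_inner M (U k) V - L2_inner M V0 V) \<longlonglongrightarrow> 0"
        by (rule Lim_null_comparison[rotated])
      then show ?thesis by (simp add: LIM_zero_iff)
    qed
    have pos: "0 \<le> q V + L2_inner M V0 V + s / 2 * (L2_norm M V)\<^sup>2" if s: "0 < s" for s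
    proof -
      have "- ((1/4) ^ k / 8) \<le> s * q V + s * L2_inner M (U k) V + s\<^sup>2 / 2 * (L2_norm M V)\<^sup>2" for k
      proof -
        have "J (U k) - (1/4) ^ k / 8 \<le> J (\<lambda>x. U k x + s *\<^sub>R V x)"
          using m[OF L2_add[OF U[of k] L2_scaleR[OF V, of s]]] JU[of k] by simp
        also have "\<dots> = q (\<lambda>x. U k x + s *\<^sub>R V x) + (L2_norm M (U k))\<^sup>2 / 2
            + s * L2_inner M (U k) V + s\<^sup>2 / 2 * (L2_norm M V)\<^sup>2"
          by (simp add: J_def L2_norm_add_scaleR_square[OF U V] add_divide_distrib)
        \<comment> \<open>The term \<open>q (U k)\<close> created here cancels the one inside
          \<open>J (U k)\<close>; what remains depends on k only through an inner product and the
          vanishing error.\<close>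
        also have "q (\<lambda>x. U k x + s *\<^sub>R V x) \<le> q (U k) + s * q V"
          using add[OF U[of k] L2_scaleR[OF V, of s]] scale[OF V s] by linarith
        finally show ?thesis by (simp add: J_def)
      qed
      moreover have "(\<lambda>k. s * q V + s * L2_inner M (U k) V + s\<^sup>2 / 2 * (L2_norm M V)\<^sup>2)
          \<longlonglongrightarrow> s * q V + s * L2_inner M V0 V + s\<^sup>2 / 2 * (L2_norm M V)\<^sup>2"
        by (intro tendsto_intros inner)
      moreover have "(\<lambda>k. - ((1/4) ^ k / 8 :: real)) \<longlonglongrightarrow> - (0 / 8)"
        by (intro tendsto_intros LIMSEQ_power_zero) auto
      ultimately have "- (0 / 8) \<le> s * q V + s * L2_inner M V0 V + s\<^sup>2 / 2 * (L2_norm M V)\<^sup>2"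
        by (intro LIMSEQ_le) auto
      also have "\<dots> = s * (q V + L2_inner M V0 V + s / 2 * (L2_norm M V)\<^sup>2)"
        by (simp add: algebra_simps power2_eq_square)
      finally show ?thesis using s by (simp add: zero_le_mult_iff)
    qed
    have "((\<lambda>s. q V + L2_inner M V0 V + s / 2 * (L2_norm M V)\<^sup>2)
        \<longlongrightarrow> q V + L2_inner M V0 V + 0 / 2 * (L2_norm M V)\<^sup>2) (at_right 0)"
      by (intro tendsto_intros) auto
    moreover have "eventually (\<lambda>s. 0 \<le> q V + L2_inner M V0 V + s / 2 * (L2_norm M V)\<^sup>2) (at_right 0)"
      using pos eventually_at_right_less[of "0::real"] by (auto elim!: eventually_mono)
    ultimately have "0 \<le> q V + L2_inner M V0 V + 0 / 2 * (L2_norm M V)\<^sup>2"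
      by (intro tendsto_lowerbound[of _ _ "at_right 0"]) auto
    then show "L2_inner M (\<lambda>x. - V0 x) V \<le> q V"
      by (simp add: L2_inner_uminus_left)
  qed
qed

text \<open>
  The infimal convolution \<open>q V = inf {p (V - U) + \<langle>\<xi>, U\<rangle> | U \<in> S}\<close> is sublinear, lies below \<open>p\<close> and
  on \<open>S\<close> below \<open>\<xi>\<close>; as \<open>S\<close> is a subspace, a linear functional below \<open>q\<close> agrees with \<open>\<xi>\<close> on \<open>S\<close>.
\<close>

lemma L2_Hahn_Banach:
  fixes p :: "('a \<Rightarrow> real ^ 'n) \<Rightarrow> real"
  assumes add: "\<And>V W. V \<in> L2 M \<Longrightarrow> W \<in> L2 M \<Longrightarrow> p (\<lambda>x. V x + W x) \<le> p V + p W"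
    and scale: "\<And>V s. V \<in> L2 M \<Longrightarrow> 0 < s \<Longrightarrow> p (\<lambda>x. s *\<^sub>R V x) \<le> s * p V"
    and upper: "\<And>V. V \<in> L2 M \<Longrightarrow> p V \<le> L * L2_norm M V"
    and S: "S \<subseteq> L2 M" and S0: "(\<lambda>x. 0) \<in> S"
    and S_add: "\<And>U V. U \<in> S \<Longrightarrow> V \<in> S \<Longrightarrow> (\<lambda>x. U x + V x) \<in> S"
    and S_scale: "\<And>U c. U \<in> S \<Longrightarrow> (\<lambda>x. c *\<^sub>R U x) \<in> S"
    and \<xi>: "\<xi> \<in> L2 M" and le: "\<And>U. U \<in> S \<Longrightarrow> L2_inner M \<xi> U \<le> p U"
  obtains Z where "Z \<in> L2 M" "\<And>V. V \<in> L2 M \<Longrightarrow> L2_inner M Z V \<le> p V"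
    "\<And>U. U \<in> S \<Longrightarrow> L2_inner M Z U = L2_inner M \<xi> U"
proof -
  have SL: "U \<in> L2 M" if "U \<in> S" for U using S that by blast
  have S_neg: "(\<lambda>x. - U x) \<in> S" if "U \<in> S" for U
    using S_scale[OF that, of "-1"] by simp
  define a where "a V U = p (\<lambda>x. V x - U x) + L2_inner M \<xi> U" for V U
  define q where "q V = (INF U\<in>S. a V U)" for V
  \<comment> \<open>This keeps the infimum finite. Since -U = (V - U) + (-V), domination of \<xi> at
    -U and subadditivity bound \<open>p (V - U)\<close> from below.\<close>
  have lower: "- (L * L2_norm M V) \<le> a V U" if V: "V \<in> L2 M" and U: "U \<in> S" for V U
  proof -
    have "L2_inner M \<xi> (\<lambda>x. - U x) \<le> p (\<lambda>x. - U x)" by (rule le[OF S_neg[OF U]])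
    also have "\<dots> = p (\<lambda>x. (V x - U x) + (- V x))" by simp
    also have "\<dots> \<le> p (\<lambda>x. V x - U x) + p (\<lambda>x. - V x)"
      by (intro add L2_intros V SL[OF U])
    also have "p (\<lambda>x. - V x) \<le> L * L2_norm M V"
      using upper[OF L2_uminus[OF V]] by (simp add: L2_norm_uminus)
    finally show ?thesis by (simp add: a_def L2_inner_uminus_right)
  qed
  have q_le: "q V \<le> a V U" if "V \<in> L2 M" "U \<in> S" for V U
    unfolding q_def by (intro cINF_lower bdd_belowI2[of _ "- (L * L2_norm M V)"] lower that)
  have le_q: "c \<le> q V" if "\<And>U. U \<in> S \<Longrightarrow> c \<le> a V U" for c V
    unfolding q_def by (rule cINF_greatest) (use S0 that in auto)
  have "\<exists>Z\<in>L2 M. \<forall>V\<in>L2 M. L2_inner M Z V \<le> q V"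
  proof (rule L2_sublinear_dominates_linear[of M q L])
    fix V W :: "'a \<Rightarrow> real ^ 'n" assume V: "V \<in> L2 M" and W: "W \<in> L2 M"
    have *: "q (\<lambda>x. V x + W x) \<le> a V U + a W U'" if U: "U \<in> S" and U': "U' \<in> S" for U U'
    proof -
      have "q (\<lambda>x. V x + W x) \<le> a (\<lambda>x. V x + W x) (\<lambda>x. U x + U' x)"
        by (intro q_le L2_add V W S_add U U')
      also have "(\<lambda>x. (V x + W x) - (U x + U' x)) = (\<lambda>x. (V x - U x) + (W x - U' x))"
        by (simp add: algebra_simps)
      then have "a (\<lambda>x. V x + W x) (\<lambda>x. U x + U' x)
          = p (\<lambda>x. (V x - U x) + (W x - U' x)) + (L2_inner M \<xi> U + L2_inner M \<xi> U')"
        by (simp add: a_def L2_inner_add_right \<xi> SL[OF U] SL[OF U'])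
      also have "\<dots> \<le> a V U + a W U'"
        using add[OF L2_diff[OF V SL[OF U]] L2_diff[OF W SL[OF U']]] by (simp add: a_def)
      finally show ?thesis .
    qed
    have "q (\<lambda>x. V x + W x) - a W U' \<le> q V" if "U' \<in> S" for U'
      by (rule le_q) (use *[OF _ that] in \<open>simp add: algebra_simps\<close>)
    then have "q (\<lambda>x. V x + W x) - q V \<le> q W"
      by (intro le_q) (simp add: algebra_simps)
    then show "q (\<lambda>x. V x + W x) \<le> q V + q W" by simp
  next
    fix V :: "'a \<Rightarrow> real ^ 'n" and s :: real assume V: "V \<in> L2 M" and s: "0 < s"
    have "q (\<lambda>x. s *\<^sub>R V x) / s \<le> q V"
    proof (rule le_q)
      fix U assume U: "U \<in> S"
      have "q (\<lambda>x. s *\<^sub>R V x) \<le> a (\<lambda>x. s *\<^sub>R V x) (\<lambda>x. s *\<^sub>R U x)"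
        by (intro q_le L2_scaleR V S_scale U)
      also have "\<dots> \<le> s * a V U"
        using scale[OF L2_diff[OF V SL[OF U]] s]
        by (simp add: a_def L2_inner_scaleR_right scaleR_diff_right distrib_left)
      finally show "q (\<lambda>x. s *\<^sub>R V x) / s \<le> a V U" using s by (simp add: divide_le_eq mult.commute)
    qed
    then show "q (\<lambda>x. s *\<^sub>R V x) \<le> s * q V" using s by (simp add: divide_le_eq mult.commute)
  next
    fix V :: "'a \<Rightarrow> real ^ 'n" assume "V \<in> L2 M"
    then show "- (L * L2_norm M V) \<le> q V" by (intro le_q lower)
  qed blast
  then obtain Z where Z: "Z \<in> L2 M" and Zq: "\<And>V. V \<in> L2 M \<Longrightarrow> L2_inner M Z V \<le> q V" by blast
  \<comment> \<open>For V in S the choice U = V in the infimum leaves p at zero plus the value of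
    \<xi>.\<close>
  have p0: "p (\<lambda>x. 0) \<le> 0" using upper[OF L2_zero] by simp
  have S_le: "L2_inner M Z U \<le> L2_inner M \<xi> U" if U: "U \<in> S" for U
  proof -
    have "L2_inner M Z U \<le> a U U" using Zq[OF SL[OF U]] q_le[OF SL[OF U] U] by linarith
    then show ?thesis using p0 by (simp add: a_def)
  qed
  show ?thesis
  proof (rule that[OF Z])
    fix V :: "'a \<Rightarrow> real ^ 'n" assume V: "V \<in> L2 M"
    have "L2_inner M Z V \<le> a V (\<lambda>x. 0)" using Zq[OF V] q_le[OF V S0] by linarith
    then show "L2_inner M Z V \<le> p V" by (simp add: a_def L2_inner_def)
  next
    fix U assume U: "U \<in> S"
    show "L2_inner M Z U = L2_inner M \<xi> U"
      using S_le[OF U] S_le[OF S_neg[OF U]] by (simp add: L2_inner_uminus_right)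
  qed
qed

section \<open>Clarke derivatives of locally Lipschitz functions\<close>

lemma L2_Clarke_deriv_le_iff:
  "L2_Clarke_deriv M F X V \<le> ereal c \<longleftrightarrow>
    (\<forall>e>0. \<exists>d>0. \<forall>t Y. 0 < t \<longrightarrow> t < d \<longrightarrow> Y \<in> L2 M \<longrightarrow> L2_norm M (\<lambda>\<omega>. Y \<omega> - X \<omega>) < d \<longrightarrow>
      F (\<lambda>\<omega>. Y \<omega> + t *\<^sub>R V \<omega>) - F Y \<le> (c + e) * t)"
  unfolding L2_Clarke_deriv_def case_prod_unfold Limsup_le_ereal_iff eventually_at_right_L2_nhds
  by (auto simp: divide_le_eq)

lemma Clarke_deriv_C1_le_iff:
  "Clarke_deriv_C1 G \<mu> w \<le> ereal c \<longleftrightarrow>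
    (\<forall>e>0. \<exists>d>0. \<forall>\<nu> t. 0 < t \<longrightarrow> t < d \<longrightarrow> \<nu> \<in> P2 \<longrightarrow> W2 \<nu> \<mu> < d \<longrightarrow>
      G (distr \<nu> borel (\<lambda>x. x + t *\<^sub>R w x)) - G \<nu> \<le> (c + e) * t)"
  unfolding Clarke_deriv_C1_def case_prod_unfold Limsup_le_ereal_iff eventually_P2_nhds_at_right
  by (auto simp: divide_le_eq)

text \<open>The setting of the classical Clarke calculus for an arbitrary F. Radius and constant are
  explicit parameters because L reappears as the Lipschitz constant of the derivative in its
  direction.\<close>

locale L2_Lipschitz_around =
  fixes M :: "'a measure" and F :: "('a \<Rightarrow> real ^ 'n) \<Rightarrow> real" and X :: "'a \<Rightarrow> real ^ 'n" and r L :: real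
  assumes X: "X \<in> L2 M" and r: "0 < r" and L: "0 \<le> L"
    and Lipschitz: "\<And>Y Y'. Y \<in> L2 M \<Longrightarrow> Y' \<in> L2 M \<Longrightarrow>
      L2_norm M (\<lambda>\<omega>. Y \<omega> - X \<omega>) < r \<Longrightarrow> L2_norm M (\<lambda>\<omega>. Y' \<omega> - X \<omega>) < r \<Longrightarrow>
      \<bar>F Y - F Y'\<bar> \<le> L * L2_norm M (\<lambda>\<omega>. Y \<omega> - Y' \<omega>)"
begin

text \<open>One d serves for both the step and the base point: with d = \<rho> / (1 + ||V||) one has
  d + d ||V|| = \<rho>, also when V has norm zero.\<close>

lemma perturbation_near:
  assumes V: "V \<in> L2 M" and \<rho>: "0 < \<rho>"
  obtains d where "0 < d" "d \<le> \<rho>"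
    and "\<And>t Y. 0 < t \<Longrightarrow> t < d \<Longrightarrow> Y \<in> L2 M \<Longrightarrow> L2_norm M (\<lambda>\<omega>. Y \<omega> - X \<omega>) < d \<Longrightarrow>
      L2_norm M (\<lambda>\<omega>. (Y \<omega> + t *\<^sub>R V \<omega>) - X \<omega>) < \<rho>"
proof (rule that)
  have V0: "0 \<le> L2_norm M V" by (rule L2_norm_nonneg)
  show d: "0 < \<rho> / (1 + L2_norm M V)" using \<rho> V0 by simp
  show "\<rho> / (1 + L2_norm M V) \<le> \<rho>"
    using \<rho> V0 by (simp add: divide_le_eq)
  fix t Y assume t: "0 < t" "t < \<rho> / (1 + L2_norm M V)" and Y: "Y \<in> L2 M"
    and near: "L2_norm M (\<lambda>\<omega>. Y \<omega> - X \<omega>) < \<rho> / (1 + L2_norm M V)"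
  have "L2_norm M (\<lambda>\<omega>. (Y \<omega> + t *\<^sub>R V \<omega>) - X \<omega>)
      \<le> L2_norm M (\<lambda>\<omega>. Y \<omega> - X \<omega>) + t * L2_norm M V"
    using L2_norm_triangle[OF L2_diff[OF Y X] L2_scaleR[OF V, of t]] t
    by (simp add: L2_norm_scaleR algebra_simps)
  also have "\<dots> < \<rho> / (1 + L2_norm M V) + \<rho> / (1 + L2_norm M V) * L2_norm M V"
    by (intro add_less_le_mono near mult_right_mono V0) (use t in simp)
  also have "\<dots> = \<rho>"
    using V0 by (simp add: field_simps add_nonneg_eq_0_iff)
  finally show "L2_norm M (\<lambda>\<omega>. (Y \<omega> + t *\<^sub>R V \<omega>) - X \<omega>) < \<rho>" .
qed

lemma Clarke_deriv_upper:
  assumes V: "V \<in> L2 M"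
  shows "L2_Clarke_deriv M F X V \<le> ereal (L * L2_norm M V)"
  unfolding L2_Clarke_deriv_le_iff
proof (intro allI impI)
  fix e :: real assume e: "0 < e"
  obtain d where d: "0 < d" "d \<le> r" and near: "\<And>t Y. 0 < t \<Longrightarrow> t < d \<Longrightarrow> Y \<in> L2 M \<Longrightarrow>
      L2_norm M (\<lambda>\<omega>. Y \<omega> - X \<omega>) < d \<Longrightarrow> L2_norm M (\<lambda>\<omega>. (Y \<omega> + t *\<^sub>R V \<omega>) - X \<omega>) < r"
    using perturbation_near[OF V r] by blast
  have "F (\<lambda>\<omega>. Y \<omega> + t *\<^sub>R V \<omega>) - F Y \<le> (L * L2_norm M V + e) * t"
    if t: "0 < t" "t < d" and Y: "Y \<in> L2 M" and YX: "L2_norm M (\<lambda>\<omega>. Y \<omega> - X \<omega>) < d" for t Y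
  proof -
    have "\<bar>F (\<lambda>\<omega>. Y \<omega> + t *\<^sub>R V \<omega>) - F Y\<bar> \<le> L * L2_norm M (\<lambda>\<omega>. (Y \<omega> + t *\<^sub>R V \<omega>) - Y \<omega>)"
      by (rule Lipschitz) (use near t Y YX d V in \<open>auto intro!: L2_intros\<close>)
    also have "\<dots> = L * L2_norm M V * t" using t by (simp add: L2_norm_scaleR)
    finally have "F (\<lambda>\<omega>. Y \<omega> + t *\<^sub>R V \<omega>) - F Y \<le> L * L2_norm M V * t" by linarith
    moreover have "0 \<le> e * t" using e t by simp
    ultimately show ?thesis unfolding distrib_right by linarith
  qed
  with d show "\<exists>d>0. \<forall>t Y. 0 < t \<longrightarrow> t < d \<longrightarrow> Y \<in> L2 M \<longrightarrow> L2_norm M (\<lambda>\<omega>. Y \<omega> - X \<omega>) < d \<longrightarrow>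
      F (\<lambda>\<omega>. Y \<omega> + t *\<^sub>R V \<omega>) - F Y \<le> (L * L2_norm M V + e) * t" by blast
qed

lemma Clarke_deriv_lower:
  assumes V: "V \<in> L2 M"
  shows "ereal (- (L * L2_norm M V)) \<le> L2_Clarke_deriv M F X V"
proof (rule ereal_le_real)
  fix c assume le: "L2_Clarke_deriv M F X V \<le> ereal c"
  obtain d where d: "0 < d" "d \<le> r" and near: "\<And>t Y. 0 < t \<Longrightarrow> t < d \<Longrightarrow> Y \<in> L2 M \<Longrightarrow>
      L2_norm M (\<lambda>\<omega>. Y \<omega> - X \<omega>) < d \<Longrightarrow> L2_norm M (\<lambda>\<omega>. (Y \<omega> + t *\<^sub>R V \<omega>) - X \<omega>) < r"
    using perturbation_near[OF V r] by blast
  have "- (L * L2_norm M V) \<le> c + e" if e: "0 < e" for e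
  proof -
    obtain d' where d': "0 < d'" and le': "\<And>t Y. 0 < t \<Longrightarrow> t < d' \<Longrightarrow> Y \<in> L2 M \<Longrightarrow>
        L2_norm M (\<lambda>\<omega>. Y \<omega> - X \<omega>) < d' \<Longrightarrow> F (\<lambda>\<omega>. Y \<omega> + t *\<^sub>R V \<omega>) - F Y \<le> (c + e) * t"
      using le e unfolding L2_Clarke_deriv_le_iff by blast
    define t where "t = min d d' / 2"
    have t: "0 < t" "t < d" "t < d'" using d d' by (auto simp: t_def)
    have "\<bar>F (\<lambda>\<omega>. X \<omega> + t *\<^sub>R V \<omega>) - F X\<bar> \<le> L * L2_norm M (\<lambda>\<omega>. (X \<omega> + t *\<^sub>R V \<omega>) - X \<omega>)"
      by (rule Lipschitz) (use near[OF t(1,2) X] d X V r in \<open>auto intro!: L2_intros\<close>)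
    also have "\<dots> = L * L2_norm M V * t" using t by (simp add: L2_norm_scaleR)
    finally have "- (L * L2_norm M V) * t \<le> (c + e) * t"
      using le'[OF t(1,3) X] d' by simp
    then show ?thesis using t(1) by (rule mult_right_le_imp_le)
  qed
  then show "ereal (- (L * L2_norm M V)) \<le> ereal c"
    by (simp add: field_le_epsilon)
qed

definition dirderiv :: "('a \<Rightarrow> real ^ 'n) \<Rightarrow> real" where
  "dirderiv V = real_of_ereal (L2_Clarke_deriv M F X V)"

lemma Clarke_deriv_eq: "V \<in> L2 M \<Longrightarrow> L2_Clarke_deriv M F X V = ereal (dirderiv V)"
  using Clarke_deriv_upper[of V] Clarke_deriv_lower[of V]
  by (cases "L2_Clarke_deriv M F X V") (auto simp: dirderiv_def)

lemma dirderiv_bounds: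
  assumes "V \<in> L2 M"
  shows "dirderiv V \<le> L * L2_norm M V" and "- (L * L2_norm M V) \<le> dirderiv V"
  using Clarke_deriv_upper[OF assms] Clarke_deriv_lower[OF assms]
  by (simp_all add: Clarke_deriv_eq[OF assms])

lemma dirderiv_le_iff:
  assumes "V \<in> L2 M"
  shows "dirderiv V \<le> c \<longleftrightarrow>
    (\<forall>e>0. \<exists>d>0. \<forall>t Y. 0 < t \<longrightarrow> t < d \<longrightarrow> Y \<in> L2 M \<longrightarrow> L2_norm M (\<lambda>\<omega>. Y \<omega> - X \<omega>) < d \<longrightarrow>
      F (\<lambda>\<omega>. Y \<omega> + t *\<^sub>R V \<omega>) - F Y \<le> (c + e) * t)"
  using L2_Clarke_deriv_le_iff[of M F X V c] by (simp add: Clarke_deriv_eq[OF assms])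

lemma dirderiv_bound_near:
  assumes "V \<in> L2 M" and "0 < e"
  obtains d where "0 < d" and "\<And>t Y. 0 < t \<Longrightarrow> t < d \<Longrightarrow> Y \<in> L2 M \<Longrightarrow>
    L2_norm M (\<lambda>\<omega>. Y \<omega> - X \<omega>) < d \<Longrightarrow> F (\<lambda>\<omega>. Y \<omega> + t *\<^sub>R V \<omega>) - F Y \<le> (dirderiv V + e) * t"
  using dirderiv_le_iff[OF assms(1), of "dirderiv V"] assms(2) by auto

text \<open>The step is split: from Y along V, then from Y + t V along W. The second quotient has a
  moved base point that is still close to X; letting the base point vary in the upper limit is what
  makes the derivative subadditive.\<close>

lemma dirderiv_add:
  assumes V: "V \<in> L2 M" and W: "W \<in> L2 M"
  shows "dirderiv (\<lambda>\<omega>. V \<omega> + W \<omega>) \<le> dirderiv V + dirderiv W"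
  unfolding dirderiv_le_iff[OF L2_add[OF V W]]
proof (intro allI impI)
  fix e :: real assume "0 < e"
  then have e2: "0 < e / 2" by simp
  obtain d1 where d1: "0 < d1" and le1: "\<And>t Y. 0 < t \<Longrightarrow> t < d1 \<Longrightarrow> Y \<in> L2 M \<Longrightarrow>
      L2_norm M (\<lambda>\<omega>. Y \<omega> - X \<omega>) < d1 \<Longrightarrow> F (\<lambda>\<omega>. Y \<omega> + t *\<^sub>R V \<omega>) - F Y \<le> (dirderiv V + e / 2) * t"
    using dirderiv_bound_near[OF V e2] by blast
  obtain d2 where d2: "0 < d2" and le2: "\<And>t Y. 0 < t \<Longrightarrow> t < d2 \<Longrightarrow> Y \<in> L2 M \<Longrightarrow>
      L2_norm M (\<lambda>\<omega>. Y \<omega> - X \<omega>) < d2 \<Longrightarrow> F (\<lambda>\<omega>. Y \<omega> + t *\<^sub>R W \<omega>) - F Y \<le> (dirderiv W + e / 2) * t"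
    using dirderiv_bound_near[OF W e2] by blast
  obtain d3 where d3: "0 < d3" "d3 \<le> d2" and near: "\<And>t Y. 0 < t \<Longrightarrow> t < d3 \<Longrightarrow> Y \<in> L2 M \<Longrightarrow>
      L2_norm M (\<lambda>\<omega>. Y \<omega> - X \<omega>) < d3 \<Longrightarrow> L2_norm M (\<lambda>\<omega>. (Y \<omega> + t *\<^sub>R V \<omega>) - X \<omega>) < d2"
    using perturbation_near[OF V d2] by blast
  have "F (\<lambda>\<omega>. Y \<omega> + t *\<^sub>R (V \<omega> + W \<omega>)) - F Y \<le> (dirderiv V + dirderiv W + e) * t"
    if t: "0 < t" "t < min d1 d3" and Y: "Y \<in> L2 M" and YX: "L2_norm M (\<lambda>\<omega>. Y \<omega> - X \<omega>) < min d1 d3"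
    for t Y
  proof -
    have "F (\<lambda>\<omega>. (Y \<omega> + t *\<^sub>R V \<omega>) + t *\<^sub>R W \<omega>) - F (\<lambda>\<omega>. Y \<omega> + t *\<^sub>R V \<omega>) \<le> (dirderiv W + e / 2) * t"
      by (rule le2) (use t Y YX d3 near V in \<open>auto intro!: L2_intros\<close>)
    moreover have "F (\<lambda>\<omega>. Y \<omega> + t *\<^sub>R V \<omega>) - F Y \<le> (dirderiv V + e / 2) * t"
      by (rule le1) (use t Y YX in auto)
    ultimately show ?thesis by (simp add: algebra_simps)
  qed
  then show "\<exists>d>0. \<forall>t Y. 0 < t \<longrightarrow> t < d \<longrightarrow> Y \<in> L2 M \<longrightarrow> L2_norm M (\<lambda>\<omega>. Y \<omega> - X \<omega>) < d \<longrightarrow>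
      F (\<lambda>\<omega>. Y \<omega> + t *\<^sub>R (V \<omega> + W \<omega>)) - F Y \<le> (dirderiv V + dirderiv W + e) * t"
    using d1 d3 by (intro exI[of _ "min d1 d3"]) auto
qed

text \<open>A step t along s V is a step t s along V, whence the second radius d / s. The inequality
  for all s > 0 already contains equality, by passing to 1 / s.\<close>

lemma dirderiv_scale:
  assumes V: "V \<in> L2 M" and s: "0 < s"
  shows "dirderiv (\<lambda>\<omega>. s *\<^sub>R V \<omega>) \<le> s * dirderiv V"
  unfolding dirderiv_le_iff[OF L2_scaleR[OF V]]
proof (intro allI impI)
  fix e :: real assume "0 < e"
  then have es: "0 < e / s" using s by simp
  obtain d where d: "0 < d" and le: "\<And>t Y. 0 < t \<Longrightarrow> t < d \<Longrightarrow> Y \<in> L2 M \<Longrightarrow>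
      L2_norm M (\<lambda>\<omega>. Y \<omega> - X \<omega>) < d \<Longrightarrow> F (\<lambda>\<omega>. Y \<omega> + t *\<^sub>R V \<omega>) - F Y \<le> (dirderiv V + e / s) * t"
    using dirderiv_bound_near[OF V es] by blast
  have "F (\<lambda>\<omega>. Y \<omega> + t *\<^sub>R (s *\<^sub>R V \<omega>)) - F Y \<le> (s * dirderiv V + e) * t"
    if t: "0 < t" "t < min d (d / s)" and Y: "Y \<in> L2 M"
      and YX: "L2_norm M (\<lambda>\<omega>. Y \<omega> - X \<omega>) < min d (d / s)" for t Y
  proof -
    have "F (\<lambda>\<omega>. Y \<omega> + (t * s) *\<^sub>R V \<omega>) - F Y \<le> (dirderiv V + e / s) * (t * s)"
      by (rule le) (use t Y YX s in \<open>auto simp: field_simps\<close>)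
    also have "(dirderiv V + e / s) * (t * s) = (s * dirderiv V + e) * t"
      using s by (simp add: field_simps)
    finally show ?thesis by (simp add: mult.commute)
  qed
  then show "\<exists>d>0. \<forall>t Y. 0 < t \<longrightarrow> t < d \<longrightarrow> Y \<in> L2 M \<longrightarrow> L2_norm M (\<lambda>\<omega>. Y \<omega> - X \<omega>) < d \<longrightarrow>
      F (\<lambda>\<omega>. Y \<omega> + t *\<^sub>R (s *\<^sub>R V \<omega>)) - F Y \<le> (s * dirderiv V + e) * t"
    using d s by (intro exI[of _ "min d (d / s)"]) auto
qed

text \<open>Subadditivity for V = W + (V - W). Exchanging V and W gives the two-sided estimate, and
  so continuity in the direction.\<close>

lemma dirderiv_Lipschitz:
  assumes V: "V \<in> L2 M" and W: "W \<in> L2 M"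
  shows "dirderiv V \<le> dirderiv W + L * L2_norm M (\<lambda>\<omega>. V \<omega> - W \<omega>)"
  using dirderiv_add[OF W L2_diff[OF V W]] dirderiv_bounds(1)[OF L2_diff[OF V W]] by simp

end

section \<open>Realising laws on an atomless space\<close>

definition ternary_code :: "(nat \<Rightarrow> bool) \<Rightarrow> real" where
  "ternary_code b = (\<Sum>m. of_bool (b m) * (1/3) ^ Suc m)"

text \<open>The code is a base 3 expansion that uses the digits 0 and 1 only. Its tails stay at or
  below 1/2 of a unit, so no carry can occur and the integer part shows the digit; base 2 would
  identify distinct sequences.\<close>

definition ternary_digit :: "nat \<Rightarrow> real \<Rightarrow> bool" where
  "ternary_digit m r \<longleftrightarrow> \<lfloor>3 ^ Suc m * r\<rfloor> mod 3 = 1"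

lemma summable_ternary: "summable (\<lambda>m. of_bool (b m) * (1/3 :: real) ^ Suc m)"
proof (rule summable_comparison_test')
  show "summable (\<lambda>m. (1/3 :: real) ^ m * (1/3))"
    by (intro summable_mult2 summable_geometric) simp
qed auto

lemma ternary_code_bounds: "0 \<le> ternary_code b" "ternary_code b \<le> 1/2"
proof -
  show "0 \<le> ternary_code b"
    unfolding ternary_code_def by (rule suminf_nonneg[OF summable_ternary]) simp
  have s: "(\<lambda>m. (1/3 :: real) ^ m * (1/3)) sums (1 / (1 - 1/3) * (1/3))"
    by (intro sums_mult2 geometric_sums) simp
  have "ternary_code b \<le> (\<Sum>m. (1/3 :: real) ^ m * (1/3))"
    unfolding ternary_code_def
    by (rule suminf_le[OF _ summable_ternary sums_summable[OF s]]) auto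
  then show "ternary_code b \<le> 1/2" using sums_unique[OF s] by simp
qed

lemma ternary_code_rec: "3 * ternary_code b = of_bool (b 0) + ternary_code (\<lambda>m. b (Suc m))"
proof -
  have "ternary_code b = (\<Sum>m. of_bool (b (Suc m)) * (1/3) ^ Suc (Suc m)) + of_bool (b 0) * (1/3) ^ Suc 0"
    unfolding ternary_code_def using suminf_split_head[OF summable_ternary[of b]] by simp
  also have "(\<Sum>m. of_bool (b (Suc m)) * (1/3) ^ Suc (Suc m))
      = (\<Sum>m. 1/3 * (of_bool (b (Suc m)) * (1/3 :: real) ^ Suc m))"
    by (intro suminf_cong) simp
  also have "\<dots> = 1/3 * ternary_code (\<lambda>m. b (Suc m))"
    unfolding ternary_code_def by (rule suminf_mult[OF summable_ternary])
  finally show ?thesis by simp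
qed

text \<open>Removing the leading digit changes \<open>3 ^ Suc m\<close> times the code by a multiple
  of 3, which \<open>mod 3\<close> does not see; so the claim shifts down to the first
  digit.\<close>

lemma ternary_digit_code: "ternary_digit m (ternary_code b) = b m"
proof -
  have "\<lfloor>3 ^ Suc m * ternary_code b\<rfloor> mod 3 = of_bool (b m)"
  proof (induction m arbitrary: b)
    case 0
    have "\<lfloor>of_bool (b 0) + ternary_code (\<lambda>m. b (Suc m))\<rfloor> = of_bool (b 0)"
      using ternary_code_bounds[of "\<lambda>m. b (Suc m)"] by (cases "b 0") (auto simp: floor_eq_iff)
    then show ?case by (simp add: ternary_code_rec)
  next
    case (Suc m)
    have "3 ^ Suc (Suc m) * ternary_code b = 3 ^ Suc m * (3 * ternary_code b)"
      by simp
    also have "\<dots> = 3 ^ Suc m * ternary_code (\<lambda>m. b (Suc m)) + real_of_int (of_bool (b 0) * 3 ^ Suc m)"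
      unfolding ternary_code_rec by (simp add: algebra_simps)
    finally have "\<lfloor>3 ^ Suc (Suc m) * ternary_code b\<rfloor>
        = \<lfloor>3 ^ Suc m * ternary_code (\<lambda>m. b (Suc m))\<rfloor> + of_bool (b 0) * 3 ^ Suc m"
      by (simp only: floor_add_int[symmetric])
    then show ?case using Suc.IH[of "\<lambda>m. b (Suc m)"] by (simp add: mod_simps)
  qed
  then show ?thesis by (simp add: ternary_digit_def)
qed

lemma measurable_ternary_code:
  assumes [measurable]: "\<And>m. Measurable.pred M (\<lambda>x. b x m)"
  shows "(\<lambda>x. ternary_code (b x)) \<in> borel_measurable M"
  unfolding ternary_code_def of_bool_def by measurable

lemma measurable_ternary_digit [measurable]: "Measurable.pred borel (ternary_digit m)"
  unfolding ternary_digit_def by measurable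

lemma inj_ternary_code_imp:
  assumes "ternary_code a = ternary_code b"
  shows "a = b"
  using ternary_digit_code[of _ a] ternary_digit_code[of _ b] assms by auto

text \<open>A point is coded by the set of basic open sets that contain it, and the Hausdorff
  property separates points. Injectivity is what carries null singletons over to the image law:
  fibres are empty or single points.\<close>

lemma ex_injective_code:
  obtains \<phi> :: "'a :: {second_countable_topology, t2_space} \<Rightarrow> real"
  where "\<phi> \<in> borel_measurable borel" "inj \<phi>" "\<And>x. 0 \<le> \<phi> x" "\<And>x. \<phi> x \<le> 1"
proof -
  obtain B :: "'a set set" where B: "countable B" "topological_basis B"
    using ex_countable_basis by blast
  have "B \<noteq> {}" using B(2) unfolding topological_basis_def by (metis Sup_empty UNIV_not_empty empty_subsetI open_UNIV subset_empty)
  define E where "E = from_nat_into B"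
  have E: "range E = B" using B(1) \<open>B \<noteq> {}\<close> by (simp add: E_def)
  have opE: "open (E m)" for m
    using B(2) E by (metis rangeI topological_basis_open)
  define \<phi> where "\<phi> x = ternary_code (\<lambda>m. x \<in> E m)" for x
  show ?thesis
  proof (rule that)
    have [measurable]: "E m \<in> sets borel" for m using opE by simp
    show "\<phi> \<in> borel_measurable borel"
      unfolding \<phi>_def by (rule measurable_ternary_code) measurable
    show "inj \<phi>"
    proof (rule injI, rule ccontr)
      fix x y assume eq: "\<phi> x = \<phi> y" and "x \<noteq> y"
      then obtain U where U: "open U" "x \<in> U" "y \<notin> U" by (metis hausdorff disjoint_iff)
      then obtain A where A: "A \<in> B" "x \<in> A" "A \<subseteq> U"
        using B(2) topological_basisE by metis
      then obtain m where "A = E m" using E by auto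
      moreover have "(x \<in> E m) = (y \<in> E m)"
        using inj_ternary_code_imp[OF eq[unfolded \<phi>_def]] by meson
      ultimately show False using A U by auto
    qed
    show "0 \<le> \<phi> x" "\<phi> x \<le> 1" for x
      using ternary_code_bounds[of "\<lambda>m. x \<in> E m"] by (simp_all add: \<phi>_def)
  qed
qed

text \<open>A real is the supremum of its rational cut; the value -\<infinity> is neutral in the
  supremum. Indexing by all rationals makes the decoder a countable supremum of measurable
  functions.\<close>

lemma SUP_rational_below:
  "(SUP q::rat. if of_rat q < x then ereal (of_rat q) else -\<infinity>) = ereal x"
proof (rule antisym)
  show "(SUP q::rat. if of_rat q < x then ereal (of_rat q) else -\<infinity>) \<le> ereal x"
    by (rule SUP_least) auto
  show "ereal x \<le> (SUP q::rat. if of_rat q < x then ereal (of_rat q) else -\<infinity>)"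
  proof (rule dense_le)
    fix y assume "y < ereal x"
    then obtain q where q: "y < real_of_rat q" "real_of_rat q < ereal x"
      using ereal_dense3 by blast
    have "y \<le> (if of_rat q < x then ereal (of_rat q) else -\<infinity>)" using q by simp
    also have "\<dots> \<le> (SUP q::rat. if of_rat q < x then ereal (of_rat q) else -\<infinity>)"
      by (rule SUP_upper) simp
    finally show "y \<le> (SUP q::rat. if of_rat q < x then ereal (of_rat q) else -\<infinity>)" .
  qed
qed

text \<open>
  A vector is coded by the set of pairs \<open>(i, q)\<close> such that the rational \<open>q\<close> lies below its \<open>i\<close>-th
  coordinate.
\<close>

lemma ex_vec_code:
  obtains \<kappa> :: "real ^ 'n \<Rightarrow> real" and \<delta> :: "real \<Rightarrow> real ^ 'n"
  where "\<kappa> \<in> borel_measurable borel" "\<delta> \<in> borel_measurable borel"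
    "\<And>x. \<delta> (\<kappa> x) = x" "\<And>x. 0 \<le> \<kappa> x" "\<And>x. \<kappa> x \<le> 1"
proof -
  define b where "b x m = (case from_nat m of (i, q) \<Rightarrow> of_rat q < (x $ i))"
    for x :: "real ^ 'n" and m
  define \<kappa> where "\<kappa> x = ternary_code (b x)" for x
  define s where "s i r = (SUP q::rat. if ternary_digit (to_nat (i, q)) r then ereal (of_rat q) else -\<infinity>)"
    for i :: 'n and r
  \<comment> \<open>At reals that code no vector the supremum may be infinite, where
    \<open>real_of_ereal\<close> gives 0; there only measurability matters.\<close>
  define \<delta> where "\<delta> r = (\<chi> i. real_of_ereal (s i r))" for r
  show ?thesis
  proof (rule that)
    have nth [measurable]: "(\<lambda>v::real ^ 'n. v $ i) \<in> borel_measurable borel" for i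
      by (intro borel_measurable_continuous_onI continuous_intros)
    show "\<kappa> \<in> borel_measurable borel"
      unfolding \<kappa>_def by (rule measurable_ternary_code) (simp add: b_def case_prod_unfold)
    have [measurable]: "s i \<in> borel_measurable borel" for i
      unfolding s_def by measurable
    have "(\<lambda>r. \<delta> r \<bullet> axis i 1) \<in> borel_measurable borel" for i
      by (simp add: \<delta>_def inner_axis)
    then show "\<delta> \<in> borel_measurable borel"
      by (subst borel_measurable_euclidean_space) (auto simp: Basis_vec_def)
    have "s i (\<kappa> x) = ereal (x $ i)" for i x
      unfolding s_def \<kappa>_def ternary_digit_code b_def
      by (simp only: from_nat_to_nat prod.case SUP_rational_below)
    then show "\<delta> (\<kappa> x) = x" for x
      by (simp add: \<delta>_def)
    show "0 \<le> \<kappa> x" "\<kappa> x \<le> 1" for x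
      using ternary_code_bounds[of "b x"] by (simp_all add: \<kappa>_def)
  qed
qed

text \<open>The quantile transform of \<open>\<beta>\<close> composed with the distribution function of \<open>\<alpha>\<close>.\<close>

lemma ex_quantile_transport:
  fixes \<alpha> \<beta> :: "real measure"
  assumes \<alpha>: "finite_borel_measure \<alpha>" and \<beta>: "finite_borel_measure \<beta>"
    and mass: "measure \<alpha> UNIV = measure \<beta> UNIV"
    and atomless: "\<And>x. measure \<alpha> {x} = 0"
    and \<alpha>0: "measure \<alpha> {..<0} = 0" and \<alpha>1: "measure \<alpha> {..1} = measure \<alpha> UNIV"
    and \<beta>0: "measure \<beta> {..<0} = 0" and \<beta>1: "measure \<beta> {..1} = measure \<beta> UNIV"
  obtains T where "T \<in> borel_measurable borel" "distr \<alpha> borel T = \<beta>"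
proof -
  interpret a: finite_borel_measure \<alpha> by (rule \<alpha>)
  interpret b: finite_borel_measure \<beta> by (rule \<beta>)
  define F where "F = cdf \<alpha>"
  define G where "G = cdf \<beta>"
  define m where "m = measure \<alpha> UNIV"
  have sa [simp]: "space \<alpha> = UNIV" and sb [simp]: "space \<beta> = UNIV"
    using a.M_is_borel b.M_is_borel by (auto dest: sets_eq_imp_space_eq)
  have [measurable_cong]: "sets \<alpha> = sets borel" by (rule a.M_is_borel)
  have Fmono: "x \<le> y \<Longrightarrow> F x \<le> F y" for x y unfolding F_def by (rule a.cdf_nondecreasing)
  have Gmono: "x \<le> y \<Longrightarrow> G x \<le> G y" for x y unfolding G_def by (rule b.cdf_nondecreasing)
  have Fcont: "isCont F x" for x unfolding F_def a.isCont_cdf by (rule atomless)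
  have F1: "F 1 = m" using \<alpha>1 by (simp add: F_def cdf_def m_def)
  have F0: "F 0 = 0"
  proof -
    have "{..0::real} = {..<0} \<union> {0}" by auto
    then have "F 0 \<le> measure \<alpha> {..<0} + measure \<alpha> {0}"
      by (simp add: F_def cdf_def del: Un_insert_right) (rule measure_Un_le; simp)
    then show ?thesis using \<alpha>0 atomless a.cdf_nonneg[of 0] by (simp add: F_def)
  qed
  have Fm: "F x \<le> m" for x using a.cdf_bounded[of x] by (simp add: F_def m_def)
  have Gm: "G x \<le> m" for x using b.cdf_bounded[of x] by (simp add: G_def m_def mass)
  have G0: "0 \<le> G x" for x unfolding G_def by (rule b.cdf_nonneg)
  have G1: "G x = m" if "1 \<le> x" for x
    using Gmono[OF that] Gm[of x] \<beta>1 by (simp add: G_def cdf_def m_def mass)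
  have Gneg: "G x = 0" if "x < 0" for x
  proof -
    have "G x \<le> measure \<beta> {..<0}"
      unfolding G_def cdf_def by (rule b.finite_measure_mono) (use that in auto)
    then show ?thesis using \<beta>0 G0[of x] by simp
  qed
  \<comment> \<open>The distribution function of a measure without atoms maps it to the uniform
    measure of the same mass. The sublevel set is a half-line whose endpoint is its largest point,
    and by the intermediate value theorem F equals c there.\<close>
  have level: "measure \<alpha> {r. F r \<le> c} = c" if c: "0 \<le> c" "c \<le> m" for c
  proof (cases "c = m")
    case True
    then show ?thesis using Fm by (simp add: m_def)
  next
    case False
    define S where "S = {r. F r \<le> c}"
    have "closed S"
      unfolding S_def by (intro closed_Collect_le continuous_at_imp_continuous_on) (auto intro: Fcont)
    moreover have "0 \<in> S" using F0 c by (simp add: S_def)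
    moreover have bdd: "bdd_above S"
    proof (rule bdd_aboveI)
      fix r assume "r \<in> S"
      then show "r \<le> 1" using Fmono[of 1 r] F1 False c by (force simp: S_def)
    qed
    ultimately have sup: "Sup S \<in> S" by (intro closed_contains_Sup) auto
    have S: "S = {..Sup S}"
    proof (intro equalityI subsetI)
      fix r assume "r \<in> {..Sup S}"
      then have "F r \<le> F (Sup S)" by (intro Fmono) simp
      then show "r \<in> S" using sup by (simp add: S_def)
    qed (auto intro: cSup_upper bdd)
    have "measure \<alpha> S = F (Sup S)"
      by (subst S) (simp add: F_def cdf_def)
    moreover have "F (Sup S) \<le> c" using sup by (simp add: S_def)
    moreover have "c \<le> F (Sup S)"
    proof -
      obtain r where "F r = c"
        using IVT'[of F 0 c 1] F0 F1 c continuous_at_imp_continuous_on[of "{0..1}" F] Fcont by auto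
      then have "r \<in> S" by (simp add: S_def)
      then show ?thesis using \<open>F r = c\<close> Fmono[OF cSup_upper[OF _ bdd]] by blast
    qed
    ultimately show ?thesis by (simp add: S_def)
  qed
  \<comment> \<open>Confining the set to the unit interval, where \<beta> lives, keeps the
    generalised inverse finite even if \<open>F r = 0\<close>, when the inequality holds on the
    whole line.\<close>
  define A where "A r = {x \<in> {0..1}. F r \<le> G x}" for r
  define T where "T r = Inf (A r)" for r
  have A1: "1 \<in> A r" for r using Fm[of r] G1[of 1] by (simp add: A_def)
  have bddA: "bdd_below (A r)" for r by (auto simp: A_def intro: bdd_belowI[of _ 0])
  have T01: "0 \<le> T r" "T r \<le> 1" for r
  proof -
    show "0 \<le> T r" unfolding T_def by (rule cInf_greatest) (use A1[of r] in \<open>auto simp: A_def\<close>)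
    show "T r \<le> 1" unfolding T_def by (rule cInf_lower[OF A1 bddA])
  qed
  \<comment> \<open>The infimum is attained because G is continuous from the right.\<close>
  have GT: "F r \<le> G (T r)" for r
  proof (rule ccontr)
    assume "\<not> ?thesis"
    then have lt: "G (T r) < F r" by simp
    have "(G \<longlongrightarrow> G (T r)) (at_right (T r))"
      using b.cdf_is_right_cont[of "T r"] by (simp add: G_def continuous_within)
    then have "eventually (\<lambda>x. G x < F r) (at_right (T r))"
      using lt by (rule order_tendstoD)
    then obtain u where u: "T r < u" "\<And>x. T r < x \<Longrightarrow> x < u \<Longrightarrow> G x < F r"
      unfolding eventually_at_right_field by auto
    obtain x where x: "x \<in> A r" "x < u"
      using cInf_lessD[of "A r" u] u(1) A1[of r] unfolding T_def by auto
    have "T r \<le> x" unfolding T_def by (rule cInf_lower[OF x(1) bddA])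
    then have "G x < F r" using u(2)[of x] x(2) lt by (cases "T r = x") auto
    then show False using x(1) by (simp add: A_def)
  qed
  \<comment> \<open>The adjunction between G and its generalised inverse. It turns the distribution
    function of the image law into a sublevel set of F, whose measure \<open>level\<close>
    gives.\<close>
  have T_le: "T r \<le> x \<longleftrightarrow> F r \<le> G x" if "0 \<le> x" "x < 1" for r x
  proof
    assume "T r \<le> x"
    then show "F r \<le> G x" using GT[of r] Gmono[of "T r" x] by linarith
  next
    assume "F r \<le> G x"
    then have "x \<in> A r" using that by (simp add: A_def)
    then show "T r \<le> x" unfolding T_def by (rule cInf_lower[OF _ bddA])
  qed
  have Tm [measurable]: "T \<in> borel_measurable borel"
  proof (rule borel_measurable_mono, rule monoI)
    fix r r' :: real assume "r \<le> r'"
    then have "A r' \<subseteq> A r" using Fmono[of r r'] by (auto simp: A_def)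
    then show "T r \<le> T r'"
      unfolding T_def by (rule cInf_superset_mono[rotated 2]) (use A1[of r'] bddA in auto)
  qed
  have "cdf (distr \<alpha> borel T) x = G x" for x
  proof -
    have "cdf (distr \<alpha> borel T) x = measure \<alpha> {r. T r \<le> x}"
      unfolding cdf_def by (subst measure_distr) (auto intro!: arg_cong2[where f = measure])
    also have "\<dots> = G x"
    proof -
      consider "x < 0" | "0 \<le> x" "x < 1" | "1 \<le> x" by linarith
      then show ?thesis
      proof cases
        case 1
        then have "\<not> T r \<le> x" for r using T01(1)[of r] by linarith
        then show ?thesis using Gneg[OF 1] by simp
      next
        case 2
        then show ?thesis using level[OF G0 Gm] by (simp add: T_le)
      next
        case 3
        then have "T r \<le> x" for r using T01(2)[of r] by linarith
        then show ?thesis using G1[OF 3] by (simp add: m_def)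
      qed
    qed
    finally show ?thesis .
  qed
  moreover have "finite_borel_measure (distr \<alpha> borel T)"
    by (intro finite_borel_measure.intro finite_borel_measure_axioms.intro a.finite_measure_distr) auto
  ultimately have "distr \<alpha> borel T = \<beta>"
    by (intro cdf_unique' \<beta>) (auto simp: G_def)
  with Tm show ?thesis by (rule that)
qed

text \<open>Both measures are carried to the line: \<phi> is injective, so the image of N has no
  atoms, and \<kappa> has the measurable left inverse \<delta>. The desired map is \<phi>, then the
  quantile transport, then \<delta>. General finite mass is allowed because the lemma is applied to
  restrictions to level sets.\<close>

lemma atomless_realises_law:
  fixes N :: "'w :: {second_countable_topology, t2_space} measure" and \<rho> :: "(real ^ 'n) measure"
  assumes N: "finite_measure N" "sets borel \<subseteq> sets N" and null: "\<And>\<omega>. emeasure N {\<omega>} = 0"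
    and \<rho>: "finite_measure \<rho>" "sets \<rho> = sets borel"
    and mass: "measure N (space N) = measure \<rho> UNIV"
  obtains Y where "Y \<in> borel_measurable N" "distr N borel Y = \<rho>"
proof -
  interpret N: finite_measure N by (rule N)
  interpret \<rho>: finite_measure \<rho> by (rule \<rho>)
  have sN: "space N = UNIV"
    by (intro top.extremum_uniqueI sets.sets_into_space subsetD[OF N(2)]) simp
  have s\<rho>: "space \<rho> = UNIV" using \<rho>(2) sets_eq_imp_space_eq[of \<rho> borel] by simp
  have [measurable_cong]: "sets \<rho> = sets borel" by (rule \<rho>)
  obtain \<phi> :: "'w \<Rightarrow> real" where \<phi>: "\<phi> \<in> borel_measurable borel" "inj \<phi>" "\<And>x. 0 \<le> \<phi> x" "\<And>x. \<phi> x \<le> 1"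
    using ex_injective_code by blast
  obtain \<kappa> :: "real ^ 'n \<Rightarrow> real" and \<delta> where [measurable]: "\<kappa> \<in> borel_measurable borel"
      "\<delta> \<in> borel_measurable borel"
    and \<delta>\<kappa>: "\<And>x. \<delta> (\<kappa> x) = x" and \<kappa>: "\<And>x. 0 \<le> \<kappa> x" "\<And>x. \<kappa> x \<le> 1"
    using ex_vec_code by blast
  have [measurable]: "\<phi> \<in> borel_measurable N"
    using \<phi>(1) N(2) sN by (auto simp: measurable_def)
  have f: "finite_borel_measure (distr N borel \<phi>)" "finite_borel_measure (distr \<rho> borel \<kappa>)"
    by (intro finite_borel_measure.intro finite_borel_measure_axioms.intro
        N.finite_measure_distr \<rho>.finite_measure_distr; simp)+
  have null': "measure (distr N borel \<phi>) {x} = 0" for x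
  proof (cases "\<exists>\<omega>. \<phi> \<omega> = x")
    case True
    then obtain \<omega> where "\<phi> \<omega> = x" by blast
    then have "\<phi> -` {x} \<inter> space N = {\<omega>}" using \<phi>(2) sN by (auto dest: injD)
    then show ?thesis using null[of \<omega>] by (simp add: measure_def emeasure_distr)
  next
    case False
    then have "\<phi> -` {x} \<inter> space N = {}" by auto
    then show ?thesis by (simp add: measure_distr)
  qed
  have range: "\<phi> -` {..<0} = {}" "\<phi> -` {..1} = UNIV" "\<kappa> -` {..<0} = {}" "\<kappa> -` {..1} = UNIV"
    using \<phi>(3,4) \<kappa> by (auto simp: not_less[symmetric] simp del: not_less)
  obtain T where [measurable]: "T \<in> borel_measurable borel"
    and T: "distr (distr N borel \<phi>) borel T = distr \<rho> borel \<kappa>"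
    by (rule ex_quantile_transport[OF f _ null']) (simp_all add: measure_distr range mass[unfolded sN] sN s\<rho>)
  have "distr N borel (\<lambda>\<omega>. \<delta> (T (\<phi> \<omega>))) = distr (distr (distr N borel \<phi>) borel T) borel \<delta>"
    by (simp add: distr_distr comp_def)
  also have "\<dots> = distr \<rho> borel (\<lambda>x. x)"
    unfolding T by (simp add: distr_distr comp_def \<delta>\<kappa>)
  also have "\<dots> = \<rho>" by (rule distr_id2) (simp add: \<rho>)
  finally show ?thesis by (rule that[rotated]) measurable
qed

lemma emeasure_eq_suminf_levels:
  fixes k :: "'a \<Rightarrow> nat"
  assumes k: "k \<in> measurable M (count_space UNIV)" and B: "B \<in> sets M"
  shows "emeasure M B = (\<Sum>m. emeasure M {x \<in> B. k x = m})"
proof -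
  have eq: "{x \<in> B. k x = m} = B \<inter> (k -` {m} \<inter> space M)" for m
    using sets.sets_into_space[OF B] by auto
  have "(\<Sum>m. emeasure M {x \<in> B. k x = m}) = emeasure M (\<Union>m. {x \<in> B. k x = m})"
    unfolding eq using B measurable_sets[OF k]
    by (intro suminf_emeasure) (auto simp: disjoint_family_on_def)
  also have "(\<Union>m. {x \<in> B. k x = m}) = B" by auto
  finally show ?thesis by simp
qed

text \<open>As k has countably many values, the conditional law given k is just a slice of \<gamma>,
  to be realised on the level set of k. Measures are restricted instead of normalised, so levels of
  probability zero need no separate treatment; \<open>marginal\<close> makes the masses of the two
  restrictions equal.\<close>

lemma ex_joint_law:
  fixes M :: "'w :: {second_countable_topology, t2_space} measure" and k :: "'w \<Rightarrow> nat"
    and \<gamma> :: "(nat \<times> (real ^ 'n)) measure"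
  assumes M: "finite_measure M" "sets borel \<subseteq> sets M" and null: "\<And>\<omega>. emeasure M {\<omega>} = 0"
    and k [measurable]: "k \<in> measurable M (count_space UNIV)"
    and \<gamma>: "finite_measure \<gamma>" "sets \<gamma> = sets (count_space UNIV \<Otimes>\<^sub>M borel)"
    and marginal: "distr \<gamma> (count_space UNIV) fst = distr M (count_space UNIV) k"
  obtains Y where "Y \<in> borel_measurable M"
    and "distr M (count_space UNIV \<Otimes>\<^sub>M borel) (\<lambda>\<omega>. (k \<omega>, Y \<omega>)) = \<gamma>"
proof -
  interpret M: finite_measure M by (rule M)
  interpret \<gamma>: finite_measure \<gamma> by (rule \<gamma>)
  have [measurable_cong]: "sets \<gamma> = sets (count_space UNIV \<Otimes>\<^sub>M borel)" by (rule \<gamma>)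
  have s\<gamma>: "space \<gamma> = UNIV"
    using sets_eq_imp_space_eq[OF \<gamma>(2)] by (simp add: space_pair_measure)
  have sM: "space M = UNIV"
    by (intro top.extremum_uniqueI sets.sets_into_space subsetD[OF M(2)]) simp
  define N where "N m = density M (indicator (k -` {m} \<inter> space M))" for m
  define \<rho> where "\<rho> m = distr (density \<gamma> (indicator ({m} \<times> UNIV))) borel snd" for m
  have eN: "emeasure (N m) A = emeasure M ({\<omega> \<in> A. k \<omega> = m})" if "A \<in> sets M" for m A
  proof -
    have "emeasure (N m) A = emeasure M (k -` {m} \<inter> space M \<inter> A)"
      unfolding N_def using that by (intro emeasure_restricted) measurable
    also have "k -` {m} \<inter> space M \<inter> A = {\<omega> \<in> A. k \<omega> = m}" using sM by auto
    finally show ?thesis .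
  qed
  have [measurable]: "{m} \<times> UNIV \<in> sets \<gamma>" for m :: nat
    unfolding \<gamma>(2) by (intro pair_measureI) auto
  have e\<rho>: "emeasure (\<rho> m) A = emeasure \<gamma> ({m} \<times> A)" if [measurable]: "A \<in> sets borel" for m A
  proof -
    have "emeasure (\<rho> m) A = emeasure (density \<gamma> (indicator ({m} \<times> UNIV))) (snd -` A)"
      unfolding \<rho>_def by (subst emeasure_distr) (auto simp: s\<gamma>)
    also have "\<dots> = emeasure \<gamma> (({m} \<times> UNIV) \<inter> snd -` A)"
    proof -
      have [measurable]: "snd -` A \<in> sets \<gamma>"
        using measurable_sets[of snd \<gamma> borel A] s\<gamma> by simp
      show ?thesis by (rule emeasure_restricted) measurable
    qed
    also have "({m} \<times> UNIV) \<inter> snd -` A = {m} \<times> A" by auto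
    finally show ?thesis .
  qed
  have "\<exists>Y. Y \<in> borel_measurable M \<and> distr (N m) borel Y = \<rho> m" for m
  proof -
    have "emeasure (N m) (space (N m)) = emeasure M (k -` {m} \<inter> space M)"
      using eN[of UNIV m] sets.top[of M] sM by (simp add: N_def vimage_def)
    also have "\<dots> = emeasure (distr M (count_space UNIV) k) {m}"
      by (simp add: emeasure_distr)
    also have "\<dots> = emeasure \<gamma> ({m} \<times> UNIV)"
      unfolding marginal[symmetric] by (subst emeasure_distr) (auto simp: s\<gamma> intro!: arg_cong2[where f = emeasure])
    finally have mass: "emeasure (N m) (space (N m)) = emeasure (\<rho> m) UNIV"
      by (simp add: e\<rho>)
    have "finite_measure (N m)"
      by (rule finite_measureI) (simp add: mass e\<rho>)
    moreover have "finite_measure (\<rho> m)"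
      by (rule finite_measureI) (use e\<rho>[of UNIV m] in \<open>simp add: \<rho>_def\<close>)
    moreover have "emeasure (N m) {\<omega>} = 0" for \<omega>
    proof -
      have "{\<omega>} \<in> sets M" using M(2) by auto
      then have "emeasure (N m) {\<omega>} \<le> emeasure M {\<omega>}"
        by (subst eN) (auto intro: emeasure_mono)
      then show ?thesis using null[of \<omega>] by simp
    qed
    moreover have "sets (\<rho> m) = sets borel" "sets borel \<subseteq> sets (N m)"
      using M(2) by (simp_all add: \<rho>_def N_def)
    moreover have "measure (N m) (space (N m)) = measure (\<rho> m) UNIV"
      using mass by (simp add: measure_def)
    ultimately obtain Y where "Y \<in> borel_measurable (N m)" "distr (N m) borel Y = \<rho> m"
      using atomless_realises_law[of "N m" "\<rho> m"] by blast
    then show ?thesis by (auto simp: N_def)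
  qed
  then obtain y where ym [measurable]: "\<And>m. y m \<in> borel_measurable M"
    and y: "\<And>m. distr (N m) borel (y m) = \<rho> m" by metis
  \<comment> \<open>Each \<open>y m\<close> is defined everywhere, but \<open>N m\<close> is carried
    by level m, and only there is \<open>y m\<close> used.\<close>
  define Y where "Y \<omega> = y (k \<omega>) \<omega>" for \<omega>
  have Ym [measurable]: "Y \<in> borel_measurable M"
    unfolding Y_def by (rule measurable_compose_countable[OF ym k])
  have "distr M (count_space UNIV \<Otimes>\<^sub>M borel) (\<lambda>\<omega>. (k \<omega>, Y \<omega>)) = \<gamma>"
  proof (rule measure_eqI)
    fix A assume "A \<in> sets (distr M (count_space UNIV \<Otimes>\<^sub>M borel) (\<lambda>\<omega>. (k \<omega>, Y \<omega>)))"
    then have A [measurable]: "A \<in> sets (count_space UNIV \<Otimes>\<^sub>M borel)" by simp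
    have Am [measurable]: "Pair m -` A \<in> sets borel" for m
      by (rule sets_Pair1[OF A])
    let ?B = "(\<lambda>\<omega>. (k \<omega>, Y \<omega>)) -` A \<inter> space M"
    have "emeasure (distr M (count_space UNIV \<Otimes>\<^sub>M borel) (\<lambda>\<omega>. (k \<omega>, Y \<omega>))) A = emeasure M ?B"
      by (rule emeasure_distr) measurable
    also have "\<dots> = (\<Sum>m. emeasure M {\<omega> \<in> ?B. k \<omega> = m})"
      by (rule emeasure_eq_suminf_levels[OF k]) measurable
    also have "\<dots> = (\<Sum>m. emeasure \<gamma> {z \<in> A. fst z = m})"
    proof (intro suminf_cong)
      fix m
      have "{\<omega> \<in> ?B. k \<omega> = m} = {\<omega> \<in> y m -` (Pair m -` A) \<inter> space M. k \<omega> = m}"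
        by (auto simp: Y_def)
      then have "emeasure M {\<omega> \<in> ?B. k \<omega> = m} = emeasure (N m) (y m -` (Pair m -` A) \<inter> space M)"
        by (subst eN) auto
      also have "\<dots> = emeasure (distr (N m) borel (y m)) (Pair m -` A)"
        by (subst emeasure_distr) (auto simp: N_def)
      also have "\<dots> = emeasure \<gamma> ({m} \<times> (Pair m -` A))"
        by (simp add: y e\<rho>)
      also have "{m} \<times> (Pair m -` A) = {z \<in> A. fst z = m}" by auto
      finally show "emeasure M {\<omega> \<in> ?B. k \<omega> = m} = emeasure \<gamma> {z \<in> A. fst z = m}" .
    qed
    also have "\<dots> = emeasure \<gamma> A"
      by (rule emeasure_eq_suminf_levels[symmetric]) (auto simp: \<gamma>(2))
    finally show "emeasure (distr M (count_space UNIV \<Otimes>\<^sub>M borel) (\<lambda>\<omega>. (k \<omega>, Y \<omega>))) A = emeasure \<gamma> A" .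
  qed (simp add: \<gamma>(2))
  with Ym show ?thesis by (rule that)
qed

section \<open>Laws of random variables and the Wasserstein distance\<close>

lemma distr_in_P2:
  assumes "prob_space M" and "Y \<in> L2 M"
  shows "distr M borel Y \<in> P2"
proof -
  have [measurable]: "Y \<in> borel_measurable M" using assms(2) by (rule L2_measurable)
  have "integrable (distr M borel Y) (\<lambda>x. (norm x)\<^sup>2)"
    by (subst integrable_distr_eq) (use L2_integrable[OF assms(2)] in auto)
  then show ?thesis
    using prob_space.prob_space_distr[OF assms(1), of Y borel] by (simp add: P2_def)
qed

lemma in_L2_if_distr_in_P2:
  assumes [measurable]: "Y \<in> borel_measurable M" and "distr M borel Y \<in> P2"
  shows "Y \<in> L2 M"
proof -
  have "integrable (distr M borel Y) (\<lambda>x. (norm x)\<^sup>2)" using assms(2) by (simp add: P2_def)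
  then have "integrable M (\<lambda>\<omega>. (norm (Y \<omega>))\<^sup>2)"
    by (subst (asm) integrable_distr_eq) auto
  then show ?thesis by (simp add: L2_def)
qed

lemma bdd_below_transport_costs:
  "bdd_below ((\<lambda>\<gamma>. \<integral>z. (dist (fst z) (snd z))\<^sup>2 \<partial>\<gamma>) ` couplings \<mu> \<nu>)"
  by (intro bdd_belowI2[of _ 0]) (simp add: Bochner_Integration.integral_nonneg)

text \<open>The joint law of Y and Y' is one of the competing couplings.\<close>

lemma W2_le_L2_norm:
  assumes Y: "Y \<in> L2 M" and Y': "Y' \<in> L2 M"
  shows "W2 (distr M borel Y) (distr M borel Y') \<le> L2_norm M (\<lambda>\<omega>. Y \<omega> - Y' \<omega>)"
proof -
  note [measurable] = L2_measurable[OF Y] L2_measurable[OF Y']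
  let ?\<gamma> = "distr M (borel \<Otimes>\<^sub>M borel) (\<lambda>\<omega>. (Y \<omega>, Y' \<omega>))"
  have "?\<gamma> \<in> couplings (distr M borel Y) (distr M borel Y')"
    by (simp add: couplings_def distr_distr comp_def)
  then have "(INF \<gamma>\<in>couplings (distr M borel Y) (distr M borel Y'). \<integral>z. (dist (fst z) (snd z))\<^sup>2 \<partial>\<gamma>)
      \<le> (\<integral>z. (dist (fst z) (snd z))\<^sup>2 \<partial>?\<gamma>)"
    by (intro cINF_lower bdd_below_transport_costs)
  also have "\<dots> = (\<integral>\<omega>. (norm (Y \<omega> - Y' \<omega>))\<^sup>2 \<partial>M)"
    by (subst integral_distr) (auto simp: dist_norm)
  finally show ?thesis
    unfolding W2_def L2_norm_def by (rule real_sqrt_le_mono)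
qed

text \<open>Independence supplies a coupling, so the infimum in \<open>W2\<close> is over a
  non-empty set; over the empty set a real infimum would be arbitrary.\<close>

lemma pair_measure_in_couplings:
  assumes \<mu>: "\<mu> \<in> P2" and \<nu>: "\<nu> \<in> P2"
  shows "\<mu> \<Otimes>\<^sub>M \<nu> \<in> couplings \<mu> \<nu>"
proof -
  have s: "sets \<mu> = sets borel" "sets \<nu> = sets borel" and "prob_space \<mu>" "prob_space \<nu>"
    using \<mu> \<nu> by (auto simp: P2_def)
  interpret \<mu>: prob_space \<mu> by fact
  interpret \<nu>: prob_space \<nu> by fact
  have [measurable_cong]: "sets \<mu> = sets borel" "sets \<nu> = sets borel" by (fact s)+
  have sp: "space \<mu> = UNIV" "space \<nu> = UNIV"
    using s by (auto dest: sets_eq_imp_space_eq)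
  have "distr (\<mu> \<Otimes>\<^sub>M \<nu>) borel fst = \<mu>"
  proof (rule measure_eqI)
    fix A assume "A \<in> sets (distr (\<mu> \<Otimes>\<^sub>M \<nu>) borel fst)"
    then have [measurable]: "A \<in> sets borel" by simp
    have "fst -` A \<inter> space (\<mu> \<Otimes>\<^sub>M \<nu>) = A \<times> space \<nu>"
      by (auto simp: space_pair_measure sp)
    then show "emeasure (distr (\<mu> \<Otimes>\<^sub>M \<nu>) borel fst) A = emeasure \<mu> A"
      by (simp add: emeasure_distr \<nu>.emeasure_pair_measure_Times s sp
        \<nu>.emeasure_space_1[unfolded sp])
  qed (simp add: s)
  moreover have "distr (\<mu> \<Otimes>\<^sub>M \<nu>) borel snd = \<nu>"
  proof (rule measure_eqI)
    fix A assume "A \<in> sets (distr (\<mu> \<Otimes>\<^sub>M \<nu>) borel snd)"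
    then have [measurable]: "A \<in> sets borel" by simp
    have "snd -` A \<inter> space (\<mu> \<Otimes>\<^sub>M \<nu>) = space \<mu> \<times> A"
      by (auto simp: space_pair_measure sp)
    then show "emeasure (distr (\<mu> \<Otimes>\<^sub>M \<nu>) borel snd) A = emeasure \<nu> A"
      by (simp add: emeasure_distr \<nu>.emeasure_pair_measure_Times s sp
        \<mu>.emeasure_space_1[unfolded sp])
  qed (simp add: s)
  ultimately show ?thesis
    by (simp add: couplings_def sets_pair_measure_cong[OF s])
qed

lemma transport_cost_nonneg:
  assumes "\<mu> \<in> P2" "\<nu> \<in> P2"
  shows "0 \<le> (INF \<gamma>\<in>couplings \<mu> \<nu>. \<integral>z. (dist (fst z) (snd z))\<^sup>2 \<partial>\<gamma>)"
proof (rule cINF_greatest)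
  show "couplings \<mu> \<nu> \<noteq> {}" using pair_measure_in_couplings[OF assms] by auto
qed (simp add: Bochner_Integration.integral_nonneg)

lemma W2_nonneg: "\<mu> \<in> P2 \<Longrightarrow> \<nu> \<in> P2 \<Longrightarrow> 0 \<le> W2 \<mu> \<nu>"
  using transport_cost_nonneg[of \<mu> \<nu>] by (simp add: W2_def)

lemma W2_less_imp_coupling:
  assumes "\<nu> \<in> P2" "\<mu> \<in> P2" "W2 \<nu> \<mu> < e"
  obtains \<gamma> where "\<gamma> \<in> couplings \<nu> \<mu>" "(\<integral>z. (dist (fst z) (snd z))\<^sup>2 \<partial>\<gamma>) < e\<^sup>2"
proof -
  have ne: "couplings \<nu> \<mu> \<noteq> {}" using pair_measure_in_couplings[OF assms(1,2)] by auto
  have "(W2 \<nu> \<mu>)\<^sup>2 < e\<^sup>2" using assms W2_nonneg by (intro power_strict_mono) auto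
  then have "(INF \<gamma>\<in>couplings \<nu> \<mu>. \<integral>z. (dist (fst z) (snd z))\<^sup>2 \<partial>\<gamma>) < e\<^sup>2"
    using transport_cost_nonneg[OF assms(1,2)] by (simp add: W2_def)
  then show ?thesis
    using that by (auto simp: cINF_less_iff[OF ne bdd_below_transport_costs])
qed

text \<open>
  After rounding \<open>X\<close> to countably many values, \<open>Y\<close> is drawn on each level set according to the
  conditional law given by an almost optimal coupling; the rounding is paid for by the factor \<open>3\<close>.
\<close>

lemma ex_near_realisation:
  fixes M :: "'w :: {second_countable_topology, t2_space} measure" and X :: "'w \<Rightarrow> real ^ 'n"
  assumes M: "prob_space M" "sets borel \<subseteq> sets M" and null: "\<And>\<omega>. emeasure M {\<omega>} = 0"
    and X: "X \<in> L2 M" and \<nu>: "\<nu> \<in> P2" and W: "W2 \<nu> (distr M borel X) < e"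
  obtains Y where "Y \<in> L2 M" "distr M borel Y = \<nu>" "L2_norm M (\<lambda>\<omega>. Y \<omega> - X \<omega>) < 3 * e"
proof -
  interpret M: prob_space M by (rule M)
  have Xm [measurable]: "X \<in> borel_measurable M" using X by (rule L2_measurable)
  define \<mu> where "\<mu> = distr M borel X"
  have \<mu>: "\<mu> \<in> P2" unfolding \<mu>_def by (rule distr_in_P2[OF M(1) X])
  obtain \<gamma> where \<gamma>: "\<gamma> \<in> couplings \<nu> \<mu>" and cost: "(\<integral>z. (dist (fst z) (snd z))\<^sup>2 \<partial>\<gamma>) < e\<^sup>2"
    using W2_less_imp_coupling[OF \<nu> \<mu> W[folded \<mu>_def]] by blast
  have s\<gamma> [measurable_cong]: "sets \<gamma> = sets (borel \<Otimes>\<^sub>M borel)" and \<gamma>1: "distr \<gamma> borel fst = \<nu>"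
    and \<gamma>2: "distr \<gamma> borel snd = \<mu>" using \<gamma> by (auto simp: couplings_def)
  have "prob_space \<nu>" using \<nu> by (simp add: P2_def)
  then interpret \<gamma>: prob_space \<gamma>
    unfolding \<gamma>1[symmetric] by (rule prob_space_distrD[rotated]) measurable
  have e: "0 < e"
    using W W2_nonneg[OF \<nu> \<mu>] by (simp add: \<mu>_def)
  \<comment> \<open>The squared distance ends up below 4 e^2 + 6 \<delta>^2, which is 5.5 e^2 for
    this choice and hence less than (3 e)^2.\<close>
  define \<delta> where "\<delta> = e / 2"
  have \<delta>: "0 < \<delta>" using e by (simp add: \<delta>_def)
  obtain D :: "(real ^ 'n) set" where D: "countable D" "\<And>U. open U \<Longrightarrow> U \<noteq> {} \<Longrightarrow> \<exists>d\<in>D. d \<in> U"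
    using countable_dense_setE by blast
  have "D \<noteq> {}" using D(2)[of UNIV] by auto
  define d where "d = from_nat_into D"
  \<comment> \<open>Rounding to the first point of a dense sequence within \<delta>; density makes
    the least index exist.\<close>
  define k where "k x = (LEAST m. dist x (d m) < \<delta>)" for x
  have km [measurable]: "k \<in> measurable borel (count_space UNIV)"
    unfolding k_def by measurable
  have near: "norm (x - d (k x)) < \<delta>" for x
  proof -
    obtain c where "c \<in> D" "c \<in> ball x \<delta>" using D(2)[of "ball x \<delta>"] \<delta> by auto
    moreover then obtain m where "c = d m"
      using range_from_nat_into[OF \<open>D \<noteq> {}\<close> D(1)] by (auto simp: d_def)
    ultimately have "dist x (d m) < \<delta>" by simp
    then show ?thesis unfolding k_def by (metis (no_types, lifting) LeastI dist_norm)
  qed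
  have [measurable]: "d \<in> borel_measurable (count_space UNIV)" by simp
  \<comment> \<open>In \<gamma> the law \<nu> comes first and \<mu> second, so the second coordinate
    is rounded and the order is exchanged.\<close>
  let ?\<gamma> = "distr \<gamma> (count_space UNIV \<Otimes>\<^sub>M borel) (\<lambda>z. (k (snd z), fst z))"
  have marg: "distr ?\<gamma> (count_space UNIV) fst = distr M (count_space UNIV) (\<lambda>\<omega>. k (X \<omega>))"
  proof -
    have "distr ?\<gamma> (count_space UNIV) fst = distr (distr \<gamma> borel snd) (count_space UNIV) k"
      by (simp add: distr_distr comp_def)
    also have "\<dots> = distr M (count_space UNIV) (\<lambda>\<omega>. k (X \<omega>))"
      unfolding \<gamma>2 \<mu>_def by (simp add: distr_distr comp_def)
    finally show ?thesis .
  qed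
  have fin: "finite_measure ?\<gamma>" by (rule \<gamma>.finite_measure_distr) measurable
  obtain Y where Ym [measurable]: "Y \<in> borel_measurable M"
    and law: "distr M (count_space UNIV \<Otimes>\<^sub>M borel) (\<lambda>\<omega>. (k (X \<omega>), Y \<omega>)) = ?\<gamma>"
    by (rule ex_joint_law[OF M.finite_measure_axioms M(2) null _ fin _ marg]) measurable
  have Y\<nu>: "distr M borel Y = \<nu>"
  proof -
    have "distr M borel Y = distr (distr M (count_space UNIV \<Otimes>\<^sub>M borel) (\<lambda>\<omega>. (k (X \<omega>), Y \<omega>))) borel snd"
      by (simp add: distr_distr comp_def)
    also have "\<dots> = distr \<gamma> borel fst"
      unfolding law by (simp add: distr_distr comp_def)
    finally show ?thesis by (simp add: \<gamma>1)
  qed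
  have Y: "Y \<in> L2 M" by (rule in_L2_if_distr_in_P2[OF Ym]) (simp add: Y\<nu> \<nu>)
  have i1: "integrable \<gamma> (\<lambda>z. (norm (fst z))\<^sup>2)"
  proof -
    have "integrable (distr \<gamma> borel fst) (\<lambda>x. (norm x)\<^sup>2)"
      using \<nu> by (simp add: \<gamma>1 P2_def)
    then show ?thesis by (subst (asm) integrable_distr_eq) auto
  qed
  have i2: "integrable \<gamma> (\<lambda>z. (norm (snd z))\<^sup>2)"
  proof -
    have "integrable (distr \<gamma> borel snd) (\<lambda>x. (norm x)\<^sup>2)"
      using \<mu> by (simp add: \<gamma>2 P2_def)
    then show ?thesis by (subst (asm) integrable_distr_eq) auto
  qed
  have int: "integrable \<gamma> (\<lambda>z. (dist (fst z) (snd z))\<^sup>2)"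
  proof (rule Bochner_Integration.integrable_bound)
    show "integrable \<gamma> (\<lambda>z. 2 * (norm (fst z))\<^sup>2 + 2 * (norm (snd z))\<^sup>2)"
      by (intro Bochner_Integration.integrable_add integrable_mult_right i1 i2)
    show "AE z in \<gamma>. norm ((dist (fst z) (snd z))\<^sup>2) \<le> norm (2 * (norm (fst z))\<^sup>2 + 2 * (norm (snd z))\<^sup>2)"
    proof (rule AE_I2)
      fix z
      show "norm ((dist (fst z) (snd z))\<^sup>2) \<le> norm (2 * (norm (fst z))\<^sup>2 + 2 * (norm (snd z))\<^sup>2)"
        using norm_add_square_le[of "fst z" "- snd z"] by (simp add: dist_norm)
    qed
  qed measurable
  have b1: "(norm (y - d (k x)))\<^sup>2 \<le> 2 * (dist y x)\<^sup>2 + 2 * \<delta>\<^sup>2" for x y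
  proof -
    have "(norm (y - d (k x)))\<^sup>2 \<le> 2 * (dist y x)\<^sup>2 + 2 * (norm (x - d (k x)))\<^sup>2"
      using norm_add_square_le[of "y - x" "x - d (k x)"] by (simp add: dist_norm)
    moreover have "(norm (x - d (k x)))\<^sup>2 \<le> \<delta>\<^sup>2"
      using near[of x] by (intro power_mono) auto
    ultimately show ?thesis by linarith
  qed
  have b2: "(norm (y - x))\<^sup>2 \<le> 2 * (norm (y - d (k x)))\<^sup>2 + 2 * \<delta>\<^sup>2" for x y
  proof -
    have "(norm (y - x))\<^sup>2 \<le> 2 * (norm (y - d (k x)))\<^sup>2 + 2 * (norm (x - d (k x)))\<^sup>2"
      using norm_add_square_le[of "y - d (k x)" "- (x - d (k x))"] by (simp add: norm_minus_commute)
    moreover have "(norm (x - d (k x)))\<^sup>2 \<le> \<delta>\<^sup>2"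
      using near[of x] by (intro power_mono) auto
    ultimately show ?thesis by linarith
  qed
  have int': "integrable \<gamma> (\<lambda>z. (norm (fst z - d (k (snd z))))\<^sup>2)"
  proof (rule Bochner_Integration.integrable_bound)
    show "integrable \<gamma> (\<lambda>z. 2 * (dist (fst z) (snd z))\<^sup>2 + 2 * \<delta>\<^sup>2)"
      by (intro Bochner_Integration.integrable_add integrable_mult_right int) simp
    show "AE z in \<gamma>. norm ((norm (fst z - d (k (snd z))))\<^sup>2) \<le> norm (2 * (dist (fst z) (snd z))\<^sup>2 + 2 * \<delta>\<^sup>2)"
    proof (rule AE_I2)
      fix z
      show "norm ((norm (fst z - d (k (snd z))))\<^sup>2) \<le> norm (2 * (dist (fst z) (snd z))\<^sup>2 + 2 * \<delta>\<^sup>2)"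
        using b1[of "fst z" "snd z"] by simp
    qed
  qed measurable
  \<comment> \<open>Only the joint law of \<open>k (X \<omega>)\<close> and Y is prescribed, not
    that of X and Y. Therefore the distance from Y to the rounded point is computed under \<gamma>,
    and X itself is recovered afterwards through \<open>b2\<close>.\<close>
  have "(\<integral>\<omega>. (norm (Y \<omega> - d (k (X \<omega>))))\<^sup>2 \<partial>M)
      = (\<integral>p. (norm (snd p - d (fst p)))\<^sup>2 \<partial>distr M (count_space UNIV \<Otimes>\<^sub>M borel) (\<lambda>\<omega>. (k (X \<omega>), Y \<omega>)))"
    by (subst integral_distr) auto
  also have "\<dots> = (\<integral>z. (norm (fst z - d (k (snd z))))\<^sup>2 \<partial>\<gamma>)"
    unfolding law by (subst integral_distr) auto
  also have "\<dots> \<le> (\<integral>z. 2 * (dist (fst z) (snd z))\<^sup>2 + 2 * \<delta>\<^sup>2 \<partial>\<gamma>)"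
    by (intro integral_mono int' Bochner_Integration.integrable_add integrable_mult_right int b1) simp
  also have "\<dots> = 2 * (\<integral>z. (dist (fst z) (snd z))\<^sup>2 \<partial>\<gamma>) + 2 * \<delta>\<^sup>2"
    using int by (simp add: \<gamma>.prob_space)
  finally have c1: "(\<integral>\<omega>. (norm (Y \<omega> - d (k (X \<omega>))))\<^sup>2 \<partial>M) < 2 * e\<^sup>2 + 2 * \<delta>\<^sup>2"
    using cost by linarith
  have int'': "integrable M (\<lambda>\<omega>. (norm (Y \<omega> - d (k (X \<omega>))))\<^sup>2)"
  proof -
    have "integrable ?\<gamma> (\<lambda>p. (norm (snd p - d (fst p)))\<^sup>2)"
      by (subst integrable_distr_eq) (use int' in auto)
    then show ?thesis
      unfolding law[symmetric] by (subst (asm) integrable_distr_eq) auto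
  qed
  have "(L2_norm M (\<lambda>\<omega>. Y \<omega> - X \<omega>))\<^sup>2 \<le> (\<integral>\<omega>. 2 * (norm (Y \<omega> - d (k (X \<omega>))))\<^sup>2 + 2 * \<delta>\<^sup>2 \<partial>M)"
    unfolding L2_norm_square
    by (intro integral_mono Bochner_Integration.integrable_add integrable_mult_right int'' b2
        L2_integrable L2_diff X Y) simp
  also have "\<dots> = 2 * (\<integral>\<omega>. (norm (Y \<omega> - d (k (X \<omega>))))\<^sup>2 \<partial>M) + 2 * \<delta>\<^sup>2"
    using int'' by (simp add: M.prob_space)
  also have "\<dots> < 4 * e\<^sup>2 + 6 * \<delta>\<^sup>2" using c1 by linarith
  also have "\<dots> \<le> (3 * e)\<^sup>2" by (simp add: \<delta>_def power2_eq_square)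
  finally have "L2_norm M (\<lambda>\<omega>. Y \<omega> - X \<omega>) < 3 * e"
    by (rule power_less_imp_less_base) (use e in simp)
  with Y Y\<nu> show ?thesis by (rule that)
qed

section \<open>Continuous maps of linear growth\<close>

lemma C1_growth_continuous: "w \<in> C1_growth \<Longrightarrow> continuous_on UNIV w"
  by (simp add: C1_growth_def)

lemma C1_growth_measurable: "w \<in> C1_growth \<Longrightarrow> w \<in> borel_measurable borel"
  by (simp add: C1_growth_def borel_measurable_continuous_onI)

lemma C1_growth_square_bound:
  assumes "w \<in> C1_growth"
  obtains C where "0 \<le> C" "\<And>x. (norm (w x))\<^sup>2 \<le> C * (1 + (norm x)\<^sup>2)"
proof -
  obtain B where B: "\<And>x. norm (w x) / (1 + norm x) \<le> B"
    using assms by (auto simp: C1_growth_def bdd_above_def)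
  have pos: "0 < 1 + norm x" for x :: "real ^ 'n" by (simp add: add_pos_nonneg)
  have w: "norm (w x) \<le> B * (1 + norm x)" for x
    using B[of x] pos[of x] by (simp add: divide_le_eq)
  show ?thesis
  proof (rule that)
    show "0 \<le> 2 * B\<^sup>2" by simp
    fix x
    have "(norm (w x))\<^sup>2 \<le> (B * (1 + norm x))\<^sup>2" by (intro power_mono w norm_ge_zero)
    also have "\<dots> = B\<^sup>2 * (1 + norm x)\<^sup>2" by (rule power_mult_distrib)
    also have "\<dots> \<le> B\<^sup>2 * (2 * (1 + (norm x)\<^sup>2))"
      using sum_squares_bound[of 1 "norm x"] by (intro mult_left_mono) (auto simp: power2_sum)
    finally show "(norm (w x))\<^sup>2 \<le> 2 * B\<^sup>2 * (1 + (norm x)\<^sup>2)" by (simp add: algebra_simps)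
  qed
qed

lemma C1_growth_comp_L2:
  assumes M: "finite_measure M" and w: "w \<in> C1_growth" and X: "X \<in> L2 M"
  shows "w \<circ> X \<in> L2 M"
proof -
  interpret finite_measure M by (rule M)
  have [measurable]: "w \<in> borel_measurable borel" "X \<in> borel_measurable M"
    using C1_growth_measurable[OF w] L2_measurable[OF X] by auto
  obtain C where C: "0 \<le> C" "\<And>x. (norm (w x))\<^sup>2 \<le> C * (1 + (norm x)\<^sup>2)"
    using C1_growth_square_bound[OF w] by blast
  have "integrable M (\<lambda>\<omega>. (norm (w (X \<omega>)))\<^sup>2)"
  proof (rule Bochner_Integration.integrable_bound)
    show "integrable M (\<lambda>\<omega>. C * (1 + (norm (X \<omega>))\<^sup>2))"
      by (intro integrable_mult_right Bochner_Integration.integrable_add L2_integrable X) simp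
    show "AE \<omega> in M. norm ((norm (w (X \<omega>)))\<^sup>2) \<le> norm (C * (1 + (norm (X \<omega>))\<^sup>2))"
      using C by (intro AE_I2) (simp add: abs_mult)
  qed measurable
  then show ?thesis by (simp add: L2_def comp_def)
qed

lemma C1_growth_subset_L2:
  fixes \<mu> :: "(real ^ 'n) measure"
  assumes "\<mu> \<in> P2"
  shows "C1_growth \<subseteq> L2 \<mu>"
proof
  fix w :: "real ^ 'n \<Rightarrow> real ^ 'n" assume w: "w \<in> C1_growth"
  have "finite_measure \<mu>" using assms by (simp add: P2_def prob_space.finite_measure)
  moreover have "(\<lambda>x. x) \<in> L2 \<mu>"
    using assms by (auto simp: P2_def L2_def cong: measurable_cong_sets)
  ultimately have "w \<circ> (\<lambda>x. x) \<in> L2 \<mu>" using w by (intro C1_growth_comp_L2)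
  then show "w \<in> L2 \<mu>" by (simp add: comp_def)
qed

text \<open>
  Along a sequence converging fast in \<open>L\<^sup>2\<close> the squared differences are summable almost
  everywhere, which gives both almost everywhere convergence and an integrable bound.
\<close>

lemma C1_growth_comp_continuous:
  assumes M: "finite_measure M" and w: "w \<in> C1_growth" and X: "X \<in> L2 M" and e: "0 < e"
  obtains d where "0 < d" and "\<And>Y. Y \<in> L2 M \<Longrightarrow> L2_norm M (\<lambda>\<omega>. Y \<omega> - X \<omega>) < d \<Longrightarrow>
    L2_norm M (\<lambda>\<omega>. w (Y \<omega>) - w (X \<omega>)) < e"
proof -
  interpret finite_measure M by (rule M)
  have "\<exists>d>0. \<forall>Y\<in>L2 M. L2_norm M (\<lambda>\<omega>. Y \<omega> - X \<omega>) < d \<longrightarrow> L2_norm M (\<lambda>\<omega>. w (Y \<omega>) - w (X \<omega>)) < e"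
  proof (rule ccontr)
    assume "\<not> ?thesis"
    then have "\<forall>k::nat. \<exists>Y. Y \<in> L2 M \<and> L2_norm M (\<lambda>\<omega>. Y \<omega> - X \<omega>) < (1/2) ^ k \<and>
        e \<le> L2_norm M (\<lambda>\<omega>. w (Y \<omega>) - w (X \<omega>))"
      by (meson not_less zero_less_divide_1_iff zero_less_numeral zero_less_power)
    from choice[OF this] obtain Y where Y: "\<And>k::nat. Y k \<in> L2 M"
      and close: "\<And>k. L2_norm M (\<lambda>\<omega>. Y k \<omega> - X \<omega>) < (1/2) ^ k"
      and far: "\<And>k. e \<le> L2_norm M (\<lambda>\<omega>. w (Y k \<omega>) - w (X \<omega>))" by blast
    have [measurable]: "w \<in> borel_measurable borel" "X \<in> borel_measurable M" "Y k \<in> borel_measurable M" for k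
      using C1_growth_measurable[OF w] L2_measurable[OF X] L2_measurable[OF Y] by auto
    obtain C where C: "0 \<le> C" "\<And>x. (norm (w x))\<^sup>2 \<le> C * (1 + (norm x)\<^sup>2)"
      using C1_growth_square_bound[OF w] by blast
    define s where "s k \<omega> = (norm (Y k \<omega> - X \<omega>))\<^sup>2" for k \<omega>
    define h where "h \<omega> = (\<Sum>k. s k \<omega>)" for \<omega>
    have sm [measurable]: "s k \<in> borel_measurable M" for k unfolding s_def by measurable
    have int_s: "integrable M (s k)" for k
      unfolding s_def by (intro L2_integrable L2_diff X Y)
    have le_s: "(\<integral>\<omega>. s k \<omega> \<partial>M) \<le> (1/4) ^ k" for k
    proof -
      have "(\<integral>\<omega>. s k \<omega> \<partial>M) = (L2_norm M (\<lambda>\<omega>. Y k \<omega> - X \<omega>))\<^sup>2" by (simp add: s_def L2_norm_square)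
      also have "\<dots> \<le> ((1/2) ^ k)\<^sup>2"
        by (intro power_mono less_imp_le close L2_norm_nonneg)
      also have "\<dots> = (1/4) ^ k" by (simp add: power2_eq_square flip: power_mult_distrib)
      finally show ?thesis .
    qed
    have nonneg_s: "0 \<le> s k \<omega>" for k \<omega> by (simp add: s_def)
    have summable_c: "summable (\<lambda>k. (1/4 :: real) ^ k)" by (rule summable_geometric) simp
    have summ: "AE \<omega> in M. summable (\<lambda>k. s k \<omega>)" and int_h: "integrable M h"
      using AE_summable_if_summable_integrals[OF int_s nonneg_s le_s summable_c] by (simp_all add: h_def[abs_def])
    have "(\<lambda>k. \<integral>\<omega>. (norm (w (Y k \<omega>) - w (X \<omega>)))\<^sup>2 \<partial>M) \<longlonglongrightarrow> (\<integral>\<omega>. 0 \<partial>M)"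
    proof (rule integral_dominated_convergence)
      \<comment> \<open>Each term satisfies \<open>s k \<omega> \<le> h \<omega>\<close>, so |Y k|^2
        is at most 2 h + 2 |X|^2. The growth bound of w, applied to Y k and to X, then gives this
        dominating function.\<close>
      show "integrable M (\<lambda>\<omega>. 2 * (C * (1 + (2 * h \<omega> + 2 * (norm (X \<omega>))\<^sup>2))) + 2 * (C * (1 + (norm (X \<omega>))\<^sup>2)))"
        by (intro Bochner_Integration.integrable_add integrable_mult_right int_h L2_integrable X) simp_all
      show "AE \<omega> in M. (\<lambda>k. (norm (w (Y k \<omega>) - w (X \<omega>)))\<^sup>2) \<longlonglongrightarrow> 0"
        using summ
      proof eventually_elim
        case (elim \<omega>)
        then have "(\<lambda>k. sqrt (s k \<omega>)) \<longlonglongrightarrow> sqrt 0"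
          by (intro tendsto_real_sqrt summable_LIMSEQ_zero)
        then have "(\<lambda>k. Y k \<omega> - X \<omega>) \<longlonglongrightarrow> 0"
          by (simp add: s_def tendsto_norm_zero_iff)
        then have "(\<lambda>k. Y k \<omega>) \<longlonglongrightarrow> X \<omega>" by (simp add: LIM_zero_iff)
        then have "(\<lambda>k. w (Y k \<omega>)) \<longlonglongrightarrow> w (X \<omega>)"
          using C1_growth_continuous[OF w] by (intro continuous_on_tendsto_compose[of UNIV w]) auto
        then have "(\<lambda>k. (norm (w (Y k \<omega>) - w (X \<omega>)))\<^sup>2) \<longlonglongrightarrow> (norm (w (X \<omega>) - w (X \<omega>)))\<^sup>2"
          by (intro tendsto_intros)
        then show ?case by simp
      qed
      show "AE \<omega> in M. norm ((norm (w (Y k \<omega>) - w (X \<omega>)))\<^sup>2)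
          \<le> 2 * (C * (1 + (2 * h \<omega> + 2 * (norm (X \<omega>))\<^sup>2))) + 2 * (C * (1 + (norm (X \<omega>))\<^sup>2))" for k
        using summ
      proof eventually_elim
        case (elim \<omega>)
        have "s k \<omega> \<le> h \<omega>"
          using sum_le_suminf[OF elim, of "{k}"] nonneg_s by (simp add: h_def)
        then have "(norm (Y k \<omega>))\<^sup>2 \<le> 2 * h \<omega> + 2 * (norm (X \<omega>))\<^sup>2"
          using norm_add_square_le[of "Y k \<omega> - X \<omega>" "X \<omega>"] by (simp add: s_def)
        then have "C * (1 + (norm (Y k \<omega>))\<^sup>2) \<le> C * (1 + (2 * h \<omega> + 2 * (norm (X \<omega>))\<^sup>2))"
          using C(1) by (intro mult_left_mono) auto
        then show ?case
          using norm_add_square_le[of "w (Y k \<omega>)" "- w (X \<omega>)"] C(2)[of "Y k \<omega>"] C(2)[of "X \<omega>"] by simp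
      qed
    qed measurable
    then have "(\<lambda>k. sqrt (\<integral>\<omega>. (norm (w (Y k \<omega>) - w (X \<omega>)))\<^sup>2 \<partial>M)) \<longlonglongrightarrow> sqrt 0"
      by (intro tendsto_real_sqrt) simp
    then have "(\<lambda>k. L2_norm M (\<lambda>\<omega>. w (Y k \<omega>) - w (X \<omega>))) \<longlonglongrightarrow> 0"
      by (simp add: L2_norm_def)
    then have "e \<le> 0" by (rule LIMSEQ_le_const) (use far in blast)
    then show False using e by simp
  qed
  then show ?thesis using that by blast
qed

section \<open>Density of the continuous maps of linear growth\<close>

lemma C1_growth_zero: "(\<lambda>x. 0) \<in> C1_growth"
  by (auto simp: C1_growth_def)

lemma C1_growth_add:
  assumes v: "v \<in> C1_growth" and w: "w \<in> C1_growth"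
  shows "(\<lambda>x. v x + w x) \<in> C1_growth"
proof -
  obtain A B where A: "\<And>x. norm (v x) / (1 + norm x) \<le> A" and B: "\<And>x. norm (w x) / (1 + norm x) \<le> B"
    using v w by (auto simp: C1_growth_def bdd_above_def)
  have "norm (v x + w x) / (1 + norm x) \<le> A + B" for x
  proof -
    have "norm (v x + w x) / (1 + norm x) \<le> (norm (v x) + norm (w x)) / (1 + norm x)"
      by (intro divide_right_mono norm_triangle_ineq) simp
    then show ?thesis using A[of x] B[of x] by (simp add: add_divide_distrib)
  qed
  then show ?thesis
    using v w by (auto simp: C1_growth_def intro!: continuous_on_add bdd_aboveI2)
qed

lemma bounded_continuous_in_C1_growth:
  fixes w :: "real ^ 'n \<Rightarrow> real ^ 'n"
  assumes "continuous_on UNIV w" and "\<And>x. norm (w x) \<le> B"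
  shows "w \<in> C1_growth"
proof -
  have "norm (w x) / (1 + norm x) \<le> B" for x
  proof -
    have "norm (w x) / (1 + norm x) \<le> norm (w x) / 1"
      by (intro divide_left_mono) (auto simp: add_pos_nonneg)
    then show ?thesis using assms(2)[of x] by simp
  qed
  then show ?thesis using assms(1) by (auto simp: C1_growth_def intro!: bdd_aboveI2)
qed

context
  fixes \<mu> :: "(real ^ 'n) measure"
  assumes \<mu>: "finite_measure \<mu>" and sets_\<mu>: "sets \<mu> = sets borel"
begin

text \<open>Membership in the closure of \<open>C1_growth\<close>. As a predicate that is stable
  under sums it allows induction over the finite range of a simple function.\<close>

definition approximable :: "(real ^ 'n \<Rightarrow> real ^ 'n) \<Rightarrow> bool" where
  "approximable \<beta> \<longleftrightarrow> \<beta> \<in> L2 \<mu> \<and>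
    (\<forall>e>0. \<exists>w\<in>C1_growth. w \<in> L2 \<mu> \<and> L2_norm \<mu> (\<lambda>x. w x - \<beta> x) < e)"

lemma approximable_zero: "approximable (\<lambda>x. 0)"
  unfolding approximable_def using C1_growth_zero L2_zero by fastforce

lemma approximable_add:
  assumes f: "approximable f" and g: "approximable g"
  shows "approximable (\<lambda>x. f x + g x)"
  unfolding approximable_def
proof (intro conjI allI impI)
  show "(\<lambda>x. f x + g x) \<in> L2 \<mu>" using f g by (auto simp: approximable_def intro: L2_add)
  fix e :: real assume "0 < e"
  then obtain v w where v: "v \<in> C1_growth" "v \<in> L2 \<mu>" "L2_norm \<mu> (\<lambda>x. v x - f x) < e / 2"
    and w: "w \<in> C1_growth" "w \<in> L2 \<mu>" "L2_norm \<mu> (\<lambda>x. w x - g x) < e / 2"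
    using f g unfolding approximable_def by (meson half_gt_zero)
  have "L2_norm \<mu> (\<lambda>x. (v x - f x) + (w x - g x)) \<le> L2_norm \<mu> (\<lambda>x. v x - f x) + L2_norm \<mu> (\<lambda>x. w x - g x)"
    using f g v w by (intro L2_norm_triangle L2_diff) (auto simp: approximable_def)
  then have "L2_norm \<mu> (\<lambda>x. (v x + w x) - (f x + g x)) < e"
    using v(3) w(3) by (simp add: algebra_simps)
  then show "\<exists>w\<in>C1_growth. w \<in> L2 \<mu> \<and> L2_norm \<mu> (\<lambda>x. w x - (f x + g x)) < e"
    using C1_growth_add[OF v(1) w(1)] L2_add[OF v(2) w(2)] by blast
qed

text \<open>Outer regularity for B and for its complement encloses B between the closed set
  \<open>- U'\<close> and the open set U. A Urysohn function equal to v on the first and to 0 off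
  the second is wrong only on a set of measure below 2 \<eta>.\<close>

lemma approximable_indicator:
  assumes B: "B \<in> sets borel"
  shows "approximable (\<lambda>x. indicator B x *\<^sub>R v)"
  unfolding approximable_def
proof (intro conjI allI impI)
  interpret finite_measure \<mu> by (rule \<mu>)
  have [measurable_cong]: "sets \<mu> = sets borel" by (rule sets_\<mu>)
  note [measurable] = B
  have "norm (indicator B x *\<^sub>R v) \<le> norm v" for x by (auto simp: indicator_def)
  then show L2B: "(\<lambda>x. indicator B x *\<^sub>R v) \<in> L2 \<mu>" by (intro L2_bounded) auto
  fix e :: real assume e: "0 < e"
  \<comment> \<open>Chosen so that |v|^2 times 2 \<eta> is less than e^2; the summand 1 covers v =
    0.\<close>
  define \<eta> where "\<eta> = e\<^sup>2 / (2 * ((norm v)\<^sup>2 + 1))"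
  have \<eta>: "0 < \<eta>" using e by (simp add: \<eta>_def add_nonneg_pos)
  have outer: "\<exists>U. A \<subseteq> U \<and> open U \<and> measure \<mu> (U - A) < \<eta>" if A: "A \<in> sets borel" for A
  proof -
    have "emeasure \<mu> A < emeasure \<mu> A + ennreal \<eta>"
      using \<eta> by (simp add: emeasure_eq_measure ennreal_plus[symmetric] ennreal_less_iff del: ennreal_plus)
    then have "(INF U\<in>{U. A \<subseteq> U \<and> open U}. emeasure \<mu> U) < emeasure \<mu> A + ennreal \<eta>"
      using outer_regular[OF sets_\<mu> _ A] by simp
    then obtain U where U: "A \<subseteq> U" "open U" "emeasure \<mu> U < emeasure \<mu> A + ennreal \<eta>"
      by (auto simp: INF_less_iff)
    then have "measure \<mu> U < measure \<mu> A + \<eta>"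
      using \<eta> by (simp add: emeasure_eq_measure ennreal_plus[symmetric] ennreal_less_iff del: ennreal_plus)
    moreover have "measure \<mu> (U - A) = measure \<mu> U - measure \<mu> A"
      using U A by (intro finite_measure_Diff) (auto simp: sets_\<mu>)
    ultimately show ?thesis using U by auto
  qed
  obtain U where U: "B \<subseteq> U" "open U" "measure \<mu> (U - B) < \<eta>" using outer[OF B] by blast
  obtain U' where U': "- B \<subseteq> U'" "open U'" "measure \<mu> (U' - (- B)) < \<eta>"
    using outer[of "- B"] B by auto
  obtain f :: "real ^ 'n \<Rightarrow> real ^ 'n" where f: "continuous_on UNIV f" "\<And>x. f x \<in> closed_segment v 0"
    "\<And>x. x \<in> - U' \<Longrightarrow> f x = v" "\<And>x. x \<in> - U \<Longrightarrow> f x = 0"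
    using Urysohn[of "- U'" "- U" v 0] U U' by auto
  have fn: "norm (f x) \<le> norm v" for x
  proof -
    obtain u where "0 \<le> u" "u \<le> 1" "f x = (1 - u) *\<^sub>R v"
      using f(2)[of x] by (auto simp: closed_segment_def)
    then show ?thesis by (simp add: mult_left_le_one_le)
  qed
  have fC: "f \<in> C1_growth" by (rule bounded_continuous_in_C1_growth[OF f(1) fn])
  have [measurable]: "f \<in> borel_measurable borel" using fC by (rule C1_growth_measurable)
  have fL: "f \<in> L2 \<mu>" by (rule L2_bounded[of _ "norm v"]) (auto intro: fn)
  have [measurable]: "U \<in> sets borel" "U' \<in> sets borel" using U U' by auto
  let ?D = "(U - B) \<union> (U' - (- B))"
  \<comment> \<open>Both values lie on the segment from 0 to v, so they differ by at most |v|;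
    outside \<open>?D\<close> they agree.\<close>
  have diff: "(norm (f x - indicator B x *\<^sub>R v))\<^sup>2 \<le> (norm v)\<^sup>2 * indicator ?D x" for x
  proof (cases "x \<in> ?D")
    case True
    have "norm (f x - indicator B x *\<^sub>R v) \<le> norm v"
    proof (cases "x \<in> B")
      case True
      obtain u where u: "0 \<le> u" "u \<le> 1" "f x = (1 - u) *\<^sub>R v"
        using f(2)[of x] by (auto simp: closed_segment_def)
      then have "f x - v = - (u *\<^sub>R v)" by (simp add: scaleR_diff_left)
      then show ?thesis using True u(1,2) by (simp add: mult_left_le_one_le)
    qed (use fn in simp)
    then have "(norm (f x - indicator B x *\<^sub>R v))\<^sup>2 \<le> (norm v)\<^sup>2" by (intro power_mono) auto
    then show ?thesis using True by simp
  next
    case False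
    then show ?thesis using f(3,4)[of x] U(1) U'(1) by (cases "x \<in> B") auto
  qed
  have "(L2_norm \<mu> (\<lambda>x. f x - indicator B x *\<^sub>R v))\<^sup>2 \<le> (\<integral>x. (norm v)\<^sup>2 * indicator ?D x \<partial>\<mu>)"
    unfolding L2_norm_square
    by (intro integral_mono diff L2_integrable L2_diff fL L2B integrable_mult_right
        integrable_real_indicator) (auto simp: emeasure_eq_measure)
  also have "\<dots> = (norm v)\<^sup>2 * measure \<mu> ?D"
    by (simp add: sets_\<mu>)
  also have "\<dots> \<le> (norm v)\<^sup>2 * (\<eta> + \<eta>)"
  proof (rule mult_left_mono)
    have "measure \<mu> ?D \<le> measure \<mu> (U - B) + measure \<mu> (U' - (- B))"
      by (rule measure_Un_le) measurable
    then show "measure \<mu> ?D \<le> \<eta> + \<eta>" using U(3) U'(3) by linarith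
  qed simp
  also have "\<dots> < e\<^sup>2"
  proof -
    have "(norm v)\<^sup>2 + 1 \<noteq> 0" using zero_le_power2[of "norm v"] by linarith
    then have "\<eta> * (2 * ((norm v)\<^sup>2 + 1)) = e\<^sup>2" by (simp add: \<eta>_def)
    then show ?thesis using \<eta> by (simp add: algebra_simps)
  qed
  finally have "L2_norm \<mu> (\<lambda>x. f x - indicator B x *\<^sub>R v) < e"
    by (rule power_less_imp_less_base) (use e in simp)
  then show "\<exists>w\<in>C1_growth. w \<in> L2 \<mu> \<and> L2_norm \<mu> (\<lambda>x. w x - indicator B x *\<^sub>R v) < e"
    using fC fL by blast
qed

lemma approximable_simple:
  assumes s: "simple_function \<mu> s"
  shows "approximable s"
proof -
  have sp: "space \<mu> = UNIV" using sets_eq_imp_space_eq[OF sets_\<mu>] by simp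
  have fin: "finite (range s)" using s by (simp add: simple_function_def sp)
  have "approximable (\<lambda>x. \<Sum>v\<in>A. indicator (s -` {v}) x *\<^sub>R v)" if "finite A" for A
    using that
  proof induction
    case (insert v A)
    have "s -` {v} \<in> sets borel"
      using simple_functionD(2)[OF s, of "{v}"] by (simp add: sp sets_\<mu>)
    then show ?case
      unfolding sum.insert[OF insert.hyps]
      by (intro approximable_add approximable_indicator insert.IH)
  qed (simp add: approximable_zero)
  from this[OF fin] show ?thesis
  proof (rule back_subst[of approximable])
    show "(\<lambda>x. \<Sum>v\<in>range s. indicator (s -` {v}) x *\<^sub>R v) = s"
    proof
      fix x
      have "(\<Sum>v\<in>range s. indicator (s -` {v}) x *\<^sub>R v) = (\<Sum>v\<in>range s. if v = s x then v else 0)"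
        by (intro sum.cong) (auto simp: indicator_def)
      then show "(\<Sum>v\<in>range s. indicator (s -` {v}) x *\<^sub>R v) = s x"
        using fin by simp
    qed
  qed
qed

text \<open>Simple functions with |s i| \<le> 2 |\<beta>| converge pointwise, and 9 |\<beta>|^2
  dominates the squared errors; each of them is approximable in turn.\<close>

lemma C1_growth_dense:
  assumes \<beta>: "\<beta> \<in> L2 \<mu>" and e: "0 < e"
  obtains w where "w \<in> C1_growth" "w \<in> L2 \<mu>" "L2_norm \<mu> (\<lambda>x. w x - \<beta> x) < e"
proof -
  have sp: "space \<mu> = UNIV" using sets_eq_imp_space_eq[OF sets_\<mu>] by simp
  have [measurable]: "\<beta> \<in> borel_measurable \<mu>" using \<beta> by (rule L2_measurable)
  obtain s where s: "\<And>i. simple_function \<mu> (s i)" and lim: "\<And>x. (\<lambda>i. s i x) \<longlonglongrightarrow> \<beta> x"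
    and bound: "\<And>i x. norm (s i x) \<le> 2 * norm (\<beta> x)"
    using borel_measurable_implies_sequence_metric[of \<beta> \<mu> 0] by (auto simp: sp)
  have [measurable]: "s i \<in> borel_measurable \<mu>" for i using s by (rule borel_measurable_simple_function)
  have "(\<lambda>i. \<integral>x. (norm (s i x - \<beta> x))\<^sup>2 \<partial>\<mu>) \<longlonglongrightarrow> (\<integral>x. 0 \<partial>\<mu>)"
  proof (rule integral_dominated_convergence)
    show "integrable \<mu> (\<lambda>x. 9 * (norm (\<beta> x))\<^sup>2)"
      by (intro integrable_mult_right L2_integrable \<beta>)
    show "AE x in \<mu>. (\<lambda>i. (norm (s i x - \<beta> x))\<^sup>2) \<longlonglongrightarrow> 0"
    proof (rule AE_I2)
      fix x
      have "(\<lambda>i. (norm (s i x - \<beta> x))\<^sup>2) \<longlonglongrightarrow> (norm (\<beta> x - \<beta> x))\<^sup>2"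
        by (intro tendsto_intros lim)
      then show "(\<lambda>i. (norm (s i x - \<beta> x))\<^sup>2) \<longlonglongrightarrow> 0" by simp
    qed
    show "AE x in \<mu>. norm ((norm (s i x - \<beta> x))\<^sup>2) \<le> 9 * (norm (\<beta> x))\<^sup>2" for i
    proof (rule AE_I2)
      fix x
      have "norm (s i x - \<beta> x) \<le> 3 * norm (\<beta> x)"
        using norm_triangle_ineq4[of "s i x" "\<beta> x"] bound[of i x] by linarith
      then have "(norm (s i x - \<beta> x))\<^sup>2 \<le> (3 * norm (\<beta> x))\<^sup>2" by (intro power_mono) auto
      then show "norm ((norm (s i x - \<beta> x))\<^sup>2) \<le> 9 * (norm (\<beta> x))\<^sup>2"
        by (simp add: power_mult_distrib)
    qed
  qed measurable
  then have "(\<lambda>i. sqrt (\<integral>x. (norm (s i x - \<beta> x))\<^sup>2 \<partial>\<mu>)) \<longlonglongrightarrow> sqrt 0"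
    by (intro tendsto_real_sqrt) simp
  then have "eventually (\<lambda>i. L2_norm \<mu> (\<lambda>x. s i x - \<beta> x) < e / 2) sequentially"
    using e by (intro order_tendstoD(2)[of _ 0]) (simp_all add: L2_norm_def)
  then obtain i where i: "L2_norm \<mu> (\<lambda>x. s i x - \<beta> x) < e / 2"
    by (auto simp: eventually_sequentially)
  obtain w where w: "w \<in> C1_growth" "w \<in> L2 \<mu>" "L2_norm \<mu> (\<lambda>x. w x - s i x) < e / 2"
    using approximable_simple[OF s[of i]] e unfolding approximable_def by (meson half_gt_zero)
  have "s i \<in> L2 \<mu>" using approximable_simple[OF s] by (simp add: approximable_def)
  then have "L2_norm \<mu> (\<lambda>x. w x - \<beta> x) < e"
    using L2_norm_triangle_diff[OF w(2) _ \<beta>, of "s i"] w(3) i by simp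
  with w show ?thesis by (intro that)
qed

end

section \<open>Barycentric projections and conditional expectations\<close>

lemma integrable_component_product:
  assumes f: "f \<in> L2 M" and g: "g \<in> L2 M"
  shows "integrable M (\<lambda>x. f x $ i * g x $ i)"
proof (rule Bochner_Integration.integrable_bound)
  have nth: "(\<lambda>v::real ^ 'n. v $ i) \<in> borel_measurable borel" for i
    by (intro borel_measurable_continuous_onI continuous_intros)
  note [measurable] = L2_measurable[OF f] L2_measurable[OF g] nth
  show "integrable M (\<lambda>x. (norm (f x))\<^sup>2 + (norm (g x))\<^sup>2)"
    by (intro Bochner_Integration.integrable_add L2_integrable f g)
  show "AE x in M. norm (f x $ i * g x $ i) \<le> norm ((norm (f x))\<^sup>2 + (norm (g x))\<^sup>2)"
  proof (rule AE_I2)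
    fix x
    have "\<bar>f x $ i * g x $ i\<bar> \<le> norm (f x) * norm (g x)"
      unfolding abs_mult by (intro mult_mono component_le_norm_cart) auto
    moreover have "2 * (norm (f x) * norm (g x)) \<le> (norm (f x))\<^sup>2 + (norm (g x))\<^sup>2"
      using sum_squares_bound[of "norm (f x)" "norm (g x)"] by simp
    moreover have "0 \<le> norm (f x) * norm (g x)" by simp
    ultimately show "norm (f x $ i * g x $ i) \<le> norm ((norm (f x))\<^sup>2 + (norm (g x))\<^sup>2)"
      unfolding real_norm_def by linarith
  qed
  show "(\<lambda>x. f x $ i * g x $ i) \<in> borel_measurable M" by measurable
qed

text \<open>Forward, in each coordinate the factor \<open>\<beta> \<circ> X\<close> is measurable
  for the sigma-algebra of X and may be pulled out of the conditional expectation. Backward,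
  suitable \<beta> reproduce its defining integrals. The coordinate-wise definition thus becomes the
  orthogonality statement that fits Hilbert space arguments.\<close>

lemma Bar_iff_inner:
  fixes X Z :: "'w \<Rightarrow> real ^ 'n"
  assumes M: "prob_space M" and X [measurable]: "X \<in> borel_measurable M" and Z: "Z \<in> L2 M"
    and b: "b \<in> L2 (distr M borel X)"
  shows "b \<in> Bar M X Z \<longleftrightarrow>
    (\<forall>\<beta>\<in>L2 (distr M borel X). L2_inner (distr M borel X) b \<beta> = L2_inner M Z (\<beta> \<circ> X))"
proof -
  interpret prob_space M by (rule M)
  let ?\<mu> = "distr M borel X" and ?F = "vimage_algebra (space M) X borel"
  interpret \<mu>: prob_space ?\<mu> by (rule prob_space_distr) measurable
  have Zm [measurable]: "Z \<in> borel_measurable M" using Z by (rule L2_measurable)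
  have bm [measurable]: "b \<in> borel_measurable borel" using b by (simp add: L2_def)
  have XF: "X \<in> ?F \<rightarrow>\<^sub>M borel" by (rule measurable_vimage_algebra1) auto
  have sub: "subalgebra M ?F"
    unfolding subalgebra_def by (auto simp: sets_vimage_algebra2 intro: measurable_sets[OF X])
  interpret F: finite_measure_subalgebra M ?F
    by (intro finite_measure_subalgebra.intro finite_measure_subalgebra_axioms.intro sub finite_measure_axioms)
  have nth [measurable]: "(\<lambda>v::real ^ 'n. v $ i) \<in> borel_measurable borel" for i
    by (intro borel_measurable_continuous_onI continuous_intros)
  have bX: "b \<circ> X \<in> L2 M" by (rule L2_distr[OF X b])
  show ?thesis
  proof
    assume B: "b \<in> Bar M X Z"
    show "\<forall>\<beta>\<in>L2 ?\<mu>. L2_inner ?\<mu> b \<beta> = L2_inner M Z (\<beta> \<circ> X)"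
    proof
      fix \<beta> :: "real ^ 'n \<Rightarrow> real ^ 'n" assume \<beta>: "\<beta> \<in> L2 ?\<mu>"
      have [measurable]: "\<beta> \<in> borel_measurable borel" using \<beta> by (simp add: L2_def)
      have \<beta>X: "\<beta> \<circ> X \<in> L2 M" by (rule L2_distr[OF X \<beta>])
      have eq: "(\<integral>\<omega>. b (X \<omega>) $ i * \<beta> (X \<omega>) $ i \<partial>M) = (\<integral>\<omega>. Z \<omega> $ i * \<beta> (X \<omega>) $ i \<partial>M)" for i
      proof -
        have "(\<integral>\<omega>. b (X \<omega>) $ i * \<beta> (X \<omega>) $ i \<partial>M)
            = (\<integral>\<omega>. \<beta> (X \<omega>) $ i * real_cond_exp M ?F (\<lambda>\<omega>. Z \<omega> $ i) \<omega> \<partial>M)"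
        proof (rule integral_cong_AE)
          have "AE \<omega> in M. b (X \<omega>) $ i = real_cond_exp M ?F (\<lambda>\<omega>. Z \<omega> $ i) \<omega>"
            using B by (simp add: Bar_def)
          then show "AE \<omega> in M. b (X \<omega>) $ i * \<beta> (X \<omega>) $ i
              = \<beta> (X \<omega>) $ i * real_cond_exp M ?F (\<lambda>\<omega>. Z \<omega> $ i) \<omega>"
            by eventually_elim simp
        qed measurable
        also have "\<dots> = (\<integral>\<omega>. \<beta> (X \<omega>) $ i * Z \<omega> $ i \<partial>M)"
        proof (rule F.real_cond_exp_intg(2))
          show "integrable M (\<lambda>\<omega>. \<beta> (X \<omega>) $ i * Z \<omega> $ i)"
            using integrable_component_product[OF \<beta>X Z, of i] by simp
          show "(\<lambda>\<omega>. \<beta> (X \<omega>) $ i) \<in> borel_measurable ?F"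
            by (rule measurable_compose[OF XF]) measurable
        qed measurable
        finally show ?thesis by (simp add: mult.commute)
      qed
      have "L2_inner ?\<mu> b \<beta> = (\<integral>\<omega>. b (X \<omega>) \<bullet> \<beta> (X \<omega>) \<partial>M)"
        by (simp add: L2_inner_distr) (simp add: L2_inner_def)
      also have "\<dots> = (\<Sum>i\<in>UNIV. \<integral>\<omega>. b (X \<omega>) $ i * \<beta> (X \<omega>) $ i \<partial>M)"
        unfolding inner_vec_def inner_real_def
        using integrable_component_product[OF bX \<beta>X] by (intro Bochner_Integration.integral_sum) simp
      also have "\<dots> = (\<Sum>i\<in>UNIV. \<integral>\<omega>. Z \<omega> $ i * \<beta> (X \<omega>) $ i \<partial>M)"
        by (simp only: eq)
      also have "\<dots> = L2_inner M Z (\<beta> \<circ> X)"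
        unfolding L2_inner_def inner_vec_def inner_real_def comp_def
        using integrable_component_product[OF Z \<beta>X]
        by (intro Bochner_Integration.integral_sum[symmetric]) simp
      finally show "L2_inner ?\<mu> b \<beta> = L2_inner M Z (\<beta> \<circ> X)" .
    qed
  next
    assume inner: "\<forall>\<beta>\<in>L2 ?\<mu>. L2_inner ?\<mu> b \<beta> = L2_inner M Z (\<beta> \<circ> X)"
    have int: "integrable M (\<lambda>\<omega>. f \<omega> $ i)" if "f \<in> L2 M" for f :: "'w \<Rightarrow> real ^ 'n" and i
      using integrable_component_product[OF that L2_const[of "axis i 1"], of i] by (simp add: axis_def)
    have "AE \<omega> in M. b (X \<omega>) $ i = real_cond_exp M ?F (\<lambda>\<omega>. Z \<omega> $ i) \<omega>" for i
    proof -
      have "AE \<omega> in M. real_cond_exp M ?F (\<lambda>\<omega>. Z \<omega> $ i) \<omega> = b (X \<omega>) $ i"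
      proof (rule F.real_cond_exp_charact)
        show "integrable M (\<lambda>\<omega>. Z \<omega> $ i)" by (rule int[OF Z])
        show "integrable M (\<lambda>\<omega>. b (X \<omega>) $ i)" using int[OF bX, of i] by simp
        show "(\<lambda>\<omega>. b (X \<omega>) $ i) \<in> borel_measurable ?F"
          by (rule measurable_compose[OF XF]) measurable
        fix A assume "A \<in> sets ?F"
        then obtain B where [measurable]: "B \<in> sets borel" and A: "A = X -` B \<inter> space M"
          by (auto simp: sets_vimage_algebra2)
        \<comment> \<open>Testing with this field isolates coordinate i on the event that X lies in
          B.\<close>
        define \<beta> :: "real ^ 'n \<Rightarrow> real ^ 'n" where "\<beta> x = indicator B x *\<^sub>R axis i 1" for x
        have \<beta>m [measurable]: "\<beta> \<in> borel_measurable borel" unfolding \<beta>_def by measurable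
        have "\<beta> \<in> L2 ?\<mu>"
          by (rule \<mu>.L2_bounded[of _ 1]) (auto simp: \<beta>_def indicator_def)
        from bspec[OF inner this] have "L2_inner M (b \<circ> X) (\<beta> \<circ> X) = L2_inner M Z (\<beta> \<circ> X)"
          unfolding L2_inner_distr[OF X bm \<beta>m] .
        then have "(\<integral>\<omega>. b (X \<omega>) \<bullet> \<beta> (X \<omega>) \<partial>M) = (\<integral>\<omega>. Z \<omega> \<bullet> \<beta> (X \<omega>) \<partial>M)"
          by (simp add: L2_inner_def)
        moreover have "(\<integral>\<omega>\<in>A. f \<omega> $ i \<partial>M) = (\<integral>\<omega>. f \<omega> \<bullet> \<beta> (X \<omega>) \<partial>M)" for f :: "'w \<Rightarrow> real ^ 'n"
          unfolding set_lebesgue_integral_def A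
          by (intro Bochner_Integration.integral_cong) (auto simp: indicator_def \<beta>_def inner_axis)
        ultimately show "(\<integral>\<omega>\<in>A. Z \<omega> $ i \<partial>M) = (\<integral>\<omega>\<in>A. b (X \<omega>) $ i \<partial>M)" by simp
      qed
      then show ?thesis by eventually_elim simp
    qed
    then show "b \<in> Bar M X Z" using b by (simp add: Bar_def)
  qed
qed

section \<open>The lift\<close>

text \<open>A singleton cannot be split into smaller sets of positive measure. The realisation of
  laws uses non-atomicity in this form.\<close>

lemma non_atomic_null_singleton:
  fixes M :: "'w :: t1_space measure"
  assumes "sets borel \<subseteq> sets M" and "non_atomic M"
  shows "emeasure M {\<omega>} = 0"
proof (rule ccontr)
  assume "emeasure M {\<omega>} \<noteq> 0"
  moreover have "{\<omega>} \<in> sets M" using assms(1) by auto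
  ultimately obtain B where "B \<subseteq> {\<omega>}" "0 < emeasure M B" "emeasure M B < emeasure M {\<omega>}"
    using assms(2) unfolding non_atomic_def by (meson zero_less_iff_neq_zero)
  then show False by (auto simp: subset_singleton_iff)
qed

lemma locally_Lipschitz_lift:
  assumes M: "prob_space M" and X: "X \<in> L2 M" and G: "locally_Lipschitz_around G (distr M borel X)"
  obtains r L where "L2_Lipschitz_around M (lift M G) X r L"
proof -
  obtain r L where r: "0 < r" and Lip: "\<And>\<nu> \<nu>'. \<nu> \<in> P2 \<Longrightarrow> \<nu>' \<in> P2 \<Longrightarrow>
      W2 \<nu> (distr M borel X) < r \<Longrightarrow> W2 \<nu>' (distr M borel X) < r \<Longrightarrow> \<bar>G \<nu> - G \<nu>'\<bar> \<le> L * W2 \<nu> \<nu>'"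
    using G unfolding locally_Lipschitz_around_def by blast
  \<comment> \<open>The constant in \<open>locally_Lipschitz_around\<close> carries no sign
    condition, hence the absolute value.\<close>
  have "L2_Lipschitz_around M (lift M G) X r \<bar>L\<bar>"
  proof
    fix Y Y' assume Y: "Y \<in> L2 M" "L2_norm M (\<lambda>\<omega>. Y \<omega> - X \<omega>) < r"
      and Y': "Y' \<in> L2 M" "L2_norm M (\<lambda>\<omega>. Y' \<omega> - X \<omega>) < r"
    have P: "distr M borel Y \<in> P2" "distr M borel Y' \<in> P2"
      by (intro distr_in_P2[OF M] Y Y')+
    have "\<bar>lift M G Y - lift M G Y'\<bar> \<le> L * W2 (distr M borel Y) (distr M borel Y')"
      unfolding lift_def
      by (rule Lip) (use P W2_le_L2_norm[OF Y(1) X] W2_le_L2_norm[OF Y'(1) X] Y(2) Y'(2) in auto)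
    also have "\<dots> \<le> \<bar>L\<bar> * W2 (distr M borel Y) (distr M borel Y')"
      by (intro mult_right_mono W2_nonneg P) simp
    also have "\<dots> \<le> \<bar>L\<bar> * L2_norm M (\<lambda>\<omega>. Y \<omega> - Y' \<omega>)"
      by (intro mult_left_mono W2_le_L2_norm Y Y') simp
    finally show "\<bar>lift M G Y - lift M G Y'\<bar> \<le> \<bar>L\<bar> * L2_norm M (\<lambda>\<omega>. Y \<omega> - Y' \<omega>)" .
  qed (use X r in auto)
  then show ?thesis by (rule that)
qed

text \<open>The two arguments of F differ by t (w(Y) - w(X)), and composition with w is continuous
  at X, so the Lipschitz bound is an arbitrarily small multiple of t.\<close>

lemma (in L2_Lipschitz_around) freeze_direction:
  assumes M: "finite_measure M" and w: "w \<in> C1_growth" and e: "0 < e"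
  obtains d where "0 < d" and "\<And>t Y. 0 < t \<Longrightarrow> t < d \<Longrightarrow> Y \<in> L2 M \<Longrightarrow>
    L2_norm M (\<lambda>\<omega>. Y \<omega> - X \<omega>) < d \<Longrightarrow>
    \<bar>F (\<lambda>\<omega>. Y \<omega> + t *\<^sub>R w (Y \<omega>)) - F (\<lambda>\<omega>. Y \<omega> + t *\<^sub>R w (X \<omega>))\<bar> \<le> e * t"
proof -
  define \<eta> where "\<eta> = e / (L + 1)"
  have \<eta>: "0 < \<eta>" "L * \<eta> \<le> e"
    using e L by (auto simp: \<eta>_def divide_simps algebra_simps add_nonneg_pos)
  have wL: "(\<lambda>\<omega>. w (Y \<omega>)) \<in> L2 M" if "Y \<in> L2 M" for Y
    using C1_growth_comp_L2[OF M w that] by (simp add: comp_def)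
  obtain d1 where d1: "0 < d1" and c1: "\<And>Y. Y \<in> L2 M \<Longrightarrow> L2_norm M (\<lambda>\<omega>. Y \<omega> - X \<omega>) < d1 \<Longrightarrow>
      L2_norm M (\<lambda>\<omega>. w (Y \<omega>) - w (X \<omega>)) < \<eta>"
    using C1_growth_comp_continuous[OF M w X \<eta>(1)] by blast
  have r2: "0 < r / 2" using r by simp
  obtain d2 where d2: "0 < d2" and c2: "\<And>t Y. 0 < t \<Longrightarrow> t < d2 \<Longrightarrow> Y \<in> L2 M \<Longrightarrow>
      L2_norm M (\<lambda>\<omega>. Y \<omega> - X \<omega>) < d2 \<Longrightarrow> L2_norm M (\<lambda>\<omega>. (Y \<omega> + t *\<^sub>R w (X \<omega>)) - X \<omega>) < r / 2"
    by (rule perturbation_near[OF wL[OF X] r2]) (rule that; blast)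
  \<comment> \<open>The last bound gives t \<eta> < r / 2. As Y + t w(X) is within r / 2 of X, the
    point Y + t w(Y) then also stays in the ball where F is Lipschitz.\<close>
  define d where "d = min (min d1 d2) (r / (2 * \<eta>))"
  show ?thesis
  proof (rule that)
    show "0 < d" using d1 d2 r \<eta> by (simp add: d_def)
    fix t Y assume t: "0 < t" "t < d" and Y: "Y \<in> L2 M" and YX: "L2_norm M (\<lambda>\<omega>. Y \<omega> - X \<omega>) < d"
    have diff: "L2_norm M (\<lambda>\<omega>. (Y \<omega> + t *\<^sub>R w (Y \<omega>)) - (Y \<omega> + t *\<^sub>R w (X \<omega>))) \<le> t * \<eta>"
    proof -
      have "(\<lambda>\<omega>. (Y \<omega> + t *\<^sub>R w (Y \<omega>)) - (Y \<omega> + t *\<^sub>R w (X \<omega>))) = (\<lambda>\<omega>. t *\<^sub>R (w (Y \<omega>) - w (X \<omega>)))"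
        by (simp add: algebra_simps)
      moreover have "L2_norm M (\<lambda>\<omega>. w (Y \<omega>) - w (X \<omega>)) < \<eta>"
        by (rule c1) (use Y YX in \<open>auto simp: d_def\<close>)
      ultimately show ?thesis using t by (simp only: L2_norm_scaleR) (simp add: mult_left_mono)
    qed
    have near: "L2_norm M (\<lambda>\<omega>. (Y \<omega> + t *\<^sub>R w (X \<omega>)) - X \<omega>) < r / 2"
      by (rule c2) (use t Y YX in \<open>auto simp: d_def\<close>)
    have L2s: "(\<lambda>\<omega>. Y \<omega> + t *\<^sub>R w (Y \<omega>)) \<in> L2 M" "(\<lambda>\<omega>. Y \<omega> + t *\<^sub>R w (X \<omega>)) \<in> L2 M"
      by (intro L2_intros wL X Y)+
    have "t * \<eta> < r / 2"
      using t \<eta>(1) by (simp add: d_def field_simps)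
    then have near': "L2_norm M (\<lambda>\<omega>. (Y \<omega> + t *\<^sub>R w (Y \<omega>)) - X \<omega>) < r"
      using L2_norm_triangle_diff[OF L2s X] diff near by linarith
    have "\<bar>F (\<lambda>\<omega>. Y \<omega> + t *\<^sub>R w (Y \<omega>)) - F (\<lambda>\<omega>. Y \<omega> + t *\<^sub>R w (X \<omega>))\<bar>
        \<le> L * L2_norm M (\<lambda>\<omega>. (Y \<omega> + t *\<^sub>R w (Y \<omega>)) - (Y \<omega> + t *\<^sub>R w (X \<omega>)))"
      by (rule Lipschitz[OF L2s near']) (use near r in simp)
    also have "\<dots> \<le> L * (t * \<eta>)" by (intro mult_left_mono diff L)
    also have "\<dots> = (L * \<eta>) * t" by simp
    also have "\<dots> \<le> e * t" by (intro mult_right_mono \<eta>) (use t in simp)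
    finally show "\<bar>F (\<lambda>\<omega>. Y \<omega> + t *\<^sub>R w (Y \<omega>)) - F (\<lambda>\<omega>. Y \<omega> + t *\<^sub>R w (X \<omega>))\<bar> \<le> e * t" .
  qed
qed

lemma lift_push_forward:
  assumes [measurable]: "Y \<in> borel_measurable M" "w \<in> borel_measurable borel"
  shows "G (distr (distr M borel Y) borel (\<lambda>x. x + t *\<^sub>R w x)) = lift M G (\<lambda>\<omega>. Y \<omega> + t *\<^sub>R w (Y \<omega>))"
  by (simp add: lift_def distr_distr comp_def)

lemma Clarke_deriv_C1_eq_lift:
  fixes M :: "'w :: {second_countable_topology, t2_space} measure" and X :: "'w \<Rightarrow> real ^ 'n"
  assumes M: "prob_space M" "sets borel \<subseteq> sets M" "non_atomic M"
    and X: "X \<in> L2 M" and G: "locally_Lipschitz_around G (distr M borel X)" and w: "w \<in> C1_growth"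
  shows "Clarke_deriv_C1 G (distr M borel X) w = L2_Clarke_deriv M (lift M G) X (w \<circ> X)"
proof (rule ereal_eq_if_same_upper_bounds)
  fix c :: real
  have null: "emeasure M {\<omega>} = 0" for \<omega> by (rule non_atomic_null_singleton[OF M(2,3)])
  have fin: "finite_measure M" using M(1) by (rule prob_space.finite_measure)
  obtain r L where "L2_Lipschitz_around M (lift M G) X r L"
    using locally_Lipschitz_lift[OF M(1) X G] by blast
  then interpret L2_Lipschitz_around M "lift M G" X r L .
  note push = lift_push_forward[OF L2_measurable C1_growth_measurable[OF w], of _ M G]
  show "Clarke_deriv_C1 G (distr M borel X) w \<le> ereal c \<longleftrightarrow>
      L2_Clarke_deriv M (lift M G) X (w \<circ> X) \<le> ereal c"
    unfolding Clarke_deriv_C1_le_iff L2_Clarke_deriv_le_iff comp_def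
  proof (intro iffI allI impI, goal_cases)
    \<comment> \<open>From laws to the lift: Y near X has a law near \<mu>, and pushing that law
      forward by the identity plus t w gives the law of Y + t w(Y). Half of e pays for freezing the
      direction.\<close>
    case (1 e)
    then have e2: "0 < e / 2" by simp
    obtain d1 where d1: "0 < d1" and le: "\<And>\<nu> t. 0 < t \<Longrightarrow> t < d1 \<Longrightarrow> \<nu> \<in> P2 \<Longrightarrow>
        W2 \<nu> (distr M borel X) < d1 \<Longrightarrow>
        G (distr \<nu> borel (\<lambda>x. x + t *\<^sub>R w x)) - G \<nu> \<le> (c + e / 2) * t"
      using 1(1) e2 by blast
    obtain d2 where d2: "0 < d2" and freeze: "\<And>t Y. 0 < t \<Longrightarrow> t < d2 \<Longrightarrow> Y \<in> L2 M \<Longrightarrow>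
        L2_norm M (\<lambda>\<omega>. Y \<omega> - X \<omega>) < d2 \<Longrightarrow>
        \<bar>lift M G (\<lambda>\<omega>. Y \<omega> + t *\<^sub>R w (Y \<omega>)) - lift M G (\<lambda>\<omega>. Y \<omega> + t *\<^sub>R w (X \<omega>))\<bar> \<le> e / 2 * t"
      using freeze_direction[OF fin w e2] by blast
    have "lift M G (\<lambda>\<omega>. Y \<omega> + t *\<^sub>R w (X \<omega>)) - lift M G Y \<le> (c + e) * t"
      if t: "0 < t" "t < min d1 d2" and Y: "Y \<in> L2 M"
        and YX: "L2_norm M (\<lambda>\<omega>. Y \<omega> - X \<omega>) < min d1 d2" for t Y
    proof -
      have "lift M G (\<lambda>\<omega>. Y \<omega> + t *\<^sub>R w (Y \<omega>)) - lift M G Y \<le> (c + e / 2) * t"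
        using le[of t "distr M borel Y"] t YX W2_le_L2_norm[OF Y X] distr_in_P2[OF M(1) Y]
        unfolding push[OF Y] by (simp add: lift_def)
      moreover have "\<bar>lift M G (\<lambda>\<omega>. Y \<omega> + t *\<^sub>R w (Y \<omega>)) - lift M G (\<lambda>\<omega>. Y \<omega> + t *\<^sub>R w (X \<omega>))\<bar> \<le> e / 2 * t"
        by (rule freeze) (use t Y YX in auto)
      moreover have "(c + e) * t = (c + e / 2) * t + e / 2 * t" by (simp add: algebra_simps)
      ultimately show ?thesis by linarith
    qed
    then show ?case using d1 d2 by (intro exI[of _ "min d1 d2"]) auto
  next
    case (2 e)
    then have e2: "0 < e / 2" by simp
    obtain d1 where d1: "0 < d1" and le: "\<And>t Y. 0 < t \<Longrightarrow> t < d1 \<Longrightarrow> Y \<in> L2 M \<Longrightarrow>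
        L2_norm M (\<lambda>\<omega>. Y \<omega> - X \<omega>) < d1 \<Longrightarrow>
        lift M G (\<lambda>\<omega>. Y \<omega> + t *\<^sub>R w (X \<omega>)) - lift M G Y \<le> (c + e / 2) * t"
      using 2(1) e2 by blast
    obtain d2 where d2: "0 < d2" and freeze: "\<And>t Y. 0 < t \<Longrightarrow> t < d2 \<Longrightarrow> Y \<in> L2 M \<Longrightarrow>
        L2_norm M (\<lambda>\<omega>. Y \<omega> - X \<omega>) < d2 \<Longrightarrow>
        \<bar>lift M G (\<lambda>\<omega>. Y \<omega> + t *\<^sub>R w (Y \<omega>)) - lift M G (\<lambda>\<omega>. Y \<omega> + t *\<^sub>R w (X \<omega>))\<bar> \<le> e / 2 * t"
      using freeze_direction[OF fin w e2] by blast
    \<comment> \<open>From the lift to laws: the realisation of a law within d of \<mu> is only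
      known to be within 3 d of X.\<close>
    define d where "d = min d1 d2 / 3"
    have d: "0 < d" "3 * d \<le> d1" "3 * d \<le> d2" using d1 d2 by (auto simp: d_def)
    have "G (distr \<nu> borel (\<lambda>x. x + t *\<^sub>R w x)) - G \<nu> \<le> (c + e) * t"
      if t: "0 < t" "t < d" and \<nu>: "\<nu> \<in> P2" and W: "W2 \<nu> (distr M borel X) < d" for \<nu> t
    proof -
      obtain Y where Y: "Y \<in> L2 M" and law: "distr M borel Y = \<nu>"
        and YX: "L2_norm M (\<lambda>\<omega>. Y \<omega> - X \<omega>) < 3 * d"
        using ex_near_realisation[OF M(1,2) null X \<nu> W] by blast
      have "lift M G (\<lambda>\<omega>. Y \<omega> + t *\<^sub>R w (X \<omega>)) - lift M G Y \<le> (c + e / 2) * t"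
        by (rule le) (use t d Y YX in auto)
      moreover have "\<bar>lift M G (\<lambda>\<omega>. Y \<omega> + t *\<^sub>R w (Y \<omega>)) - lift M G (\<lambda>\<omega>. Y \<omega> + t *\<^sub>R w (X \<omega>))\<bar> \<le> e / 2 * t"
        by (rule freeze) (use t d Y YX in auto)
      moreover have "(c + e) * t = (c + e / 2) * t + e / 2 * t" by (simp add: algebra_simps)
      moreover have "G (distr \<nu> borel (\<lambda>x. x + t *\<^sub>R w x)) = lift M G (\<lambda>\<omega>. Y \<omega> + t *\<^sub>R w (Y \<omega>))"
        "G \<nu> = lift M G Y"
        using push[OF Y] by (simp_all add: law lift_def)
      ultimately show ?thesis by linarith
    qed
    then show ?case using d(1) by blast
  qed
qed

text \<open>\<open>Clarke_deriv\<close> is a definite description, so existence and uniqueness are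
  both due. Composition with X preserves the norm, hence the Lipschitz dependence on the direction
  gives continuity of the candidate E; density of \<open>C1_growth\<close> gives uniqueness. The
  value 0 off \<open>L2 \<mu>\<close> follows the normalisation in the definition.\<close>

lemma Clarke_deriv_eq_lift:
  fixes M :: "'w :: {second_countable_topology, t2_space} measure" and X :: "'w \<Rightarrow> real ^ 'n"
  assumes M: "prob_space M" "sets borel \<subseteq> sets M" "non_atomic M"
    and X: "X \<in> L2 M" and G: "locally_Lipschitz_around G (distr M borel X)"
    and \<beta>: "\<beta> \<in> L2 (distr M borel X)"
  shows "Clarke_deriv G (distr M borel X) \<beta> = L2_Clarke_deriv M (lift M G) X (\<beta> \<circ> X)"
proof -
  define \<mu> where "\<mu> = distr M borel X"
  have Xm [measurable]: "X \<in> borel_measurable M" using X by (rule L2_measurable)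
  have P: "\<mu> \<in> P2" unfolding \<mu>_def by (rule distr_in_P2[OF M(1) X])
  have C1: "C1_growth \<subseteq> L2 \<mu>" by (rule C1_growth_subset_L2[OF P])
  have fin: "finite_measure \<mu>" and sets: "sets \<mu> = sets borel"
    using P by (auto simp: P2_def prob_space.finite_measure)
  obtain r L where "L2_Lipschitz_around M (lift M G) X r L"
    using locally_Lipschitz_lift[OF M(1) X G] by blast
  then interpret L2_Lipschitz_around M "lift M G" X r L .
  have L2X: "\<eta> \<circ> X \<in> L2 M" if "\<eta> \<in> L2 \<mu>" for \<eta> :: "real ^ 'n \<Rightarrow> real ^ 'n"
    using L2_distr[OF Xm] that by (simp add: \<mu>_def)
  have normX: "L2_norm \<mu> (\<lambda>x. \<eta> x - \<zeta> x) = L2_norm M (\<lambda>\<omega>. (\<eta> \<circ> X) \<omega> - (\<zeta> \<circ> X) \<omega>)"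
    if "\<eta> \<in> L2 \<mu>" "\<zeta> \<in> L2 \<mu>" for \<eta> \<zeta> :: "real ^ 'n \<Rightarrow> real ^ 'n"
  proof -
    have "(\<lambda>x. \<eta> x - \<zeta> x) \<in> borel_measurable borel"
      using L2_measurable[OF L2_diff[OF that]] sets by (simp cong: measurable_cong_sets)
    from L2_norm_distr[OF Xm this] show ?thesis by (simp add: \<mu>_def comp_def)
  qed
  define E where "E \<eta> = (if \<eta> \<in> L2 \<mu> then L2_Clarke_deriv M (lift M G) X (\<eta> \<circ> X) else 0)" for \<eta>
  let ?ext = "\<lambda>E. (\<forall>w\<in>C1_growth. E w = Clarke_deriv_C1 G \<mu> w) \<and>
    (\<forall>\<beta>\<in>L2 \<mu>. (E \<longlongrightarrow> E \<beta>) (L2_nhds \<mu> \<beta>)) \<and> (\<forall>\<beta>. \<beta> \<notin> L2 \<mu> \<longrightarrow> E \<beta> = 0)"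
  have "Clarke_deriv G \<mu> = E"
    unfolding Clarke_deriv_def
  proof (rule the_equality)
    have cont: "(E \<longlongrightarrow> E \<eta>) (L2_nhds \<mu> \<eta>)" if \<eta>: "\<eta> \<in> L2 \<mu>" for \<eta>
    proof -
      have "((\<lambda>\<zeta>. dirderiv (\<zeta> \<circ> X)) \<longlongrightarrow> dirderiv (\<eta> \<circ> X)) (L2_nhds \<mu> \<eta>)"
      proof (rule tendstoI)
        fix e :: real assume e: "0 < e"
        have "dist (dirderiv (\<zeta> \<circ> X)) (dirderiv (\<eta> \<circ> X)) < e"
          if \<zeta>: "\<zeta> \<in> L2 \<mu>" and close: "L2_norm \<mu> (\<lambda>x. \<zeta> x - \<eta> x) < e / (L + 1)" for \<zeta>
        proof -
          have "\<bar>dirderiv (\<zeta> \<circ> X) - dirderiv (\<eta> \<circ> X)\<bar> \<le> L * L2_norm \<mu> (\<lambda>x. \<zeta> x - \<eta> x)"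
            using dirderiv_Lipschitz[OF L2X[OF \<zeta>] L2X[OF \<eta>]] dirderiv_Lipschitz[OF L2X[OF \<eta>] L2X[OF \<zeta>]]
              L2_norm_diff_commute[of M "\<zeta> \<circ> X" "\<eta> \<circ> X"]
            by (simp add: normX[OF \<zeta> \<eta>] abs_le_iff)
          also have "\<dots> \<le> L * (e / (L + 1))" by (intro mult_left_mono less_imp_le close L)
          also have "\<dots> < e" using e L by (simp add: field_simps)
          finally show ?thesis by (simp add: dist_real_def)
        qed
        then show "eventually (\<lambda>\<zeta>. dist (dirderiv (\<zeta> \<circ> X)) (dirderiv (\<eta> \<circ> X)) < e) (L2_nhds \<mu> \<eta>)"
          unfolding eventually_L2_nhds using e L by (intro exI[of _ "e / (L + 1)"]) auto
      qed
      then have "((\<lambda>\<zeta>. ereal (dirderiv (\<zeta> \<circ> X))) \<longlongrightarrow> E \<eta>) (L2_nhds \<mu> \<eta>)"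
        using \<eta> by (simp add: E_def Clarke_deriv_eq[OF L2X[OF \<eta>]])
      moreover have "eventually (\<lambda>\<zeta>. ereal (dirderiv (\<zeta> \<circ> X)) = E \<zeta>) (L2_nhds \<mu> \<eta>)"
        unfolding eventually_L2_nhds
        by (intro exI[of _ 1]) (auto simp: E_def Clarke_deriv_eq[OF L2X])
      ultimately show ?thesis by (rule Lim_transform_eventually)
    qed
    show ext: "?ext E"
      using cont C1 Clarke_deriv_C1_eq_lift[OF M X G] by (auto simp: E_def \<mu>_def)
    fix E' assume ext': "?ext E'"
    show "E' = E"
    proof
      fix \<eta>
      show "E' \<eta> = E \<eta>"
      proof (cases "\<eta> \<in> L2 \<mu>")
        case True
        show ?thesis
        proof (rule ccontr)
          assume "E' \<eta> \<noteq> E \<eta>"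
          \<comment> \<open>Disjoint neighbourhoods would keep the two maps apart on a whole ball,
            which contains an element of \<open>C1_growth\<close>, where they agree.\<close>
          then obtain U V where UV: "open U" "open V" "E' \<eta> \<in> U" "E \<eta> \<in> V" "U \<inter> V = {}"
            by (metis hausdorff)
          have "eventually (\<lambda>\<zeta>. E' \<zeta> \<in> U) (L2_nhds \<mu> \<eta>)" "eventually (\<lambda>\<zeta>. E \<zeta> \<in> V) (L2_nhds \<mu> \<eta>)"
            using ext ext' True UV by (auto intro: topological_tendstoD)
          then have "eventually (\<lambda>\<zeta>. E' \<zeta> \<in> U \<and> E \<zeta> \<in> V) (L2_nhds \<mu> \<eta>)"
            by (rule eventually_conj)
          then obtain e where e: "0 < e" "\<And>\<zeta>. \<zeta> \<in> L2 \<mu> \<Longrightarrow> L2_norm \<mu> (\<lambda>x. \<zeta> x - \<eta> x) < e \<Longrightarrow>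
              E' \<zeta> \<in> U \<and> E \<zeta> \<in> V"
            unfolding eventually_L2_nhds by blast
          obtain w where w: "w \<in> C1_growth" "w \<in> L2 \<mu>" "L2_norm \<mu> (\<lambda>x. w x - \<eta> x) < e"
            using C1_growth_dense[OF fin sets True e(1)] by blast
          have "E' w = E w" using ext ext' w(1) by simp
          then show False using e(2)[OF w(2,3)] UV(5) by auto
        qed
      qed (use ext ext' in auto)
    qed
  qed
  then show ?thesis using \<beta> by (simp add: E_def \<mu>_def)
qed

theorem proposition4p6:
  fixes M :: "'w :: polish_space measure"
    and G :: "(real ^ 'n) measure \<Rightarrow> real"
    and \<mu> :: "(real ^ 'n) measure"
    and X :: "'w \<Rightarrow> real ^ 'n"
  assumes "prob_space M" and "space M = UNIV" and "sets borel \<subseteq> sets M"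
    and "complete_measure M" and "non_atomic M"
    and "\<mu> \<in> P2" and "locally_Lipschitz_around G \<mu>"
    and "X \<in> L2 M" and "distr M borel X = \<mu>"
  shows "(\<forall>\<beta>\<in>L2 \<mu>. L2_Clarke_deriv M (lift M G) X (\<beta> \<circ> X) = Clarke_deriv G \<mu> \<beta>) \<and>
         Clarke_subdiff G \<mu> = (\<Union>Z\<in>L2_Clarke_subdiff M (lift M G) X. Bar M X Z)"
proof (intro conjI ballI equalityI subsetI)
  have G: "locally_Lipschitz_around G (distr M borel X)" using assms by simp
  note M = \<open>prob_space M\<close> \<open>sets borel \<subseteq> sets M\<close> \<open>non_atomic M\<close>
  note X = \<open>X \<in> L2 M\<close>
  note P = \<open>\<mu> \<in> P2\<close>
  have law: "distr M borel X = \<mu>" by fact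
  have Xm [measurable]: "X \<in> borel_measurable M" using X by (rule L2_measurable)
  have C1: "C1_growth \<subseteq> L2 \<mu>" by (rule C1_growth_subset_L2[OF P])
  have fin: "finite_measure \<mu>" and sets: "sets \<mu> = sets borel"
    using P by (auto simp: P2_def prob_space.finite_measure)
  have bm: "\<eta> \<in> borel_measurable borel" if "\<eta> \<in> L2 \<mu>" for \<eta> :: "real ^ 'n \<Rightarrow> real ^ 'n"
    using L2_measurable[OF that] sets by (simp cong: measurable_cong_sets)
  have L2X: "\<eta> \<circ> X \<in> L2 M" if "\<eta> \<in> L2 \<mu>" for \<eta> :: "real ^ 'n \<Rightarrow> real ^ 'n"
    using L2_distr[OF Xm] that by (simp add: law)
  have innerX: "L2_inner \<mu> \<eta> \<zeta> = L2_inner M (\<eta> \<circ> X) (\<zeta> \<circ> X)" if "\<eta> \<in> L2 \<mu>" "\<zeta> \<in> L2 \<mu>"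
    for \<eta> \<zeta> :: "real ^ 'n \<Rightarrow> real ^ 'n"
    using L2_inner_distr[OF Xm bm[OF that(1)] bm[OF that(2)]] by (simp add: law)
  have normX: "L2_norm \<mu> \<eta> = L2_norm M (\<eta> \<circ> X)" if "\<eta> \<in> L2 \<mu>" for \<eta> :: "real ^ 'n \<Rightarrow> real ^ 'n"
    using L2_norm_distr[OF Xm bm[OF that]] by (simp add: law)
  note deriv_C1 = Clarke_deriv_C1_eq_lift[OF M X G, unfolded law]
  note Bar_iff = Bar_iff_inner[OF M(1) Xm, unfolded law]
  {
    fix \<beta> :: "real ^ 'n \<Rightarrow> real ^ 'n" assume "\<beta> \<in> L2 \<mu>"
    then show "L2_Clarke_deriv M (lift M G) X (\<beta> \<circ> X) = Clarke_deriv G \<mu> \<beta>"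
      using Clarke_deriv_eq_lift[OF M X G] by (simp add: law)
  next
    fix \<Xi> :: "real ^ 'n \<Rightarrow> real ^ 'n" assume "\<Xi> \<in> (\<Union>Z\<in>L2_Clarke_subdiff M (lift M G) X. Bar M X Z)"
    then obtain Z where Z: "Z \<in> L2_Clarke_subdiff M (lift M G) X" and \<Xi>: "\<Xi> \<in> Bar M X Z" by blast
    have ZL: "Z \<in> L2 M" and Zle: "\<And>V. V \<in> L2 M \<Longrightarrow> ereal (L2_inner M Z V) \<le> L2_Clarke_deriv M (lift M G) X V"
      using Z by (auto simp: L2_Clarke_subdiff_def)
    have \<Xi>L: "\<Xi> \<in> L2 \<mu>" using \<Xi> by (simp add: Bar_def law)
    have "ereal (L2_inner \<mu> \<Xi> w) \<le> Clarke_deriv_C1 G \<mu> w" if w: "w \<in> C1_growth" for w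
    proof -
      have wL: "w \<in> L2 \<mu>" using w C1 by blast
      have "L2_inner \<mu> \<Xi> w = L2_inner M Z (w \<circ> X)"
        using \<Xi> wL unfolding Bar_iff[OF ZL \<Xi>L] by blast
      then show ?thesis using Zle[OF L2X[OF wL]] by (simp add: deriv_C1[OF w])
    qed
    then show "\<Xi> \<in> Clarke_subdiff G \<mu>" using \<Xi>L by (simp add: Clarke_subdiff_def)
  next
    fix \<Xi> :: "real ^ 'n \<Rightarrow> real ^ 'n" assume "\<Xi> \<in> Clarke_subdiff G \<mu>"
    then have \<Xi>L: "\<Xi> \<in> L2 \<mu>"
      and \<Xi>le: "\<And>w. w \<in> C1_growth \<Longrightarrow> ereal (L2_inner \<mu> \<Xi> w) \<le> Clarke_deriv_C1 G \<mu> w"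
      by (auto simp: Clarke_subdiff_def)
    obtain r L where "L2_Lipschitz_around M (lift M G) X r L"
      using locally_Lipschitz_lift[OF M(1) X G] by blast
    then interpret L2_Lipschitz_around M "lift M G" X r L .
    \<comment> \<open>The subdifferential tests continuous fields only; as both sides are Lipschitz
      in \<beta>, density extends the bound to every element of S.\<close>
    have le: "L2_inner \<mu> \<Xi> \<beta> \<le> dirderiv (\<beta> \<circ> X)" if \<beta>: "\<beta> \<in> L2 \<mu>" for \<beta> :: "real ^ 'n \<Rightarrow> real ^ 'n"
    proof (rule field_le_epsilon)
      fix e :: real assume e: "0 < e"
      \<comment> \<open>The Lipschitz constants of the two sides, plus 1 to make K positive.\<close>
      define K where "K = L + L2_norm \<mu> \<Xi> + 1"
      have K: "0 < K" using L L2_norm_nonneg[of \<mu> \<Xi>] by (simp add: K_def)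
      obtain w where w: "w \<in> C1_growth" "w \<in> L2 \<mu>" and close: "L2_norm \<mu> (\<lambda>x. w x - \<beta> x) < e / K"
        using C1_growth_dense[OF fin sets \<beta>, of "e / K"] e K by auto
      let ?N = "L2_norm \<mu> (\<lambda>x. w x - \<beta> x)"
      have "L2_inner \<mu> \<Xi> \<beta> = L2_inner \<mu> \<Xi> w - L2_inner \<mu> \<Xi> (\<lambda>x. w x - \<beta> x)"
        by (simp add: L2_inner_diff_right \<Xi>L w(2) \<beta>)
      also have "L2_inner \<mu> \<Xi> w \<le> dirderiv (w \<circ> X)"
        using \<Xi>le[OF w(1)] by (simp add: deriv_C1[OF w(1)] Clarke_deriv_eq[OF L2X[OF w(2)]])
      also have "dirderiv (w \<circ> X) \<le> dirderiv (\<beta> \<circ> X) + L * ?N"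
        using dirderiv_Lipschitz[OF L2X[OF w(2)] L2X[OF \<beta>]] normX[OF L2_diff[OF w(2) \<beta>]]
        by (simp add: comp_def)
      finally have "L2_inner \<mu> \<Xi> \<beta> \<le> dirderiv (\<beta> \<circ> X) + (L * ?N + L2_norm \<mu> \<Xi> * ?N)"
        using L2_Cauchy_Schwarz[OF \<Xi>L L2_diff[OF w(2) \<beta>]] by linarith
      also have "L * ?N + L2_norm \<mu> \<Xi> * ?N \<le> K * ?N"
        using L2_norm_nonneg[of \<mu> "\<lambda>x. w x - \<beta> x"] by (simp add: K_def algebra_simps)
      also have "K * ?N \<le> e" using close K by (simp add: field_simps)
      finally show "L2_inner \<mu> \<Xi> \<beta> \<le> dirderiv (\<beta> \<circ> X) + e" by (simp add: comp_def)
    qed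
    \<comment> \<open>The square-integrable maps that factor through X. By
      \<open>Bar_iff_inner\<close> the inner products with them decide whether \<Xi> lies in
      \<open>Bar M X Z\<close>.\<close>
    define S where "S = (\<lambda>\<beta> :: real ^ 'n \<Rightarrow> real ^ 'n. \<beta> \<circ> X) ` L2 \<mu>"
    have "\<exists>Z\<in>L2 M. (\<forall>V\<in>L2 M. L2_inner M Z V \<le> dirderiv V) \<and>
        (\<forall>U\<in>S. L2_inner M Z U = L2_inner M (\<Xi> \<circ> X) U)"
    proof (rule L2_Hahn_Banach[of M dirderiv L "S" "\<Xi> \<circ> X"])
      show "S \<subseteq> L2 M" using L2X by (auto simp: S_def)
      show "(\<lambda>\<omega>. 0) \<in> S"
        unfolding S_def by (rule image_eqI[OF _ L2_zero]) (simp add: comp_def)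
      show "\<Xi> \<circ> X \<in> L2 M" by (rule L2X[OF \<Xi>L])
      show "L2_inner M (\<Xi> \<circ> X) U \<le> dirderiv U" if "U \<in> S" for U
        using that le innerX[OF \<Xi>L] by (auto simp: S_def)
      show "(\<lambda>x. U x + V x) \<in> S"
        if UV: "U \<in> S" "V \<in> S" for U V
      proof -
        obtain \<beta> \<eta> where "\<beta> \<in> L2 \<mu>" "\<eta> \<in> L2 \<mu>" "U = \<beta> \<circ> X" "V = \<eta> \<circ> X" using UV by (auto simp: S_def)
        then show ?thesis unfolding S_def by (intro image_eqI[OF _ L2_add[of \<beta> \<mu> \<eta>]]) (auto simp: comp_def)
      qed
      show "(\<lambda>x. c *\<^sub>R U x) \<in> S" if U: "U \<in> S" for U c
      proof -
        obtain \<beta> where "\<beta> \<in> L2 \<mu>" "U = \<beta> \<circ> X" using U by (auto simp: S_def)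
        then show ?thesis unfolding S_def by (intro image_eqI[OF _ L2_scaleR[of \<beta> \<mu> c]]) (auto simp: comp_def)
      qed
    qed (blast intro: dirderiv_add dirderiv_scale dirderiv_bounds(1))+
    then obtain Z where Z: "Z \<in> L2 M" "\<And>V. V \<in> L2 M \<Longrightarrow> L2_inner M Z V \<le> dirderiv V"
      and Z\<Xi>: "\<And>\<beta>. \<beta> \<in> L2 \<mu> \<Longrightarrow> L2_inner M Z (\<beta> \<circ> X) = L2_inner M (\<Xi> \<circ> X) (\<beta> \<circ> X)" by (auto simp: S_def)
    have "Z \<in> L2_Clarke_subdiff M (lift M G) X"
      using Z by (auto simp: L2_Clarke_subdiff_def Clarke_deriv_eq)
    moreover have "\<Xi> \<in> Bar M X Z"
      unfolding Bar_iff[OF Z(1) \<Xi>L] using Z\<Xi> innerX[OF \<Xi>L] by simp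
    ultimately show "\<Xi> \<in> (\<Union>Z\<in>L2_Clarke_subdiff M (lift M G) X. Bar M X Z)" by blast
  }
qed

end
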